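(* Let $\mathbb K$ be a number field of degree $\kappa=[\mathbb K:\mathbb Q]$ with ring of integers $\mathbb Z_{\mathbb K}$. Let $m\in\mathbb Z_{\ge1}$ and let $\alpha_1,\ldots,\alpha_m\in\mathbb Z_{\mathbb K}\setminus\{0\}$ be pairwise distinct. Let $H$ satisfy $\log H\ge s e^s$, where $s=\max\{e^\kappa+1,\ c_1+1,\ (m+3)^2+1\}$. Suppose $\lambda_0,\lambda_1,\ldots,\lambda_m\in\mathbb Z_{\mathbb K}$ are not all zero and $$\prod_{v\in V_\infty}\max_{0\le i\le m}\{\|\lambda_i\|_v\}\le H.$$ Then there exists a prime $$p\in\Big]\log\Big(\frac{\log H}{\log\log H}\Big),\ \frac{17m\log H}{\log\log H}\Big[$$ and a non-Archimedean place $v'\mid p$ of $\mathbb K$ for which $$\big\|\lambda_0+\lambda_1F_{v'}(\alpha_1)+\cdots+\lambda_mF_{v'}(\alpha_m)\big\|_{v'}>H^{-(m+1)-114m^2\cdot\frac{\log\log\log H}{\log\log H}}.$$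
   Context: Places and normalisation: $V_\infty$ denotes the set of pairwise non-equivalent Archimedean places of $\mathbb K$. For a non-Archimedean place $v$ over a prime $p$ (written $v\mid p$), $|\cdot|_v$ extends the $p$-adic absolute value with $|p|_v=1/p$, $\mathbb K_v$ is the completion, $\kappa_v=[\mathbb K_v:\mathbb Q_p]$, and $\|x\|_v=|x|_v^{\kappa_v/\kappa}$. For an Archimedean place $v$ corresponding to an embedding $x\mapsto x^{(i)}$ of $\mathbb K$ into $\mathbb C$, $\kappa_v=[\mathbb K_v:\mathbb R]$ and $\|x\|_v=|x^{(i)}|^{\kappa_v/\kappa}$. For non-Archimedean $v$ and $\alpha\in\mathbb Z_{\mathbb K}$, $F_v(\alpha)$ denotes the sum in $\mathbb K_v$ of the convergent series $\sum_{n=0}^\infty n!\,\alpha^n$. The constant $$c_1=\prod_{v\in V_\infty}\Big(\big(\max_{1\le j\le m}\{1,\|\alpha_j\|_v\}\big)^m\prod_{i=1}^m\big(\|\alpha_i\|_v+\max_{1\le j\le m}\{1,\|\alpha_j\|_v\}\big)\Big).$$ *)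

theory Defs
  imports
    "HOL-Algebra.Embedded_Algebras"
    "HOL-Algebra.QuotRing"
    "HOL-Computational_Algebra.Computational_Algebra"
    Complex_Main
begin

section \<open>Number fields\<close>

global_interpretation rat_vs: vector_space "\<lambda>(q::rat) (x::'a::field_char_0). of_rat q * x"
  by unfold_locales (simp_all add: algebra_simps of_rat_add of_rat_mult)

definition number_field :: "'k::field_char_0 itself \<Rightarrow> bool" where
  "number_field _ \<longleftrightarrow> (\<exists>B::'k set. finite B \<and> rat_vs.span B = UNIV)"

definition nf_degree :: "'k::field_char_0 itself \<Rightarrow> nat" where
  "nf_degree _ = rat_vs.dim (UNIV :: 'k set)"


section \<open>Absolute values and completions\<close>

definition absolute_value :: "('k::field_char_0 \<Rightarrow> real) \<Rightarrow> bool" where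
  "absolute_value w \<longleftrightarrow>
     (\<forall>x. w x \<ge> 0) \<and> (\<forall>x. w x = 0 \<longleftrightarrow> x = 0) \<and>
     (\<forall>x y. w (x * y) = w x * w y) \<and> (\<forall>x y. w (x + y) \<le> w x + w y)"

definition cauchy_seq :: "('k::field_char_0 \<Rightarrow> real) \<Rightarrow> (nat \<Rightarrow> 'k) \<Rightarrow> bool" where
  "cauchy_seq w x \<longleftrightarrow> (\<forall>e>0. \<exists>N. \<forall>i\<ge>N. \<forall>j\<ge>N. w (x i - x j) < e)"

definition cauchy_ring :: "('k::field_char_0 \<Rightarrow> real) \<Rightarrow> (nat \<Rightarrow> 'k) ring" where
  "cauchy_ring w =
     \<lparr>carrier = {x. cauchy_seq w x},
      monoid.mult = (\<lambda>x y n. x n * y n), one = (\<lambda>_. 1),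
      zero = (\<lambda>_. 0), add = (\<lambda>x y n. x n + y n)\<rparr>"

definition null_seqs :: "('k::field_char_0 \<Rightarrow> real) \<Rightarrow> (nat \<Rightarrow> 'k) set" where
  "null_seqs w = {x. (\<lambda>n. w (x n)) \<longlonglongrightarrow> 0}"

text \<open>
  For an absolute value \<open>w\<close>, the completion \<open>K\<^sub>w\<close> is the ring of Cauchy sequences modulo
  the ideal of null sequences; its elements are cosets of sequences.
\<close>

definition completion :: "('k::field_char_0 \<Rightarrow> real) \<Rightarrow> (nat \<Rightarrow> 'k) set ring" where
  "completion w = cauchy_ring w Quot null_seqs w"

definition embed :: "('k::field_char_0 \<Rightarrow> real) \<Rightarrow> 'k \<Rightarrow> (nat \<Rightarrow> 'k) set" where
  "embed w a = null_seqs w +>\<^bsub>cauchy_ring w\<^esub> (\<lambda>_. a)"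

definition completion_abs :: "('k::field_char_0 \<Rightarrow> real) \<Rightarrow> (nat \<Rightarrow> 'k) set \<Rightarrow> real" where
  "completion_abs w X = (THE r. \<forall>x\<in>X. (\<lambda>n. w (x n)) \<longlonglongrightarrow> r)"

text \<open>
  The closure of \<open>\<rat>\<close> in \<open>K\<^sub>w\<close>: a copy of \<open>\<rat>\<^sub>p\<close> if \<open>w\<close> extends the \<open>p\<close>-adic absolute value,
  and a copy of \<open>\<real>\<close> if \<open>w\<close> extends the usual one.
\<close>

definition rat_completion :: "('k::field_char_0 \<Rightarrow> real) \<Rightarrow> (nat \<Rightarrow> 'k) set set" where
  "rat_completion w =
     {null_seqs w +>\<^bsub>cauchy_ring w\<^esub> x | x. cauchy_seq w x \<and> range x \<subseteq> \<rat>}"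

definition local_degree :: "('k::field_char_0 \<Rightarrow> real) \<Rightarrow> nat" where
  "local_degree w = ring.dim (completion w) (rat_completion w) (carrier (completion w))"

definition place_norm :: "('k::field_char_0 \<Rightarrow> real) \<Rightarrow> 'k \<Rightarrow> real" where
  "place_norm w x = w x powr (real (local_degree w) / real (nf_degree TYPE('k)))"

definition completion_norm :: "('k::field_char_0 \<Rightarrow> real) \<Rightarrow> (nat \<Rightarrow> 'k) set \<Rightarrow> real" where
  "completion_norm w X =
     completion_abs w X powr (real (local_degree w) / real (nf_degree TYPE('k)))"


section \<open>Places\<close>

text \<open>
  A place is represented by its unique absolute value that extends the usual or a \<open>p\<close>-adic
  absolute value of \<open>\<rat>\<close>.  Two such absolute values are equivalent only if they are equal;
  in particular conjugate embeddings give the same element of \<open>arch_places\<close>.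
\<close>

definition field_embedding :: "('k::field_char_0 \<Rightarrow> complex) \<Rightarrow> bool" where
  "field_embedding \<sigma> \<longleftrightarrow>
     \<sigma> 1 = 1 \<and> (\<forall>x y. \<sigma> (x + y) = \<sigma> x + \<sigma> y) \<and> (\<forall>x y. \<sigma> (x * y) = \<sigma> x * \<sigma> y)"

definition arch_places :: "('k::field_char_0 \<Rightarrow> real) set" where
  "arch_places = {(\<lambda>x. cmod (\<sigma> x)) | \<sigma>. field_embedding \<sigma>}"

definition padic_abs :: "nat \<Rightarrow> rat \<Rightarrow> real" where
  "padic_abs p q =
     (if q = 0 then 0
      else real p powi (int (multiplicity (int p) (snd (quotient_of q)))
                        - int (multiplicity (int p) (fst (quotient_of q)))))"

definition place_over :: "nat \<Rightarrow> ('k::field_char_0 \<Rightarrow> real) \<Rightarrow> bool" where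
  "place_over p w \<longleftrightarrow>
     absolute_value w \<and> (\<forall>x y. w (x + y) \<le> max (w x) (w y)) \<and>
     (\<forall>q. w (of_rat q) = padic_abs p q)"


section \<open>Euler's factorial series\<close>

definition factorial_series :: "('k::field_char_0 \<Rightarrow> real) \<Rightarrow> 'k \<Rightarrow> (nat \<Rightarrow> 'k) set" where
  "factorial_series w a =
     (THE L. L \<in> carrier (completion w) \<and>
        (\<lambda>N. completion_abs w
               (finsum (completion w) (\<lambda>n. embed w (fact n * a ^ n)) {..<N}
                  \<ominus>\<^bsub>completion w\<^esub> L)) \<longlonglongrightarrow> 0)"

definition linear_form ::
    "('k::field_char_0 \<Rightarrow> real) \<Rightarrow> nat \<Rightarrow> (nat \<Rightarrow> 'k) \<Rightarrow> (nat \<Rightarrow> 'k) \<Rightarrow> (nat \<Rightarrow> 'k) set" where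
  "linear_form w m l a =
     embed w (l 0) \<oplus>\<^bsub>completion w\<^esub>
     finsum (completion w)
       (\<lambda>i. embed w (l i) \<otimes>\<^bsub>completion w\<^esub> factorial_series w (a i)) {1..m}"

definition c1 :: "nat \<Rightarrow> (nat \<Rightarrow> 'k::field_char_0) \<Rightarrow> real" where
  "c1 m a =
     (\<Prod>v\<in>arch_places.
        Max (insert 1 ((\<lambda>j. place_norm v (a j)) ` {1..m})) ^ m *
        (\<Prod>i=1..m. place_norm v (a i) + Max (insert 1 ((\<lambda>j. place_norm v (a j)) ` {1..m}))))"

end

theory Submission
  imports
    Defs
    "HOL-Computational_Algebra.Field_as_Ring"
    "HOL-Analysis.Complex_Transcendental"
    "Jordan_Normal_Form.Determinant"
begin

text \<open>
  Let \<open>P\<close> be the product of the \<open>(x - \<alpha>\<^sub>j) ^ r\<close>, of degree \<open>L = m * r\<close>, and let \<open>S\<^sub>k\<close> be the linear form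
  with each series truncated after \<open>k\<close> terms.  Weighting \<open>S\<^sub>n\<close>, ..., \<open>S\<^bsub>L + n\<^esub>\<close> by the coefficients of \<open>P\<close> times
  \<open>(L + n)! / (i + n)!\<close> gives an algebraic integer \<open>W\<close> (a second-kind Pade approximation).  As \<open>P\<close>
  vanishes to order \<open>r\<close> at the nodes, \<open>W\<close> differs from a multiple of the linear form by a multiple of
  \<open>(L + n)! r!\<close>, at every finite place.  A commutator identity for shift operators shows that \<open>W\<close>
  is nonzero for some \<open>n \<le> m\<close>.

  The norm of \<open>W\<close> is at most about \<open>H (L + n)!\<close>, up to exponential factors, whereas the primes
  from the interval contribute nearly all of \<open>(L + n)! r!\<close>.  If \<open>r log r\<close> slightly exceeds
  \<open>log H\<close>, then \<open>W\<close> is not divisible by that contribution, so at some place \<open>w\<close> over such a prime \<open>W\<close> is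
  larger than the remainder, hence at most as large as the linear form.  The product formula
  inequality, applied to \<open>W\<close> at the Archimedean places and at \<open>w\<close> alone, gives the lower bound.
\<close>

section \<open>The approximations\<close>

text \<open>The product formula inequality at one place is read off a p-adic determinant that has as
  many small columns as the completion has dimensions over the closure of the rationals; applying it
  to powers with exponent 2 ^ k and taking roots removes all constants. Places are not given in
  advance: they arise from minimal norms below a spectral norm, and this has to be steered so that W
  is large at the place found. The exponent has two sources. The size of W contains one factor H
  from the coefficients and the factorial (L + n)!, whose logarithm is about m r log r, hence about
  m log H; this gives m + 1. The correction with 114 is the price of taking r a little larger than
  log H / log log H. The surplus pays for \<open>c1\<close>, for Stirling's formula and for the
  primes up to log (log H / log log H), which are discarded: a Mertens type estimate bounds the
  logarithm of their share in (L + n)! r! by roughly (m + 1) r log log log H.\<close>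

definition act :: "'a::comm_ring_1 poly \<Rightarrow> (nat \<Rightarrow> 'a) \<Rightarrow> nat \<Rightarrow> 'a" where
  "act p T n = (\<Sum>i\<le>degree p. coeff p i * T (n + i))"

lemma act_eq_sum: "degree p \<le> N \<Longrightarrow> act p T n = (\<Sum>i\<le>N. coeff p i * T (n + i))"
  unfolding act_def by (rule sum.mono_neutral_left) (auto simp: coeff_eq_0)

lemma act_0 [simp]: "act 0 T n = 0"
  by (simp add: act_def)

lemma act_1 [simp]: "act 1 T n = T n"
  by (simp add: act_def)

lemma act_pCons: "act (pCons a p) T n = a * T n + act p T (Suc n)"
proof -
  have "act (pCons a p) T n = (\<Sum>i\<le>Suc (degree p). coeff (pCons a p) i * T (n + i))"
    by (rule act_eq_sum) (rule degree_pCons_le)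
  also have "\<dots> = a * T n + (\<Sum>i\<le>degree p. coeff p i * T (n + Suc i))"
    by (subst sum.atMost_Suc_shift) simp
  finally show ?thesis by (simp add: act_def)
qed

lemma act_add: "act (p + q) T n = act p T n + act q T n"
proof -
  let ?N = "max (degree p) (degree q)"
  have "degree (p + q) \<le> ?N" by (rule degree_add_le_max)
  then show ?thesis
    by (simp add: act_eq_sum[of _ ?N] sum.distrib ring_distribs)
qed

lemma act_smult: "act (Polynomial.smult a p) T n = a * act p T n"
  by (subst act_eq_sum[of _ "degree p"]) (auto simp: act_def sum_distrib_left mult.assoc intro: degree_smult_le)

lemma act_sum: "act (sum f A) T n = (\<Sum>i\<in>A. act (f i) T n)"
  by (induction A rule: infinite_finite_induct) (auto simp: act_add)

text \<open>\<open>act\<close> lets a polynomial operate as a polynomial in the shift. If the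
  product with x - a annihilates \<open>T\<close> on a range, then the cofactor applied to
  \<open>T\<close> is geometric with ratio \<open>a\<close> there; the descent in
  \<open>factorial_recurrence_nonvanishing\<close> rests on this.\<close>

lemma act_linear_factor: "act ([:- a, 1:] * p) T n = act p T (Suc n) - a * act p T n"
proof -
  have "[:- a, 1:] * p = Polynomial.smult (- a) p + pCons 0 p" by simp
  then show ?thesis by (simp only: act_add act_smult act_pCons) simp
qed

text \<open>Pairing the relations with the coefficients of the polynomial that vanishes at all nodes
  except \<open>x j\<close> isolates \<open>c j\<close>. It is applied to the nodes
  \<open>a j\<close> and, later, to the values of the embeddings at a primitive element.\<close>

lemma vandermonde_independent:
  fixes x c :: "'i \<Rightarrow> 'a::field"
  assumes fin: "finite J" and inj: "inj_on x J"
    and zero: "\<And>n. n < card J \<Longrightarrow> (\<Sum>j\<in>J. c j * x j ^ n) = 0" and j: "j \<in> J"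
  shows "c j = 0"
proof -
  define q where "q = (\<Prod>i\<in>J-{j}. [:- x i, 1:])"
  have deg: "degree q < card J"
  proof -
    have "degree q \<le> (\<Sum>i\<in>J-{j}. degree [:- x i, 1:])"
      unfolding q_def using degree_prod_sum_le[of "J-{j}" "\<lambda>i. [:- x i, 1:]"] fin by (simp add: o_def)
    also have "\<dots> = card (J - {j})" by simp
    also have "\<dots> < card J" using fin j by (intro psubset_card_mono) auto
    finally show ?thesis .
  qed
  have pq: "poly q (x i) = 0" if "i \<in> J" "i \<noteq> j" for i
    unfolding q_def poly_prod using that fin by (auto intro!: prod_zero)
  have pj: "poly q (x j) \<noteq> 0"
    unfolding q_def poly_prod using inj j fin by (auto simp: inj_on_def prod_zero_iff)
  have "(\<Sum>i\<in>J. c i * poly q (x i)) = (\<Sum>i\<in>J. \<Sum>n\<le>degree q. coeff q n * (c i * x i ^ n))"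
    by (simp add: poly_altdef sum_distrib_left mult_ac)
  also have "\<dots> = (\<Sum>n\<le>degree q. coeff q n * (\<Sum>i\<in>J. c i * x i ^ n))"
    by (subst sum.swap) (simp add: sum_distrib_left)
  also have "\<dots> = 0" using zero deg by (intro sum.neutral) auto
  also have "(\<Sum>i\<in>J. c i * poly q (x i)) = (\<Sum>i\<in>J. if i = j then c i * poly q (x i) else 0)"
    by (intro sum.cong) (auto simp: pq)
  also have "\<dots> = c j * poly q (x j)" using fin j by simp
  finally show ?thesis using pj by simp
qed

text \<open>The exponents may vary from node to node because the nonvanishing proof lowers them one
  at a time; the approximations have the constant exponent \<open>r\<close>.\<close>

definition node_poly :: "nat \<Rightarrow> (nat \<Rightarrow> 'a::comm_ring_1) \<Rightarrow> (nat \<Rightarrow> nat) \<Rightarrow> 'a poly" where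
  "node_poly m a e = (\<Prod>j\<in>{1..m}. [:- a j, 1:] ^ e j)"

lemma node_poly_dec:
  assumes "j \<in> {1..m}" "e j > 0"
  shows "node_poly m a e = [:- a j, 1:] * node_poly m a (e(j := e j - 1))"
proof -
  have "node_poly m a e = [:- a j, 1:] ^ e j * (\<Prod>i\<in>{1..m}-{j}. [:- a i, 1:] ^ e i)"
    unfolding node_poly_def using assms by (intro prod.remove) auto
  also have "[:- a j, 1:] ^ e j = [:- a j, 1:] * [:- a j, 1:] ^ (e j - 1)"
    using assms by (metis power_eq_if less_irrefl)
  also have "(\<Prod>i\<in>{1..m}-{j}. [:- a i, 1:] ^ e i)
           = (\<Prod>i\<in>{1..m}-{j}. [:- a i, 1:] ^ (e(j := e j - 1)) i)"
    by (intro prod.cong) auto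
  also have "[:- a j, 1:] * [:- a j, 1:] ^ (e j - 1) * \<dots> = [:- a j, 1:] *
      ([:- a j, 1:] ^ (e(j := e j - 1)) j * (\<Prod>i\<in>{1..m}-{j}. [:- a i, 1:] ^ (e(j := e j - 1)) i))"
    by (simp only: mult.assoc fun_upd_same)
  also have "\<dots> = [:- a j, 1:] * node_poly m a (e(j := e j - 1))"
    unfolding node_poly_def using assms by (subst prod.remove[of _ j]) (simp_all only: finite_atLeastAtMost)
  finally show ?thesis .
qed

text \<open>For \<open>e j = 0\<close> the truncated subtraction leaves the exponents unchanged, and
  the factor \<open>of_nat (e j)\<close> removes the term.\<close>

lemma pderiv_node_poly:
  fixes a :: "nat \<Rightarrow> 'a::field_char_0"
  shows "pderiv (node_poly m a e) =
    (\<Sum>j\<in>{1..m}. Polynomial.smult (of_nat (e j)) (node_poly m a (e(j := e j - 1))))"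
  unfolding node_poly_def pderiv_prod
proof (rule sum.cong[OF refl], goal_cases)
  case (1 j)
  have "(\<Prod>i\<in>{1..m}. [:- a i, 1:] ^ (e(j := e j - 1)) i)
      = [:- a j, 1:] ^ (e j - 1) * (\<Prod>i\<in>{1..m}-{j}. [:- a i, 1:] ^ e i)"
    using 1 by (subst prod.remove[of _ j]) auto
  then show ?case by (simp add: pderiv_power pderiv_pCons mult_ac)
qed

text \<open>The term \<open>pderiv p\<close> is the commutator of the shift polynomial \<open>p\<close> with multiplication
  of a sequence by its index.\<close>

lemma act_recurrence:
  fixes T l a :: "nat \<Rightarrow> 'a::field_char_0"
  assumes rec: "\<And>n. of_nat (Suc n) * T (Suc n) = T n + (\<Sum>j\<in>J. l j * a j ^ n)"
  shows "of_nat (Suc n) * act p T (Suc n) + act (pderiv p) T (Suc (Suc n))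
       = act p T n + (\<Sum>j\<in>J. l j * poly p (a j) * a j ^ n)"
proof (induction p arbitrary: n rule: pCons_induct)
  case 0
  then show ?case by simp
next
  case (pCons b p)
  have "of_nat (Suc n) * act (pCons b p) T (Suc n) + act (pderiv (pCons b p)) T (Suc (Suc n))
     = b * (of_nat (Suc n) * T (Suc n)) + (of_nat (Suc (Suc n)) * act p T (Suc (Suc n))
        + act (pderiv p) T (Suc (Suc (Suc n))))"
    by (simp add: act_pCons pderiv_pCons act_add algebra_simps)
  also have "\<dots> = b * (T n + (\<Sum>j\<in>J. l j * a j ^ n)) + (act p T (Suc n)
        + (\<Sum>j\<in>J. l j * poly p (a j) * a j ^ Suc n))"
    by (simp only: rec pCons.IH)
  also have "\<dots> = act (pCons b p) T n + (\<Sum>j\<in>J. l j * poly (pCons b p) (a j) * a j ^ n)"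
    by (simp add: act_pCons algebra_simps sum.distrib sum_distrib_left)
  finally show ?case .
qed

lemma node_poly_zero_const: "e j = 0 \<or> j \<notin> {1..m} \<or> poly (node_poly m a e) (a j) = (0::'a::idom)"
  by (cases "e j = 0 \<or> j \<notin> {1..m}") (auto simp: node_poly_def poly_prod)

lemma node_poly_nonzero:
  fixes a :: "nat \<Rightarrow> 'a::idom"
  assumes "inj_on a {1..m}" "j \<in> {1..m}" "e j = 0"
  shows "poly (node_poly m a e) (a j) \<noteq> 0"
proof
  assume "poly (node_poly m a e) (a j) = 0"
  then obtain i where "i \<in> {1..m}" "(a j - a i) ^ e i = 0"
    unfolding node_poly_def poly_prod by (subst (asm) prod_zero_iff) (auto simp: poly_power)
  then show False using assms by (cases "i = j") (auto dest: inj_onD)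
qed

text \<open>Descent on the total exponent. Write P for \<open>node_poly m a e\<close>. Where P
  annihilates \<open>T\<close>, the sequence \<open>V j\<close> (P with one factor x - a_j removed,
  applied to \<open>T\<close>) is geometric, and \<open>act_recurrence\<close> reduces to an
  identity between exponential sums. Comparing coefficients gives e_j a_j^2 V_j(0) = l_j P(a_j); if
  \<open>e j > 0\<close>, the right side is 0, so \<open>V j\<close> vanishes and the exponent
  drops.\<close>

lemma factorial_recurrence_nonvanishing:
  fixes T l a :: "nat \<Rightarrow> 'a::field_char_0"
  assumes rec: "\<And>n. of_nat (Suc n) * T (Suc n) = T n + (\<Sum>j\<in>{1..m}. l j * a j ^ n)"
    and inj: "inj_on a {1..m}" and nz: "\<And>j. j \<in> {1..m} \<Longrightarrow> a j \<noteq> 0"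
    and van: "\<And>n. n \<le> m \<Longrightarrow> act (node_poly m a e) T n = 0"
  shows "T 0 = 0 \<and> (\<forall>j\<in>{1..m}. l j = 0)"
  using van
proof (induction "\<Sum>j\<in>{1..m}. e j" arbitrary: e rule: less_induct)
  case less
  define V where "V j = act (node_poly m a (e(j := e j - 1))) T" for j
  \<comment> \<open>The range reaches one index beyond the vanishing range, since the relation at
    \<open>n\<close> links \<open>V j n\<close> and \<open>V j (Suc n)\<close>.\<close>
  have V: "V j n = a j ^ n * V j 0" if "j \<in> {1..m}" "e j > 0" "n \<le> Suc m" for j n
    using that(3)
  proof (induction n)
    case (Suc n)
    have "0 = act (node_poly m a e) T n" using less.prems Suc by simp
    also have "\<dots> = V j (Suc n) - a j * V j n"
      unfolding V_def by (subst node_poly_dec[of j m e, OF that(1,2)]) (rule act_linear_factor)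
    finally show ?case using Suc by simp
  qed simp
  define c where "c j = of_nat (e j) * a j ^ 2 * V j 0 - l j * poly (node_poly m a e) (a j)" for j
  \<comment> \<open>\<open>act_recurrence\<close> at \<open>n\<close> involves the annihilated
    values at \<open>n\<close> and \<open>Suc n\<close>, and \<open>V j\<close> at n + 2. All are
    under control exactly for \<open>n < m\<close>, and \<open>m\<close> equations are what the
    \<open>m\<close> nodes require.\<close>
  have "c j = 0" if j: "j \<in> {1..m}" for j
  proof (rule vandermonde_independent[OF _ inj _ j])
    fix n assume "n < card {1..m}"
    then have n: "n < m" by simp
    have "act (pderiv (node_poly m a e)) T (Suc (Suc n))
        = (\<Sum>j\<in>{1..m}. of_nat (e j) * V j (Suc (Suc n)))"
      by (simp add: pderiv_node_poly act_sum act_smult V_def)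
    also have "\<dots> = (\<Sum>j\<in>{1..m}. of_nat (e j) * (a j ^ Suc (Suc n) * V j 0))"
    proof (rule sum.cong[OF refl])
      fix j assume "j \<in> {1..m}"
      then show "of_nat (e j) * V j (Suc (Suc n)) = of_nat (e j) * (a j ^ Suc (Suc n) * V j 0)"
        using V[of j "Suc (Suc n)"] n by (cases "e j = 0") auto
    qed
    finally have "(\<Sum>j\<in>{1..m}. of_nat (e j) * (a j ^ Suc (Suc n) * V j 0))
        = (\<Sum>j\<in>{1..m}. l j * poly (node_poly m a e) (a j) * a j ^ n)"
      using act_recurrence[OF rec, where p = "node_poly m a e" and n = n] less.prems[of n] less.prems[of "Suc n"] n
      by simp
    then show "(\<Sum>j\<in>{1..m}. c j * a j ^ n) = 0"
      by (simp add: c_def algebra_simps sum_subtractf power2_eq_square)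
  qed simp
  then have c0: "of_nat (e j) * a j ^ 2 * V j 0 = l j * poly (node_poly m a e) (a j)" if "j \<in> {1..m}" for j
    using that by (simp add: c_def)
  show ?case
  proof (cases "\<exists>j\<in>{1..m}. e j > 0")
    case True
    then obtain j where j: "j \<in> {1..m}" "e j > 0" by blast
    have "V j 0 = 0"
      using c0[OF j(1)] node_poly_zero_const[of e j m a] j nz[OF j(1)] by auto
    then have "act (node_poly m a (e(j := e j - 1))) T n = 0" if "n \<le> m" for n
      using V[OF j, of n] that unfolding V_def by simp
    moreover have "(\<Sum>i\<in>{1..m}. (e(j := e j - 1)) i) < (\<Sum>i\<in>{1..m}. e i)"
      using j by (intro sum_strict_mono_ex1) auto
    ultimately show ?thesis using less.hyps by blast
  next
    case False
    \<comment> \<open>All exponents are used up and P = 1: vanishing at index 0 says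
      \<open>T 0 = 0\<close>, and \<open>c0\<close> gives \<open>l j = 0\<close>.\<close>
    then have e0: "e j = 0" if "j \<in> {1..m}" for j using that by auto
    then have "node_poly m a e = 1" by (simp add: node_poly_def)
    moreover have "l j = 0" if "j \<in> {1..m}" for j
      using c0[OF that] e0[OF that] node_poly_nonzero[OF inj that, of e] by simp
    ultimately show ?thesis using less.prems[of 0] by simp
  qed
qed

text \<open>Up to a power of \<open>a\<close>, the sum is the \<open>k\<close>-th divided derivative
  of x^N p at \<open>a\<close>, and a zero of order \<open>r > k\<close> kills it. The induction
  splits off one linear factor and applies Pascal's rule, which lowers \<open>k\<close> and
  \<open>r\<close> together and works in every commutative ring.\<close>

lemma binomial_coeff_sum_vanish:
  fixes a :: "'a::comm_ring_1"
  shows "\<lbrakk>[:- a, 1:] ^ r dvd p; k < r; degree p \<le> D\<rbrakk> \<Longrightarrow>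
    (\<Sum>i\<le>D. coeff p i * of_nat ((i + N) choose k) * a ^ i) = 0"
proof (induction k arbitrary: r p N D)
  case (0 r p N D)
  have "[:- a, 1:] dvd p" using 0 by (metis dvd_power dvd_trans)
  then have "poly p a = 0" by (simp add: poly_eq_0_iff_dvd)
  moreover have "poly p a = (\<Sum>i\<le>D. coeff p i * a ^ i)"
    unfolding poly_altdef using 0 by (intro sum.mono_neutral_left) (auto simp: coeff_eq_0)
  ultimately show ?case by simp
next
  case (Suc k r p N D)
  then obtain r' where r': "r = Suc r'" "k < r'" by (cases r) auto
  obtain s where s: "p = [:- a, 1:] ^ r * s" using Suc.prems by auto
  define q where "q = [:- a, 1:] ^ r' * s"
  have pq: "p = [:- a, 1:] * q" using s r' by (simp add: q_def mult.assoc del: mult_pCons_left)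
  have cp: "coeff p (Suc i) = coeff q i - a * coeff q (Suc i)" "coeff p 0 = - a * coeff q 0" for i
    unfolding pq by (simp_all)
  define M where "M = max D (degree q)"
  let ?b = "\<lambda>i. of_nat ((i + N) choose Suc k) :: 'a"
  have "(\<Sum>i\<le>D. coeff p i * ?b i * a ^ i) = (\<Sum>i\<le>Suc M. coeff p i * ?b i * a ^ i)"
    using Suc.prems by (intro sum.mono_neutral_left) (auto simp: coeff_eq_0 M_def)
  also have "\<dots> = coeff p 0 * ?b 0 + (\<Sum>i\<le>M. coeff p (Suc i) * ?b (Suc i) * a ^ Suc i)"
    by (subst sum.atMost_Suc_shift) simp
  also have "\<dots> = (\<Sum>i\<le>M. coeff q i * ?b (Suc i) * a ^ Suc i)
       - (a * coeff q 0 * ?b 0 + (\<Sum>i\<le>M. a * coeff q (Suc i) * ?b (Suc i) * a ^ Suc i))"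
    by (simp add: cp algebra_simps sum_subtractf)
  also have "a * coeff q 0 * ?b 0 + (\<Sum>i\<le>M. a * coeff q (Suc i) * ?b (Suc i) * a ^ Suc i)
       = (\<Sum>i\<le>Suc M. a * coeff q i * ?b i * a ^ i)"
    by (subst sum.atMost_Suc_shift) simp
  also have "\<dots> = (\<Sum>i\<le>M. a * coeff q i * ?b i * a ^ i)"
    by (simp add: M_def coeff_eq_0)
  also have "(\<Sum>i\<le>M. coeff q i * ?b (Suc i) * a ^ Suc i) - (\<Sum>i\<le>M. a * coeff q i * ?b i * a ^ i)
       = a * (\<Sum>i\<le>M. coeff q i * of_nat ((i + N) choose k) * a ^ i)"
    by (simp add: sum_subtractf[symmetric] sum_distrib_left algebra_simps)
  also have "(\<Sum>i\<le>M. coeff q i * of_nat ((i + N) choose k) * a ^ i) = 0"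
    by (rule Suc.IH[of r']) (auto simp: q_def r' M_def)
  finally show ?case by simp
qed

text \<open>Integrality of the approximations is required in two rings, the unit ball of a place and
  the set \<open>integral_at p\<close>; proving it for an arbitrary subring serves both.\<close>

definition subring_set :: "'a::comm_ring_1 set \<Rightarrow> bool" where
  "subring_set R \<longleftrightarrow> 0 \<in> R \<and> 1 \<in> R \<and> (\<forall>x\<in>R. - x \<in> R) \<and> (\<forall>x\<in>R. \<forall>y\<in>R. x + y \<in> R \<and> x * y \<in> R)"

lemma subring_setD:
  assumes "subring_set R"
  shows "0 \<in> R" "1 \<in> R" "x \<in> R \<Longrightarrow> - x \<in> R" "x \<in> R \<Longrightarrow> y \<in> R \<Longrightarrow> x + y \<in> R"
    "x \<in> R \<Longrightarrow> y \<in> R \<Longrightarrow> x * y \<in> R"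
  using assms by (auto simp: subring_set_def)

lemma subring_set_sum: "subring_set R \<Longrightarrow> (\<And>i. i \<in> A \<Longrightarrow> f i \<in> R) \<Longrightarrow> sum f A \<in> R"
  by (induction A rule: infinite_finite_induct) (auto intro: subring_setD)

lemma subring_set_power: "subring_set R \<Longrightarrow> x \<in> R \<Longrightarrow> x ^ n \<in> R"
  by (induction n) (auto intro: subring_setD)

lemma subring_set_of_nat: "subring_set R \<Longrightarrow> of_nat n \<in> R"
  by (induction n) (auto intro: subring_setD)

lemma subring_set_coeff_mult:
  assumes R: "subring_set R" and "\<And>i. coeff p i \<in> R" "\<And>i. coeff q i \<in> R"
  shows "coeff (p * q) i \<in> R"
  unfolding coeff_mult using assms by (intro subring_set_sum subring_setD) auto

lemma subring_set_coeff_node_poly: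
  assumes R: "subring_set R" and a: "\<And>j. j \<in> {1..m} \<Longrightarrow> a j \<in> R"
  shows "coeff (node_poly m a e) i \<in> R"
proof -
  have one: "coeff (1 :: 'a poly) i \<in> R" for i
    by (auto simp: coeff_1 intro: subring_setD[OF R])
  have lin: "coeff [:- b, 1:] i \<in> R" if "b \<in> R" for b i
    using that by (simp add: coeff_pCons subring_setD[OF R] split: nat.split)
  have pow: "coeff ([:- b, 1:] ^ n) i \<in> R" if "b \<in> R" for b i n
  proof (induction n arbitrary: i)
    case (Suc n)
    show ?case unfolding power_Suc
      by (intro subring_set_coeff_mult[OF R] lin[OF that] Suc)
  qed (simp only: power_0 one)
  have "coeff (\<Prod>j\<in>A. [:- a j, 1:] ^ e j) i \<in> R" if "finite A" "A \<subseteq> {1..m}" for A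
    using that
  proof (induction A arbitrary: i rule: finite_induct)
    case (insert x A)
    show ?case unfolding prod.insert[OF insert(1,2)]
      using insert.prems by (intro subring_set_coeff_mult[OF R] pow insert.IH a) auto
  qed (use one in auto)
  then show ?thesis by (simp add: node_poly_def)
qed

lemma degree_node_poly:
  fixes a :: "nat \<Rightarrow> 'a::idom"
  shows "degree (node_poly m a (\<lambda>_. r)) = m * r"
proof -
  have "degree (node_poly m a (\<lambda>_. r)) = (\<Sum>j\<in>{1..m}. degree ([:- a j, 1:] ^ r))"
    unfolding node_poly_def by (intro degree_prod_eq_sum_degree) auto
  also have "\<dots> = (\<Sum>j\<in>{1..m}. r)" by (simp add: degree_power_eq)
  finally show ?thesis by simp
qed

section \<open>Truncated forms and second-kind Pade approximations\<close>

definition partial_form :: "nat \<Rightarrow> (nat \<Rightarrow> 'a::comm_semiring_1) \<Rightarrow> (nat \<Rightarrow> 'a) \<Rightarrow> nat \<Rightarrow> 'a" where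
  "partial_form m l a k = l 0 + (\<Sum>j\<in>{1..m}. l j * (\<Sum>h<k. of_nat (fact h) * a j ^ h))"

text \<open>The quotient of factorials is exact for \<open>i <= m * r\<close>; taken among the
  natural numbers, it keeps the weights inside any subring that contains the nodes.\<close>

definition pade_weight :: "nat \<Rightarrow> nat \<Rightarrow> (nat \<Rightarrow> 'a::comm_ring_1) \<Rightarrow> nat \<Rightarrow> nat \<Rightarrow> 'a" where
  "pade_weight m r a n i =
     coeff (node_poly m a (\<lambda>_. r)) i * of_nat (fact (m * r + n) div fact (i + n))"

text \<open>The multiplier of the linear form: replacing every truncation in
  \<open>pade_value\<close> by one and the same long truncation factors out this sum of
  weights.\<close>

definition pade_denom :: "nat \<Rightarrow> nat \<Rightarrow> (nat \<Rightarrow> 'a::comm_ring_1) \<Rightarrow> nat \<Rightarrow> 'a" where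
  "pade_denom m r a n = (\<Sum>i\<le>m * r. pade_weight m r a n i)"

definition pade_value :: "nat \<Rightarrow> nat \<Rightarrow> (nat \<Rightarrow> 'a::comm_ring_1) \<Rightarrow> (nat \<Rightarrow> 'a) \<Rightarrow> nat \<Rightarrow> 'a" where
  "pade_value m r l a n = (\<Sum>i\<le>m * r. pade_weight m r a n i * partial_form m l a (i + n))"

lemma of_nat_fact_div:
  assumes "i \<le> k"
  shows "of_nat (fact k div fact i) = (fact k / fact i :: 'a::field_char_0)"
proof -
  have "fact i * (fact k div fact i) = (fact k :: nat)" using assms by (simp add: fact_dvd)
  then have "of_nat (fact i * (fact k div fact i)) = (of_nat (fact k) :: 'a)" by (rule arg_cong)
  then show ?thesis by (simp add: field_simps)
qed

text \<open>Divided by \<open>fact k\<close>, the truncated forms satisfy the recurrence of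
  \<open>factorial_recurrence_nonvanishing\<close>, and \<open>pade_value\<close> is
  \<open>fact (m * r + n)\<close> times the shift polynomial applied to them. Vanishing for all
  \<open>n <= m\<close> would make every coefficient zero.\<close>

lemma pade_value_nonzero:
  fixes l a :: "nat \<Rightarrow> 'a::field_char_0"
  assumes inj: "inj_on a {1..m}" and nz: "\<And>j. j \<in> {1..m} \<Longrightarrow> a j \<noteq> 0"
    and l: "\<exists>i\<in>{0..m}. l i \<noteq> 0"
  shows "\<exists>n\<le>m. pade_value m r l a n \<noteq> 0"
proof (rule ccontr)
  assume "\<not> ?thesis"
  then have z: "pade_value m r l a n = 0" if "n \<le> m" for n using that by auto
  define T where "T k = partial_form m l a k / fact k" for k
  have "of_nat (Suc n) * T (Suc n) = T n + (\<Sum>j\<in>{1..m}. l j * a j ^ n)" for n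
  proof -
    have "partial_form m l a (Suc n) = partial_form m l a n + fact n * (\<Sum>j\<in>{1..m}. l j * a j ^ n)"
      by (simp add: partial_form_def algebra_simps sum.distrib sum_distrib_left)
    then show ?thesis by (simp add: T_def field_simps del: of_nat_Suc)
  qed
  moreover have "act (node_poly m a (\<lambda>_. r)) T n = 0" if "n \<le> m" for n
  proof -
    have "pade_value m r l a n = fact (m * r + n) * act (node_poly m a (\<lambda>_. r)) T n"
      unfolding pade_value_def act_def degree_node_poly pade_weight_def T_def sum_distrib_left
      by (intro sum.cong) (auto simp: of_nat_fact_div add.commute)
    then show ?thesis using z[OF that] by simp
  qed
  ultimately have "T 0 = 0 \<and> (\<forall>j\<in>{1..m}. l j = 0)"
    using inj nz by (intro factorial_recurrence_nonvanishing[where e = "\<lambda>_. r"]) auto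
  \<comment> \<open>\<open>T 0\<close> is \<open>l 0\<close>, because all sums in the form truncated
    at 0 are empty.\<close>
  then have "l i = 0" if "i \<in> {0..m}" for i
    using that by (cases "i = 0") (auto simp: T_def partial_form_def)
  then show False using l by auto
qed

text \<open>After this rewriting \<open>i\<close> enters only through a binomial coefficient, which
  is the shape of \<open>binomial_coeff_sum_vanish\<close>, and the factor \<open>fact k\<close> is
  visible, which \<open>fact r\<close> divides once \<open>k >= r\<close>.\<close>

lemma fact_div_mult_fact:
  assumes "i + n \<le> L"
  shows "(fact L div fact (i + n)) * fact (i + n + k) = fact L * (fact k * ((i + n + k) choose k) :: nat)"
proof -
  have "fact (i + n + k) = fact k * fact (i + n) * ((i + n + k) choose k)"
    by (metis add_diff_cancel_right' binomial_fact_lemma le_add2)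
  moreover have "fact (i + n) dvd (fact L :: nat)" using assms by (rule fact_dvd)
  ultimately show ?thesis by (simp add: mult_ac)
qed

text \<open>The tail of the series behind the truncation at \<open>i + n\<close> is indexed by the
  distance \<open>k\<close>. For \<open>k < r\<close> the sum over \<open>i\<close> vanishes because
  P has zeros of order \<open>r\<close> at the nodes; every term with \<open>k >= r\<close> is a
  multiple of (L + n)! r!. The finite \<open>M\<close> stands for the full series and keeps the
  identity algebraic, hence valid in any subring.\<close>

lemma pade_remainder:
  fixes l a :: "nat \<Rightarrow> 'a::field_char_0"
  assumes R: "subring_set R" and a: "\<And>j. j \<in> {1..m} \<Longrightarrow> a j \<in> R" and l: "\<And>j. j \<in> {1..m} \<Longrightarrow> l j \<in> R"
    and M: "M \<ge> m * r + n + r"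
  shows "\<exists>E\<in>R. pade_denom m r a n * partial_form m l a M - pade_value m r l a n
           = of_nat (fact (m * r + n) * fact r) * E"
proof -
  define L where "L = m * r"
  define P where "P = node_poly m a (\<lambda>_. r)"
  have degP: "degree P = L" by (simp add: P_def L_def degree_node_poly)
  let ?g = "\<lambda>j i k. coeff P i * of_nat ((fact (L + n) div fact (i + n)) * fact (i + n + k)) * a j ^ (i + n + k)"
  have tail: "partial_form m l a M - partial_form m l a (i + n)
      = (\<Sum>j\<in>{1..m}. l j * (\<Sum>k<M - (i + n). of_nat (fact (i + n + k)) * a j ^ (i + n + k)))"
    if "i \<le> L" for i
  proof -
    have sp: "(\<Sum>h<M. f h) = (\<Sum>h<i+n. f h) + (\<Sum>k<M - (i + n). f (i + n + k))" for f :: "nat \<Rightarrow> 'a"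
    proof -
      have "(\<Sum>h<M. f h) = (\<Sum>h<i+n. f h) + (\<Sum>h\<in>{i+n..<M}. f h)"
        using M that by (simp add: lessThan_atLeast0 sum.atLeastLessThan_concat L_def)
      also have "(\<Sum>h\<in>{i+n..<M}. f h) = (\<Sum>k<M - (i + n). f (i + n + k))"
        by (rule sum.reindex_bij_witness[where i = "\<lambda>k. i + n + k" and j = "\<lambda>h. h - (i + n)"]) auto
      finally show ?thesis .
    qed
    show ?thesis unfolding partial_form_def by (subst sp) (simp add: algebra_simps sum.distrib)
  qed
  have low: "(\<Sum>i\<le>L. ?g j i k) = 0" if j: "j \<in> {1..m}" and k: "k < r" for j k
  proof -
    have "(\<Sum>i\<le>L. ?g j i k) = (\<Sum>i\<le>L. fact (L + n) * fact k * a j ^ (n + k) *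
        (coeff P i * of_nat ((i + (n + k)) choose k) * a j ^ i))"
      by (intro sum.cong refl, subst fact_div_mult_fact)
        (auto simp: power_add mult_ac add_ac)
    also have "\<dots> = fact (L + n) * fact k * a j ^ (n + k) *
        (\<Sum>i\<le>L. coeff P i * of_nat ((i + (n + k)) choose k) * a j ^ i)"
      by (simp add: sum_distrib_left)
    also have "(\<Sum>i\<le>L. coeff P i * of_nat ((i + (n + k)) choose k) * a j ^ i) = 0"
    proof (rule binomial_coeff_sum_vanish)
      show "[:- a j, 1:] ^ r dvd P" unfolding P_def node_poly_def
        using j by (intro dvd_prodI[of _ j, where f="\<lambda>j. [:- a j, 1:] ^ r"]) auto
    qed (use k degP in auto)
    finally show ?thesis by simp
  qed
  define E where "E = (\<Sum>i\<le>L. \<Sum>j\<in>{1..m}. l j * (\<Sum>k\<in>{r..<M - (i + n)}.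
      coeff P i * of_nat (((i + n + k) choose k) * (fact k div fact r)) * a j ^ (i + n + k)))"
  have "pade_denom m r a n * partial_form m l a M - pade_value m r l a n
      = (\<Sum>i\<le>L. pade_weight m r a n i * (partial_form m l a M - partial_form m l a (i + n)))"
    by (simp add: pade_denom_def pade_value_def sum_distrib_right sum_subtractf right_diff_distrib L_def)
  also have "\<dots> = (\<Sum>i\<le>L. pade_weight m r a n i *
      (\<Sum>j\<in>{1..m}. l j * (\<Sum>k<M - (i + n). of_nat (fact (i + n + k)) * a j ^ (i + n + k))))"
    by (intro sum.cong refl) (simp add: tail)
  also have "\<dots> = (\<Sum>i\<le>L. \<Sum>j\<in>{1..m}. l j * (\<Sum>k<M - (i + n). ?g j i k))"
    by (simp add: sum_distrib_left pade_weight_def P_def L_def mult_ac)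
  also have "\<dots> = (\<Sum>i\<le>L. \<Sum>j\<in>{1..m}. l j * (\<Sum>k<r. ?g j i k))
       + (\<Sum>i\<le>L. \<Sum>j\<in>{1..m}. l j * (\<Sum>k\<in>{r..<M - (i + n)}. ?g j i k))"
  proof -
    \<comment> \<open>\<open>M >= m * r + n + r\<close> makes each tail at least \<open>r\<close>
      terms long, even for \<open>i = L\<close>.\<close>
    have "(\<Sum>k<M - (i + n). ?g j i k) = (\<Sum>k<r. ?g j i k) + (\<Sum>k\<in>{r..<M - (i + n)}. ?g j i k)"
      if "i \<le> L" for i j
      using M that by (simp add: lessThan_atLeast0 sum.atLeastLessThan_concat L_def)
    then show ?thesis by (simp add: sum.distrib[symmetric] distrib_left)
  qed
  also have "(\<Sum>i\<le>L. \<Sum>j\<in>{1..m}. l j * (\<Sum>k<r. ?g j i k)) = (\<Sum>j\<in>{1..m}. l j * (\<Sum>k<r. \<Sum>i\<le>L. ?g j i k))"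
  proof -
    have "(\<Sum>i\<le>L. \<Sum>j\<in>{1..m}. l j * (\<Sum>k<r. ?g j i k)) = (\<Sum>j\<in>{1..m}. \<Sum>i\<le>L. l j * (\<Sum>k<r. ?g j i k))"
      by (rule sum.swap)
    also have "\<dots> = (\<Sum>j\<in>{1..m}. l j * (\<Sum>i\<le>L. \<Sum>k<r. ?g j i k))"
      by (simp only: sum_distrib_left)
    also have "\<dots> = (\<Sum>j\<in>{1..m}. l j * (\<Sum>k<r. \<Sum>i\<le>L. ?g j i k))"
      by (subst sum.swap) (rule refl)
    finally show ?thesis .
  qed
  also have "\<dots> = 0"
    by (intro sum.neutral ballI) (simp add: low del: of_nat_mult of_nat_fact)
  also have "(\<Sum>i\<le>L. \<Sum>j\<in>{1..m}. l j * (\<Sum>k\<in>{r..<M - (i + n)}. ?g j i k))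
      = of_nat (fact (L + n) * fact r) * E"
  proof -
    have "?g j i k = of_nat (fact (L + n) * fact r) *
        (coeff P i * of_nat (((i + n + k) choose k) * (fact k div fact r)) * a j ^ (i + n + k))"
      if "i \<le> L" "r \<le> k" for i j k
    proof -
      have "fact r dvd (fact k :: nat)" using that by (simp add: fact_dvd)
      then have fk: "fact k = fact r * (fact k div fact r :: nat)" by simp
      have "(fact (L + n) div fact (i + n)) * fact (i + n + k)
          = fact (L + n) * (fact k * ((i + n + k) choose k) :: nat)"
        using that by (intro fact_div_mult_fact) auto
      also have "\<dots> = fact (L + n) * fact r * (((i + n + k) choose k) * (fact k div fact r))"
        by (subst fk) (simp add: mult_ac)
      finally show ?thesis by (simp only: of_nat_mult mult_ac)
    qed
    then show ?thesis
      unfolding E_def sum_distrib_left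
      by (intro sum.cong refl) (simp add: mult_ac del: of_nat_mult of_nat_fact)
  qed
  finally have "pade_denom m r a n * partial_form m l a M - pade_value m r l a n
      = of_nat (fact (m * r + n) * fact r) * E" by (simp add: L_def)
  moreover have "E \<in> R"
    unfolding E_def P_def
    by (intro subring_set_sum[OF R] subring_setD(5)[OF R] subring_set_coeff_node_poly[OF R]
        subring_set_of_nat[OF R] subring_set_power[OF R] a l) auto
  ultimately show ?thesis by blast
qed

lemma pade_denom_in:
  assumes R: "subring_set R" and a: "\<And>j. j \<in> {1..m} \<Longrightarrow> a j \<in> R"
  shows "pade_denom m r a n \<in> R"
  unfolding pade_denom_def pade_weight_def using assms
  by (intro subring_set_sum subring_setD subring_set_of_nat subring_set_coeff_node_poly) auto

lemma partial_form_in: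
  assumes R: "subring_set R" and a: "\<And>j. j \<in> {1..m} \<Longrightarrow> a j \<in> R" and l: "\<And>j. j \<in> {0..m} \<Longrightarrow> l j \<in> R"
  shows "partial_form m l a k \<in> R"
  unfolding partial_form_def using assms
  by (intro subring_setD(4) subring_set_sum subring_setD(5) subring_set_of_nat subring_set_power) auto

lemma pade_value_in:
  assumes R: "subring_set R" and a: "\<And>j. j \<in> {1..m} \<Longrightarrow> a j \<in> R" and l: "\<And>j. j \<in> {0..m} \<Longrightarrow> l j \<in> R"
  shows "pade_value m r l a n \<in> R"
  unfolding pade_value_def pade_weight_def using assms
  by (intro subring_set_sum[OF R] subring_setD(5)[OF R] subring_set_of_nat[OF R]
      subring_set_coeff_node_poly[OF R] partial_form_in[OF R]) auto

section \<open>Completions and local degrees\<close>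

locale abs_val =
  fixes w :: "'k::field_char_0 \<Rightarrow> real"
  assumes av: "absolute_value w"
begin

lemma nonneg [simp]: "w x \<ge> 0"
  and eq_0_iff [simp]: "w x = 0 \<longleftrightarrow> x = 0"
  and mult: "w (x * y) = w x * w y"
  and triangle: "w (x + y) \<le> w x + w y"
  using av by (auto simp: absolute_value_def)

lemma zero [simp]: "w 0 = 0" by simp

lemma one [simp]: "w 1 = 1"
  using mult[of 1 1] eq_0_iff[of 1] by (auto simp del: eq_0_iff)

lemma minus [simp]: "w (- x) = w x"
proof -
  have "w (-1) * w (-1) = 1" using mult[of "-1" "-1"] by simp
  then have "w (-1) = 1 \<or> w (-1) = -1" by (simp add: square_eq_1_iff)
  moreover have "w (-1) \<noteq> -1" using nonneg[of "-1"] by linarith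
  ultimately have "w (-1) = 1" by blast
  then show ?thesis using mult[of "-1" x] by simp
qed

lemma minus_commute: "w (x - y) = w (y - x)"
  using minus[of "x - y"] by simp

lemma triangle_diff: "w (x - y) \<le> w (x - z) + w (z - y)"
  using triangle[of "x - z" "z - y"] by simp

lemma triangle_minus: "w (x - y) \<le> w x + w y"
  using triangle[of x "- y"] by simp

lemma abs_diff_le: "\<bar>w x - w y\<bar> \<le> w (x - y)"
  using triangle[of "x - y" y] triangle[of "y - x" x] minus_commute[of x y] by auto

lemma power: "w (x ^ n) = w x ^ n"
  by (induction n) (auto simp: mult)

lemma inverse: "w (inverse x) = inverse (w x)"
  by (cases "x = 0") (use mult[of x "inverse x"] in \<open>auto simp: field_simps\<close>)

lemma divide: "w (x / y) = w x / w y"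
  by (simp add: divide_inverse mult inverse)

lemma pos_iff [simp]: "0 < w x \<longleftrightarrow> x \<noteq> 0"
  using nonneg[of x] eq_0_iff[of x] by linarith

lemma cauchyD: "cauchy_seq w x \<Longrightarrow> e > 0 \<Longrightarrow> \<exists>N. \<forall>i\<ge>N. \<forall>j\<ge>N. w (x i - x j) < e"
  by (auto simp: cauchy_seq_def)

lemma cauchy_const [simp]: "cauchy_seq w (\<lambda>_. a)"
  by (auto simp: cauchy_seq_def)

lemma cauchy_add:
  assumes "cauchy_seq w x" "cauchy_seq w y"
  shows "cauchy_seq w (\<lambda>n. x n + y n)"
  unfolding cauchy_seq_def
proof safe
  fix e :: real assume e: "e > 0"
  obtain N1 where N1: "\<And>i j. i \<ge> N1 \<Longrightarrow> j \<ge> N1 \<Longrightarrow> w (x i - x j) < e/2"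
    using cauchyD[OF assms(1), of "e/2"] e by auto
  obtain N2 where N2: "\<And>i j. i \<ge> N2 \<Longrightarrow> j \<ge> N2 \<Longrightarrow> w (y i - y j) < e/2"
    using cauchyD[OF assms(2), of "e/2"] e by auto
  show "\<exists>N. \<forall>i\<ge>N. \<forall>j\<ge>N. w (x i + y i - (x j + y j)) < e"
  proof (intro exI allI impI)
    fix i j assume "i \<ge> max N1 N2" "j \<ge> max N1 N2"
    then have "w (x i - x j) < e/2" "w (y i - y j) < e/2" using N1 N2 by auto
    moreover have "w (x i + y i - (x j + y j)) \<le> w (x i - x j) + w (y i - y j)"
      using triangle[of "x i - x j" "y i - y j"] by (simp add: algebra_simps)
    ultimately show "w (x i + y i - (x j + y j)) < e" by linarith
  qed
qed

lemma cauchy_uminus: "cauchy_seq w x \<Longrightarrow> cauchy_seq w (\<lambda>n. - x n)"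
  unfolding cauchy_seq_def by (metis minus minus_diff_minus)

lemma cauchy_diff: "cauchy_seq w x \<Longrightarrow> cauchy_seq w y \<Longrightarrow> cauchy_seq w (\<lambda>n. x n - y n)"
  using cauchy_add[of x "\<lambda>n. - y n"] cauchy_uminus[of y] by simp

lemma cauchy_bounded:
  assumes "cauchy_seq w x"
  shows "\<exists>C>0. \<forall>n. w (x n) \<le> C"
proof -
  obtain N where N: "\<And>i j. i \<ge> N \<Longrightarrow> j \<ge> N \<Longrightarrow> w (x i - x j) < 1"
    using cauchyD[OF assms, of 1] by auto
  define C where "C = Max ((\<lambda>i. w (x i)) ` {..N}) + 1"
  have le: "w (x i) \<le> C - 1" if "i \<le> N" for i using that by (auto simp: C_def)
  have "w (x n) \<le> C" for n
  proof (cases "n \<le> N")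
    case False
    then have "w (x n - x N) < 1" using N by auto
    then show ?thesis using triangle[of "x n - x N" "x N"] le[of N] by simp
  qed (use le in force)
  moreover have "C > 0" using le[of N] nonneg[of "x N"] by linarith
  ultimately show ?thesis by blast
qed

lemma cauchy_mult:
  assumes "cauchy_seq w x" "cauchy_seq w y"
  shows "cauchy_seq w (\<lambda>n. x n * y n)"
  unfolding cauchy_seq_def
proof safe
  fix e :: real assume e: "e > 0"
  obtain A where A: "A > 0" "\<And>n. w (x n) \<le> A" using cauchy_bounded[OF assms(1)] by auto
  obtain B where B: "B > 0" "\<And>n. w (y n) \<le> B" using cauchy_bounded[OF assms(2)] by auto
  obtain N1 where N1: "\<And>i j. i \<ge> N1 \<Longrightarrow> j \<ge> N1 \<Longrightarrow> w (x i - x j) < e/(2*B)"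
    using cauchyD[OF assms(1), of "e/(2*B)"] e B by auto
  obtain N2 where N2: "\<And>i j. i \<ge> N2 \<Longrightarrow> j \<ge> N2 \<Longrightarrow> w (y i - y j) < e/(2*A)"
    using cauchyD[OF assms(2), of "e/(2*A)"] e A by auto
  show "\<exists>N. \<forall>i\<ge>N. \<forall>j\<ge>N. w (x i * y i - x j * y j) < e"
  proof (intro exI allI impI)
    fix i j assume "i \<ge> max N1 N2" "j \<ge> max N1 N2"
    then have d: "w (x i - x j) < e/(2*B)" "w (y i - y j) < e/(2*A)" using N1 N2 by auto
    have "w (x i * y i - x j * y j) \<le> w (x i) * w (y i - y j) + w (x i - x j) * w (y j)"
    proof -
      have "x i * y i - x j * y j = x i * (y i - y j) + (x i - x j) * y j" by (simp add: algebra_simps)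
      then show ?thesis using triangle[of "x i * (y i - y j)" "(x i - x j) * y j"] by (simp add: mult)
    qed
    also have "w (x i) * w (y i - y j) \<le> A * w (y i - y j)" using A by (intro mult_right_mono) auto
    also have "\<dots> < A * (e/(2*A))" using d A by (intro mult_strict_left_mono) auto
    also have "w (x i - x j) * w (y j) \<le> e/(2*B) * B" using d B e by (intro mult_mono) (auto simp: less_imp_le)
    also have "A * (e/(2*A)) + e/(2*B) * B = e" using A B by (simp add: field_simps)
    finally show "w (x i * y i - x j * y j) < e" by simp
  qed
qed

lemma null_iff: "x \<in> null_seqs w \<longleftrightarrow> (\<lambda>n. w (x n)) \<longlonglongrightarrow> 0"
  by (simp add: null_seqs_def)

lemma null_cauchy:
  assumes "x \<in> null_seqs w"
  shows "cauchy_seq w x"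
  unfolding cauchy_seq_def
proof safe
  fix e :: real assume e: "e > 0"
  have "(\<lambda>n. w (x n)) \<longlonglongrightarrow> 0" using assms by (simp add: null_iff)
  from LIMSEQ_D[OF this, of "e/2"] e obtain N where N: "\<And>i. i \<ge> N \<Longrightarrow> w (x i) < e/2" by auto
  show "\<exists>N. \<forall>i\<ge>N. \<forall>j\<ge>N. w (x i - x j) < e"
  proof (intro exI allI impI)
    fix i j assume "i \<ge> N" "j \<ge> N"
    then show "w (x i - x j) < e" using N[of i] N[of j] triangle_minus[of "x i" "x j"] by linarith
  qed
qed

lemma null_add: "x \<in> null_seqs w \<Longrightarrow> y \<in> null_seqs w \<Longrightarrow> (\<lambda>n. x n + y n) \<in> null_seqs w"
  unfolding null_iff
  by (rule tendsto_0_le[where K = 1 and f = "\<lambda>n. w (x n) + w (y n)"])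
    (auto intro!: tendsto_eq_intros simp: triangle)

lemma null_uminus: "x \<in> null_seqs w \<Longrightarrow> (\<lambda>n. - x n) \<in> null_seqs w"
  by (simp add: null_iff)

lemma null_mult:
  assumes "x \<in> null_seqs w" "cauchy_seq w y"
  shows "(\<lambda>n. y n * x n) \<in> null_seqs w"
proof -
  obtain B where B: "B > 0" "\<And>n. w (y n) \<le> B" using cauchy_bounded[OF assms(2)] by auto
  show ?thesis
    using assms(1) unfolding null_iff
    by (rule tendsto_0_le[where K = B]) (auto simp: mult B intro!: always_eventually mult_left_mono simp: mult.commute[of "w (y n)" for n])
qed

lemma cauchy_ring_cring: "cring (cauchy_ring w)"
proof (rule cringI)
  show "abelian_group (cauchy_ring w)"
    by (rule abelian_groupI)
      (auto simp: cauchy_ring_def cauchy_add add_ac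
        intro!: exI[of _ "\<lambda>n. - x n" for x] cauchy_uminus)
  show "comm_monoid (cauchy_ring w)"
    by (rule comm_monoidI) (auto simp: cauchy_ring_def cauchy_mult mult_ac)
qed (auto simp: cauchy_ring_def cauchy_mult algebra_simps)

sublocale cr: cring "cauchy_ring w" by (rule cauchy_ring_cring)

lemma cr_simps [simp]:
  "carrier (cauchy_ring w) = {x. cauchy_seq w x}"
  "monoid.mult (cauchy_ring w) x y = (\<lambda>n. x n * y n)"
  "one (cauchy_ring w) = (\<lambda>_. 1)"
  "zero (cauchy_ring w) = (\<lambda>_. 0)"
  "add (cauchy_ring w) x y = (\<lambda>n. x n + y n)"
  by (auto simp: cauchy_ring_def)

lemma cr_uminus: "cauchy_seq w x \<Longrightarrow> a_inv (cauchy_ring w) x = (\<lambda>n. - x n)"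
  using cr.minus_equality[of "\<lambda>n. - x n" x] by (auto simp: cauchy_uminus)

lemma cr_minus: "cauchy_seq w x \<Longrightarrow> cauchy_seq w y \<Longrightarrow> a_minus (cauchy_ring w) x y = (\<lambda>n. x n - y n)"
  by (simp add: a_minus_def cr_uminus)

lemma null_ideal: "ideal (null_seqs w) (cauchy_ring w)"
proof (rule idealI)
  show "subgroup (null_seqs w) (add_monoid (cauchy_ring w))"
  proof (rule cr.add.subgroupI)
    show "null_seqs w \<noteq> {}" using null_iff[of "\<lambda>_. 0"] by auto
  qed (auto simp: null_cauchy null_add cr_uminus null_uminus)
next
  fix a x assume "a \<in> null_seqs w" "x \<in> carrier (cauchy_ring w)"
  then have "(\<lambda>n. x n * a n) \<in> null_seqs w" by (intro null_mult) auto
  then show "x \<otimes>\<^bsub>cauchy_ring w\<^esub> a \<in> null_seqs w" "a \<otimes>\<^bsub>cauchy_ring w\<^esub> x \<in> null_seqs w"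
    by (simp_all add: mult.commute)
qed (rule cr.ring_axioms)

sublocale nl: ideal "null_seqs w" "cauchy_ring w" by (rule null_ideal)

definition cls :: "(nat \<Rightarrow> 'k) \<Rightarrow> (nat \<Rightarrow> 'k) set" where
  "cls x = null_seqs w +>\<^bsub>cauchy_ring w\<^esub> x"

lemma completion_cring: "cring (completion w)"
  unfolding completion_def by (rule nl.quotient_is_cring) (rule cauchy_ring_cring)

sublocale K: cring "completion w" by (rule completion_cring)

lemma cls_hom: "cls \<in> Ring.ring_hom (cauchy_ring w) (completion w)"
  unfolding completion_def cls_def[abs_def] by (rule nl.rcos_ring_hom)

lemma cls_add: "cauchy_seq w x \<Longrightarrow> cauchy_seq w y \<Longrightarrow> cls x \<oplus>\<^bsub>completion w\<^esub> cls y = cls (\<lambda>n. x n + y n)"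
  using ring_hom_add[OF cls_hom, of x y] by simp

lemma cls_mult: "cauchy_seq w x \<Longrightarrow> cauchy_seq w y \<Longrightarrow> cls x \<otimes>\<^bsub>completion w\<^esub> cls y = cls (\<lambda>n. x n * y n)"
  using ring_hom_mult[OF cls_hom, of x y] by simp

lemma cls_one: "\<one>\<^bsub>completion w\<^esub> = cls (\<lambda>_. 1)"
  using ring_hom_one[OF cls_hom] by simp

lemma cls_closed [simp]: "cauchy_seq w x \<Longrightarrow> cls x \<in> carrier (completion w)"
  using ring_hom_closed[OF cls_hom, of x] by simp

lemma carrier_completion: "carrier (completion w) = cls ` {x. cauchy_seq w x}"
  by (auto simp: completion_def FactRing_def A_RCOSETS_def' cls_def)

lemma cls_eq_iff:
  assumes "cauchy_seq w x" "cauchy_seq w y"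
  shows "cls x = cls y \<longleftrightarrow> (\<lambda>n. x n - y n) \<in> null_seqs w"
  using cr.quotient_eq_iff_same_a_r_cos[OF null_ideal, of x y] assms
  by (simp add: cr_minus cls_def)

lemma cls_zero: "\<zero>\<^bsub>completion w\<^esub> = cls (\<lambda>_. 0)"
  using ring_hom_zero[OF cls_hom cr.ring_axioms K.ring_axioms] by simp

lemma cls_eq_zero_iff: "cauchy_seq w x \<Longrightarrow> cls x = \<zero>\<^bsub>completion w\<^esub> \<longleftrightarrow> x \<in> null_seqs w"
  by (simp add: cls_zero cls_eq_iff)

lemma cls_uminus: "cauchy_seq w x \<Longrightarrow> \<ominus>\<^bsub>completion w\<^esub> cls x = cls (\<lambda>n. - x n)"
  by (rule K.minus_equality) (auto simp: cls_add cauchy_uminus cls_zero)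

lemma cls_minus: "cauchy_seq w x \<Longrightarrow> cauchy_seq w y \<Longrightarrow> cls x \<ominus>\<^bsub>completion w\<^esub> cls y = cls (\<lambda>n. x n - y n)"
  by (simp add: a_minus_def cls_uminus cls_add cauchy_uminus)

lemma embed_cls: "embed w a = cls (\<lambda>_. a)"
  by (simp add: embed_def cls_def)

lemma mem_cls: "y \<in> cls x \<longleftrightarrow> (\<exists>h\<in>null_seqs w. y = (\<lambda>n. h n + x n))"
  by (auto simp: cls_def a_r_coset_def')

text \<open>Members of one class differ by null sequences, so the limit is shared by all
  representatives and the definite description in \<open>completion_abs\<close> denotes.\<close>

lemma completion_abs_cls:
  assumes "(\<lambda>n. w (x n)) \<longlonglongrightarrow> r"
  shows "completion_abs w (cls x) = r"
  unfolding completion_abs_def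
proof (rule the_equality)
  show "\<forall>y\<in>cls x. (\<lambda>n. w (y n)) \<longlonglongrightarrow> r"
  proof
    fix y assume "y \<in> cls x"
    then obtain h where h: "h \<in> null_seqs w" "y = (\<lambda>n. h n + x n)" by (auto simp: mem_cls)
    have "(\<lambda>n. w (y n) - w (x n)) \<longlonglongrightarrow> 0"
    proof (rule tendsto_0_le[where K = 1])
      show "(\<lambda>n. w (h n)) \<longlonglongrightarrow> 0" using h by (simp add: null_iff)
      show "\<forall>\<^sub>F n in sequentially. norm (w (y n) - w (x n)) \<le> norm (w (h n)) * 1"
        using abs_diff_le[of "y n" "x n" for n] h by auto
    qed
    from tendsto_add[OF this assms] show "(\<lambda>n. w (y n)) \<longlonglongrightarrow> r" by simp
  qed
  have "x \<in> cls x" unfolding mem_cls by (rule bexI[of _ "\<lambda>_. 0"]) (auto simp: null_iff)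
  then show "r' = r" if "\<forall>y\<in>cls x. (\<lambda>n. w (y n)) \<longlonglongrightarrow> r'" for r'
    using that assms LIMSEQ_unique by blast
qed

lemma cauchy_abs_convergent:
  assumes "cauchy_seq w x"
  shows "convergent (\<lambda>n. w (x n))"
proof (rule real_Cauchy_convergent, rule CauchyI)
  fix e :: real assume "e > 0"
  then obtain N where N: "\<And>i j. i \<ge> N \<Longrightarrow> j \<ge> N \<Longrightarrow> w (x i - x j) < e"
    using cauchyD[OF assms] by blast
  show "\<exists>N. \<forall>i\<ge>N. \<forall>j\<ge>N. norm (w (x i) - w (x j)) < e"
    using N abs_diff_le by (metis le_less_trans real_norm_def)
qed

lemma cauchy_abs_lim:
  "cauchy_seq w x \<Longrightarrow> (\<lambda>n. w (x n)) \<longlonglongrightarrow> completion_abs w (cls x)"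
  using cauchy_abs_convergent completion_abs_cls by (metis convergent_def)

lemma cauchy_sum: "(\<And>i. i \<in> A \<Longrightarrow> cauchy_seq w (f i)) \<Longrightarrow> cauchy_seq w (\<lambda>n. \<Sum>i\<in>A. f i n)"
  by (induction A rule: infinite_finite_induct) (auto intro: cauchy_add)

lemma finsum_cls:
  assumes "finite A" "\<And>i. i \<in> A \<Longrightarrow> cauchy_seq w (f i)"
  shows "finsum (completion w) (\<lambda>i. cls (f i)) A = cls (\<lambda>n. \<Sum>i\<in>A. f i n)"
  using assms
proof (induction A rule: finite_induct)
  case (insert x A)
  then show ?case
    by (subst K.finsum_insert) (auto simp: cls_add cauchy_sum)
qed (simp add: cls_zero)

text \<open>The embedded partial sums converge to the class of the sequence of partial sums itself.
  From here on, statements about the series in the completion become statements about limits of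
  \<open>w\<close> along that sequence.\<close>

lemma factorial_series_cls:
  assumes c: "cauchy_seq w (\<lambda>N. \<Sum>n<N. fact n * a ^ n)"
  shows "factorial_series w a = cls (\<lambda>N. \<Sum>n<N. fact n * a ^ n)"
proof -
  define s where "s = (\<lambda>N. \<Sum>n<N. fact n * a ^ n)"
  have cs: "cauchy_seq w s" using c by (simp add: s_def)
  have fs: "finsum (completion w) (\<lambda>n. embed w (fact n * a ^ n)) {..<N} = cls (\<lambda>_. s N)" for N
    unfolding embed_cls s_def by (rule finsum_cls) auto
  have lim: "(\<lambda>k. w (s N - x k)) \<longlonglongrightarrow> completion_abs w (cls (\<lambda>_. s N) \<ominus>\<^bsub>completion w\<^esub> cls x)"
    if "cauchy_seq w x" for x N
    using cauchy_abs_lim[of "\<lambda>k. s N - x k"] that by (simp add: cls_minus cauchy_diff)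
  show ?thesis
    unfolding factorial_series_def fs s_def[symmetric]
  proof (rule the_equality)
    have "(\<lambda>N. completion_abs w (cls (\<lambda>_. s N) \<ominus>\<^bsub>completion w\<^esub> cls s)) \<longlonglongrightarrow> 0"
    proof (rule LIMSEQ_I)
      fix e :: real assume "e > 0"
      then obtain N where N: "\<And>i j. i \<ge> N \<Longrightarrow> j \<ge> N \<Longrightarrow> w (s i - s j) < e / 2"
        using cauchyD[OF cs, of "e/2"] by auto
      have "norm (completion_abs w (cls (\<lambda>_. s n) \<ominus>\<^bsub>completion w\<^esub> cls s) - 0) < e" if "n \<ge> N" for n
      proof -
        have "completion_abs w (cls (\<lambda>_. s n) \<ominus>\<^bsub>completion w\<^esub> cls s) \<le> e / 2"
          using lim[OF cs, of n] by (rule LIMSEQ_le_const2) (use N that in \<open>auto intro: less_imp_le\<close>)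
        moreover have "completion_abs w (cls (\<lambda>_. s n) \<ominus>\<^bsub>completion w\<^esub> cls s) \<ge> 0"
          using lim[OF cs, of n] by (rule LIMSEQ_le_const) auto
        ultimately show ?thesis using \<open>e > 0\<close> by simp
      qed
      then show "\<exists>no. \<forall>n\<ge>no. norm (completion_abs w (cls (\<lambda>_. s n) \<ominus>\<^bsub>completion w\<^esub> cls s) - 0) < e"
        by blast
    qed
    then show "cls s \<in> carrier (completion w) \<and>
        (\<lambda>N. completion_abs w (cls (\<lambda>_. s N) \<ominus>\<^bsub>completion w\<^esub> cls s)) \<longlonglongrightarrow> 0"
      using cs by simp
  next
    fix L assume L: "L \<in> carrier (completion w) \<and>
        (\<lambda>N. completion_abs w (cls (\<lambda>_. s N) \<ominus>\<^bsub>completion w\<^esub> L)) \<longlonglongrightarrow> 0"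
    then obtain x where x: "cauchy_seq w x" "L = cls x" by (auto simp: carrier_completion)
    \<comment> \<open>Uniqueness: for a large fixed \<open>N\<close>, both \<open>x k\<close> and
      \<open>s k\<close> are eventually within e/2 of \<open>s N\<close>.\<close>
    have "(\<lambda>n. x n - s n) \<in> null_seqs w"
      unfolding null_iff
    proof (rule LIMSEQ_I)
      fix e :: real assume e: "e > 0"
      then obtain N1 where N1: "\<And>i j. i \<ge> N1 \<Longrightarrow> j \<ge> N1 \<Longrightarrow> w (s i - s j) < e / 2"
        using cauchyD[OF cs, of "e/2"] by auto
      obtain N2 where N2: "\<And>N. N \<ge> N2 \<Longrightarrow> completion_abs w (cls (\<lambda>_. s N) \<ominus>\<^bsub>completion w\<^esub> L) < e/2"
        using L e LIMSEQ_D[of _ 0 "e/2"] by (metis abs_less_iff diff_zero half_gt_zero real_norm_def)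
      define N where "N = max N1 N2"
      have "completion_abs w (cls (\<lambda>_. s N) \<ominus>\<^bsub>completion w\<^esub> cls x) < e/2"
        using N2[of N] x by (simp add: N_def)
      from order_tendstoD(2)[OF lim[OF x(1)] this]
      obtain N3 where N3: "\<And>k. k \<ge> N3 \<Longrightarrow> w (s N - x k) < e/2"
        by (auto simp: eventually_sequentially)
      have "norm (w (x k - s k) - 0) < e" if "k \<ge> max N N3" for k
      proof -
        have "w (x k - s N) < e/2" using N3[of k] that by (simp add: minus_commute)
        moreover have "w (s N - s k) < e/2" using N1[of N k] that by (simp add: N_def)
        ultimately show ?thesis using triangle_diff[of "x k" "s k" "s N"] by simp
      qed
      then show "\<exists>no. \<forall>n\<ge>no. norm (w (x n - s n) - 0) < e" by blast
    qed
    then show "L = cls s" using x cs by (simp add: cls_eq_iff)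
  qed
qed

lemma linear_form_cls:
  assumes c: "\<And>j. j \<in> {1..m} \<Longrightarrow> cauchy_seq w (\<lambda>N. \<Sum>n<N. fact n * a j ^ n)"
  shows "linear_form w m l a = cls (\<lambda>N. l 0 + (\<Sum>j\<in>{1..m}. l j * (\<Sum>n<N. fact n * a j ^ n)))"
    and "cauchy_seq w (\<lambda>N. l 0 + (\<Sum>j\<in>{1..m}. l j * (\<Sum>n<N. fact n * a j ^ n)))"
proof -
  have cm: "cauchy_seq w (\<lambda>N. l j * (\<Sum>n<N. fact n * a j ^ n))" if "j \<in> {1..m}" for j
    using cauchy_mult[OF cauchy_const c[OF that]] .
  have "finsum (completion w) (\<lambda>i. embed w (l i) \<otimes>\<^bsub>completion w\<^esub> factorial_series w (a i)) {1..m}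
      = finsum (completion w) (\<lambda>i. cls (\<lambda>N. l i * (\<Sum>n<N. fact n * a i ^ n))) {1..m}"
  proof (rule K.add.finprod_cong')
    fix i assume "i \<in> {1..m}"
    then show "embed w (l i) \<otimes>\<^bsub>completion w\<^esub> factorial_series w (a i)
        = cls (\<lambda>N. l i * (\<Sum>n<N. fact n * a i ^ n))"
      using c[of i] by (simp add: factorial_series_cls embed_cls cls_mult)
  qed (use cm in auto)
  also have "\<dots> = cls (\<lambda>N. \<Sum>j\<in>{1..m}. l j * (\<Sum>n<N. fact n * a j ^ n))"
    using cm by (intro finsum_cls) auto
  also have "embed w (l 0) \<oplus>\<^bsub>completion w\<^esub> \<dots> = cls (\<lambda>N. l 0 + (\<Sum>j\<in>{1..m}. l j * (\<Sum>n<N. fact n * a j ^ n)))"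
    unfolding embed_cls by (intro cls_add cauchy_const cauchy_sum cm)
  finally show "linear_form w m l a = cls (\<lambda>N. l 0 + (\<Sum>j\<in>{1..m}. l j * (\<Sum>n<N. fact n * a j ^ n)))"
    unfolding linear_form_def .
  show "cauchy_seq w (\<lambda>N. l 0 + (\<Sum>j\<in>{1..m}. l j * (\<Sum>n<N. fact n * a j ^ n)))"
    by (intro cauchy_add cauchy_const cauchy_sum cm)
qed

text \<open>A Cauchy sequence that is not null stays away from 0 from some index on. Earlier zeros
  are harmless under \<open>inverse 0 = 0\<close>, since the product differs from 1 only
  there.\<close>

lemma cauchy_inverse:
  assumes c: "cauchy_seq w x" and n: "x \<notin> null_seqs w"
  shows "cauchy_seq w (\<lambda>n. inverse (x n))" and "(\<lambda>n. x n * inverse (x n) - 1) \<in> null_seqs w"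
proof -
  obtain r where r: "(\<lambda>n. w (x n)) \<longlonglongrightarrow> r" using cauchy_abs_convergent[OF c] by (auto simp: convergent_def)
  have "r \<ge> 0" using r by (rule LIMSEQ_le_const) auto
  moreover have "r \<noteq> 0" using r n by (auto simp: null_iff)
  ultimately have r0: "r > 0" by simp
  then obtain N0 where N0: "\<And>n. n \<ge> N0 \<Longrightarrow> w (x n) > r/2"
    using order_tendstoD(1)[OF r, of "r/2"] by (auto simp: eventually_sequentially)
  have nz: "x n \<noteq> 0" if "n \<ge> N0" for n using N0[OF that] r0 by auto
  show "cauchy_seq w (\<lambda>n. inverse (x n))"
    unfolding cauchy_seq_def
  proof safe
    fix e :: real assume e: "e > 0"
    then obtain N1 where N1: "\<And>i j. i \<ge> N1 \<Longrightarrow> j \<ge> N1 \<Longrightarrow> w (x i - x j) < e * (r/2 * (r/2))"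
      using cauchyD[OF c, of "e * (r/2 * (r/2))"] r0 by auto
    show "\<exists>N. \<forall>i\<ge>N. \<forall>j\<ge>N. w (inverse (x i) - inverse (x j)) < e"
    proof (intro exI allI impI)
      fix i j assume ij: "i \<ge> max N0 N1" "j \<ge> max N0 N1"
      have "inverse (x i) - inverse (x j) = (x j - x i) / (x i * x j)"
        using nz[of i] nz[of j] ij by (simp add: field_simps)
      then have "w (inverse (x i) - inverse (x j)) = w (x j - x i) / (w (x i) * w (x j))"
        by (simp add: divide mult)
      also have "\<dots> < e * (r/2 * (r/2)) / (r/2 * (r/2))"
      proof (rule frac_less)
        show "r/2 * (r/2) \<le> w (x i) * w (x j)"
          using N0[of i] N0[of j] ij r0 by (intro mult_mono) auto
      qed (use N1 ij r0 in auto)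
      also have "\<dots> = e" using r0 by simp
      finally show "w (inverse (x i) - inverse (x j)) < e" .
    qed
  qed
  have "eventually (\<lambda>n. w (x n * inverse (x n) - 1) = 0) sequentially"
    unfolding eventually_sequentially using nz by (intro exI[of _ N0]) auto
  then show "(\<lambda>n. x n * inverse (x n) - 1) \<in> null_seqs w"
    unfolding null_iff by (rule tendsto_eventually)
qed

lemma completion_field: "field (completion w)"
proof (rule K.cring_fieldI2)
  show "\<zero>\<^bsub>completion w\<^esub> \<noteq> \<one>\<^bsub>completion w\<^esub>"
    by (simp add: cls_zero cls_one cls_eq_iff null_iff LIMSEQ_const_iff)
  fix a assume "a \<in> carrier (completion w)" "a \<noteq> \<zero>\<^bsub>completion w\<^esub>"
  then obtain x where x: "a = cls x" "cauchy_seq w x" unfolding carrier_completion by blast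
  then have "x \<notin> null_seqs w" using \<open>a \<noteq> \<zero>\<^bsub>completion w\<^esub>\<close> by (simp add: cls_eq_zero_iff)
  note x = x this
  note i = cauchy_inverse[OF x(2,3)]
  then have "a \<otimes>\<^bsub>completion w\<^esub> cls (\<lambda>n. inverse (x n)) = \<one>\<^bsub>completion w\<^esub>"
    using x by (simp add: cls_mult cls_one cls_eq_iff cauchy_mult)
  then show "\<exists>b\<in>carrier (completion w). a \<otimes>\<^bsub>completion w\<^esub> b = \<one>\<^bsub>completion w\<^esub>"
    using i by auto
qed

sublocale K: field "completion w" by (rule completion_field)

lemma rat_completion_cls: "rat_completion w = cls ` {x. cauchy_seq w x \<and> range x \<subseteq> \<rat>}"
  by (auto simp: rat_completion_def cls_def)

lemma rat_subfield: "subfield (rat_completion w) (completion w)"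
proof (rule K.subfieldI')
  show "subring (rat_completion w) (completion w)"
  proof (rule K.subringI)
    show "rat_completion w \<subseteq> carrier (completion w)"
      by (auto simp: rat_completion_cls)
    show "\<one>\<^bsub>completion w\<^esub> \<in> rat_completion w"
      by (auto simp: rat_completion_cls cls_one intro!: imageI)
    fix h assume "h \<in> rat_completion w"
    then obtain x where x: "h = cls x" "cauchy_seq w x" "range x \<subseteq> \<rat>" by (auto simp: rat_completion_cls)
    show "\<ominus>\<^bsub>completion w\<^esub> h \<in> rat_completion w"
      using x by (auto simp: rat_completion_cls cls_uminus cauchy_uminus intro!: imageI)
    fix g assume "g \<in> rat_completion w"
    then obtain y where y: "g = cls y" "cauchy_seq w y" "range y \<subseteq> \<rat>" by (auto simp: rat_completion_cls)
    show "h \<otimes>\<^bsub>completion w\<^esub> g \<in> rat_completion w"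
      using x y by (auto simp: rat_completion_cls cls_mult cauchy_mult intro!: imageI Rats_mult)
    show "h \<oplus>\<^bsub>completion w\<^esub> g \<in> rat_completion w"
      using x y by (auto simp: rat_completion_cls cls_add cauchy_add intro!: imageI Rats_add)
  qed
  fix k assume k: "k \<in> rat_completion w - {\<zero>\<^bsub>completion w\<^esub>}"
  then obtain x where x: "k = cls x" "cauchy_seq w x" "range x \<subseteq> \<rat>" by (auto simp: rat_completion_cls)
  then have "x \<notin> null_seqs w" using k by (simp add: cls_eq_zero_iff)
  note i = cauchy_inverse[OF x(2) this]
  have "k \<otimes>\<^bsub>completion w\<^esub> cls (\<lambda>n. inverse (x n)) = \<one>\<^bsub>completion w\<^esub>"
    using x i by (simp add: cls_mult cls_one cls_eq_iff cauchy_mult)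
  then have "inv\<^bsub>completion w\<^esub> k = cls (\<lambda>n. inverse (x n))"
    using x i by (intro K.comm_inv_char) auto
  then show "inv\<^bsub>completion w\<^esub> k \<in> rat_completion w"
    using x i by (auto simp: rat_completion_cls intro!: imageI Rats_inverse)
qed

end

section \<open>Rational combinations, local bases and the dimension of a completion\<close>

fun rlin :: "'k::comm_ring_1 list \<Rightarrow> 'k list \<Rightarrow> 'k" where
  "rlin (q # qs) (x # xs) = q * x + rlin qs xs"
| "rlin _ _ = 0"

lemma rlin_append_zeros [simp]: "rlin (qs @ replicate n 0) xs = rlin qs xs"
proof (induction qs arbitrary: xs)
  case Nil
  show ?case
  proof (induction n arbitrary: xs)
    case (Suc n)
    then show ?case by (cases xs) auto
  qed simp
next
  case (Cons q qs)
  then show ?case by (cases xs) auto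
qed

lemma rlin_take [simp]: "rlin (take (length xs) qs) xs = rlin qs xs"
  by (induction qs xs rule: rlin.induct) auto

lemma rlin_scale: "rlin (map ((*) c) qs) xs = c * rlin qs xs"
  by (induction qs xs rule: rlin.induct) (auto simp: algebra_simps)

lemma rlin_diff:
  assumes "length ps = length xs" "length qs = length xs"
  shows "rlin (map2 (-) ps qs) xs = rlin ps xs - rlin qs xs"
  using assms
proof (induction xs arbitrary: ps qs)
  case (Cons x xs)
  then show ?case by (cases ps; cases qs) (auto simp: algebra_simps)
qed auto

lemma rlin_add:
  assumes "length ps = length xs" "length qs = length xs"
  shows "rlin (map2 (+) ps qs) xs = rlin ps xs + rlin qs xs"
  using assms
proof (induction xs arbitrary: ps qs)
  case (Cons x xs)
  then show ?case by (cases ps; cases qs) (auto simp: algebra_simps)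
qed auto

lemma rlin_pad:
  fixes qs xs :: "'k::field_char_0 list"
  assumes "set qs \<subseteq> \<rat>"
  obtains ps where "set ps \<subseteq> \<rat>" "length ps = length xs" "rlin ps xs = rlin qs xs"
proof
  let ?ps = "take (length xs) (qs @ replicate (length xs) 0)"
  have "set (qs @ replicate (length xs) 0) \<subseteq> \<rat>"
    using assms by (auto simp: set_replicate_conv_if)
  then show "set ?ps \<subseteq> \<rat>" by (meson order_trans set_take_subset)
qed (simp_all only: rlin_take rlin_append_zeros, simp)

context abs_val
begin

text \<open>A quantitative form of linear independence over the rationals: the value of a
  combination controls each coefficient. Plain independence may be lost in the completion; this form
  survives limits of the coefficients.\<close>

definition well_indep :: "real \<Rightarrow> 'k list \<Rightarrow> bool" where
  "well_indep c xs \<longleftrightarrow> c > 0 \<and>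
     (\<forall>qs. set qs \<subseteq> \<rat> \<longrightarrow> (\<forall>q\<in>set (take (length xs) qs). c * w q \<le> w (rlin qs xs)))"

definition dense_list :: "'k list \<Rightarrow> bool" where
  "dense_list xs \<longleftrightarrow> (\<forall>y e. e > 0 \<longrightarrow> (\<exists>qs. set qs \<subseteq> \<rat> \<and> w (y - rlin qs xs) < e))"

lemma cauchy_rlin:
  "(\<forall>f\<in>set fs. cauchy_seq w f) \<Longrightarrow> cauchy_seq w (\<lambda>n. rlin (map (\<lambda>f. f n) fs) xs)"
proof (induction fs arbitrary: xs)
  case (Cons f fs)
  note prems = Cons.prems and IH = Cons.IH
  show ?case
  proof (cases xs)
    case (Cons x ys)
    have "cauchy_seq w (\<lambda>n. f n * x + rlin (map (\<lambda>f. f n) fs) ys)"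
      using prems IH by (intro cauchy_add cauchy_mult cauchy_const) auto
    then show ?thesis by (simp add: Cons)
  qed simp
qed simp

text \<open>\<open>rlin\<close> and \<open>combine\<close> both ignore the surplus entries of a
  longer list, so combinations carry over to the completion entry by entry.\<close>

lemma combine_cls:
  "(\<forall>f\<in>set fs. cauchy_seq w f) \<Longrightarrow>
   ring.combine (completion w) (map cls fs) (map (embed w) xs) = cls (\<lambda>n. rlin (map (\<lambda>f. f n) fs) xs)"
proof (induction fs arbitrary: xs)
  case (Cons f fs)
  then show ?case
    by (cases xs) (auto simp: K.combine.simps embed_cls cls_mult cls_add cls_zero cauchy_rlin cauchy_mult)
qed (auto simp: K.combine.simps cls_zero)

lemma rat_completion_list:
  assumes "set Ks \<subseteq> rat_completion w"
  obtains fs where "Ks = map cls fs" "\<forall>f\<in>set fs. cauchy_seq w f \<and> range f \<subseteq> \<rat>"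
proof -
  have "\<exists>fs. Ks = map cls fs \<and> (\<forall>f\<in>set fs. cauchy_seq w f \<and> range f \<subseteq> \<rat>)"
    using assms
  proof (induction Ks)
    case (Cons k Ks)
    then obtain fs f where "Ks = map cls fs" "\<forall>f\<in>set fs. cauchy_seq w f \<and> range f \<subseteq> \<rat>"
      "k = cls f" "cauchy_seq w f" "range f \<subseteq> \<rat>"
      by (auto simp: rat_completion_cls)
    then show ?case by (intro exI[of _ "f # fs"]) auto
  qed auto
  then show thesis using that by blast
qed

text \<open>Independence: if a combination with coefficient sequences is null, the bound makes each
  coefficient sequence null. Spanning: the terms of a Cauchy sequence are approximated by rational
  combinations, and the same bound forces their coefficients to be Cauchy. So the embedded list is a
  basis over the closure of the rationals.\<close>

lemma local_degree_eq:
  assumes wi: "well_indep c xs" and dn: "dense_list xs"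
  shows "local_degree w = length xs"
proof -
  let ?Us = "map (embed w) xs"
  have c0: "c > 0" using wi by (simp add: well_indep_def)
  have Us: "set ?Us \<subseteq> carrier (completion w)" by (auto simp: embed_cls)
  have "K.independent (rat_completion w) ?Us"
  proof (rule K.trivial_combine_imp_independent[OF rat_subfield Us])
    fix Ks assume Ks: "set Ks \<subseteq> rat_completion w" "K.combine Ks ?Us = \<zero>\<^bsub>completion w\<^esub>"
    obtain fs where fs: "Ks = map cls fs" "\<forall>f\<in>set fs. cauchy_seq w f \<and> range f \<subseteq> \<rat>"
      using rat_completion_list[OF Ks(1)] .
    have "(\<lambda>n. rlin (map (\<lambda>f. f n) fs) xs) \<in> null_seqs w"
      using Ks(2) fs by (simp add: combine_cls cls_eq_zero_iff cauchy_rlin)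
    then have lim: "(\<lambda>n. w (rlin (map (\<lambda>f. f n) fs) xs)) \<longlonglongrightarrow> 0" by (simp add: null_iff)
    have "cls f = \<zero>\<^bsub>completion w\<^esub>" if f: "f \<in> set (take (length xs) fs)" for f
    proof -
      have "c * w (f n) \<le> w (rlin (map (\<lambda>f. f n) fs) xs)" for n
      proof -
        have "set (map (\<lambda>f. f n) fs) \<subseteq> \<rat>" using fs by auto
        moreover have "f n \<in> set (take (length xs) (map (\<lambda>f. f n) fs))"
          using f by (auto simp: take_map)
        ultimately show ?thesis using wi unfolding well_indep_def by blast
      qed
      then have "(\<lambda>n. w (f n)) \<longlonglongrightarrow> 0"
        using lim c0 by (intro tendsto_0_le[OF lim, where K = "1 / c"]) (auto simp: field_simps)
      then show ?thesis using fs f in_set_takeD[OF f] by (auto simp: cls_eq_zero_iff null_iff)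
    qed
    then show "set (take (length ?Us) Ks) \<subseteq> {\<zero>\<^bsub>completion w\<^esub>}"
      by (auto simp: fs(1) take_map)
  qed
  then have "K.dimension (length ?Us) (rat_completion w) (K.Span (rat_completion w) ?Us)"
    by (rule K.dimension_independent)
  moreover have "K.Span (rat_completion w) ?Us = carrier (completion w)"
  proof
    show "K.Span (rat_completion w) ?Us \<subseteq> carrier (completion w)"
      using K.Span_in_carrier[OF _ Us] K.subring_props(1)[OF rat_subfield] by blast
    show "carrier (completion w) \<subseteq> K.Span (rat_completion w) ?Us"
    proof
      fix a assume "a \<in> carrier (completion w)"
      then obtain y where y: "a = cls y" "cauchy_seq w y" by (auto simp: carrier_completion)
      have "\<exists>ps. set ps \<subseteq> \<rat> \<and> length ps = length xs \<and> w (y n - rlin ps xs) < 1 / Suc n" for n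
      proof -
        obtain qs where qs: "set qs \<subseteq> \<rat>" "w (y n - rlin qs xs) < 1 / Suc n"
          using dn unfolding dense_list_def by (metis of_nat_0_less_iff zero_less_Suc zero_less_divide_1_iff)
        show ?thesis using rlin_pad[OF qs(1), of xs] qs(2) by metis
      qed
      then obtain ps where ps: "\<And>n. set (ps n) \<subseteq> \<rat>" "\<And>n. length (ps n) = length xs"
        "\<And>n. w (y n - rlin (ps n) xs) < 1 / Suc n" by metis
      have lim0: "(\<lambda>n. y n - rlin (ps n) xs) \<in> null_seqs w"
        unfolding null_iff
      proof (rule tendsto_0_le[OF LIMSEQ_inverse_real_of_nat, where K = 1], rule always_eventually, rule allI)
        fix n show "norm (w (y n - rlin (ps n) xs)) \<le> norm (inverse (real (Suc n))) * 1"
          using ps(3)[of n] by (simp add: inverse_eq_divide)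
      qed
      have "cauchy_seq w (\<lambda>n. y n - (y n - rlin (ps n) xs))"
        using y(2) null_cauchy[OF lim0] by (rule cauchy_diff)
      then have cr: "cauchy_seq w (\<lambda>n. rlin (ps n) xs)" by simp
      \<comment> \<open>Reads the combinations \<open>ps n\<close> by columns: the
        \<open>i\<close>-th function is the sequence of the \<open>i\<close>-th
        coefficients.\<close>
      define fs where "fs = map (\<lambda>i n. ps n ! i) [0..<length xs]"
      have mapfs: "map (\<lambda>f. f n) fs = ps n" for n
        using ps(2)[of n] by (auto simp: fs_def intro!: nth_equalityI)
      have cf: "cauchy_seq w (\<lambda>n. ps n ! i)" if i: "i < length xs" for i
        unfolding cauchy_seq_def
      proof safe
        fix e :: real assume "e > 0"
        then obtain N where N: "\<And>k j. k \<ge> N \<Longrightarrow> j \<ge> N \<Longrightarrow> w (rlin (ps k) xs - rlin (ps j) xs) < c * e"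
          using cauchyD[OF cr, of "c * e"] c0 by auto
        have "w (ps k ! i - ps j ! i) < e" if "k \<ge> N" "j \<ge> N" for k j
        proof -
          let ?d = "map2 (-) (ps k) (ps j)"
          have "set ?d \<subseteq> \<rat>" using ps(1)[of k] ps(1)[of j]
            by (auto dest!: set_zip_leftD set_zip_rightD dest: subsetD simp: set_zip)
              (metis Rats_diff nth_mem subsetD)
          moreover have "length ?d = length xs" using ps(2) by simp
          moreover have "?d ! i = ps k ! i - ps j ! i" using ps(2) i by simp
          ultimately have "c * w (ps k ! i - ps j ! i) \<le> w (rlin ?d xs)"
            using wi i unfolding well_indep_def by (metis nth_mem take_all_iff order_refl)
          also have "\<dots> < c * e" using N[OF that] ps(2) by (simp add: rlin_diff)
          finally show ?thesis using c0 by simp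
        qed
        then show "\<exists>N. \<forall>k\<ge>N. \<forall>j\<ge>N. w (ps k ! i - ps j ! i) < e" by blast
      qed
      have cfs: "\<forall>f\<in>set fs. cauchy_seq w f" using cf by (auto simp: fs_def)
      have "range f \<subseteq> \<rat>" if "f \<in> set fs" for f
        using that ps(1,2) by (auto simp: fs_def) (metis nth_mem subsetD)
      then have Ks: "set (map cls fs) \<subseteq> rat_completion w"
        using cfs by (auto simp: rat_completion_cls)
      have "a = cls (\<lambda>n. rlin (ps n) xs)"
        using y lim0 cr by (simp add: cls_eq_iff)
      also have "\<dots> = K.combine (map cls fs) ?Us"
        using combine_cls[OF cfs, of xs] by (simp add: mapfs)
      finally show "a \<in> K.Span (rat_completion w) ?Us"
        using K.Span_eq_combine_set[OF rat_subfield Us] Ks by blast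
    qed
  qed
  ultimately show ?thesis
    using K.dimI[OF rat_subfield] unfolding local_degree_def over_def by simp
qed

text \<open>Dividing a combination by the coefficient \<open>p\<close> of \<open>y\<close> shows
  that its value is at least \<open>e * w p\<close>; this bounds \<open>p\<close>, and subtracting
  \<open>p * y\<close> bounds the other coefficients at the cost of the factor
  \<open>D\<close>.\<close>

lemma well_indep_extend:
  assumes wi: "well_indep c xs" and e: "e > 0"
    and far: "\<And>qs. set qs \<subseteq> \<rat> \<Longrightarrow> w (y - rlin qs xs) \<ge> e"
  shows "\<exists>c. well_indep c (y # xs)"
proof -
  have c0: "c > 0" using wi by (simp add: well_indep_def)
  define D where "D = 1 + w y / e"
  have D: "D > 0" using e by (simp add: D_def add_pos_nonneg)
  define c' where "c' = min e (c / D)"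
  have "c' > 0" using e c0 D by (simp add: c'_def)
  moreover have "c' * w q \<le> w (rlin qs (y # xs))"
    if qs: "set qs \<subseteq> \<rat>" "q \<in> set (take (length (y # xs)) qs)" for qs q
  proof -
    obtain p ps where p: "qs = p # ps" using qs by (cases qs) auto
    have pr: "p \<in> \<rat>" "set ps \<subseteq> \<rat>" using qs p by auto
    have le1: "e * w p \<le> w (rlin qs (y # xs))"
    proof (cases "p = 0")
      case False
      have eq: "rlin qs (y # xs) = p * (y - rlin (map ((*) (- inverse p)) ps) xs)"
        using False by (simp add: p rlin_scale field_simps)
      moreover have "set (map ((*) (- inverse p)) ps) \<subseteq> \<rat>"
        using pr by (auto intro!: Rats_mult)
      ultimately have "e \<le> w (y - rlin (map ((*) (- inverse p)) ps) xs)" using far by blast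
      then show ?thesis
        unfolding eq mult by (subst mult.commute) (simp add: mult_left_mono)
    qed auto
    have le2: "c * w q \<le> D * w (rlin qs (y # xs))" if "q \<in> set (take (length xs) ps)"
    proof -
      have "c * w q \<le> w (rlin ps xs)" using wi pr that by (auto simp: well_indep_def)
      also have "\<dots> \<le> w (rlin qs (y # xs)) + w p * w y"
        using triangle_minus[of "rlin qs (y # xs)" "p * y"] by (simp add: p mult)
      also have "w p * w y \<le> w (rlin qs (y # xs)) / e * w y"
        using le1 e by (intro mult_right_mono) (auto simp: field_simps)
      finally show ?thesis by (simp add: D_def algebra_simps)
    qed
    show ?thesis
    proof (cases "q = p")
      case True
      have "c' * w q \<le> e * w p" using True by (simp add: c'_def mult_right_mono)
      then show ?thesis using le1 by linarith
    next
      case False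
      then have "q \<in> set (take (length xs) ps)" using qs p by auto
      from le2[OF this] have "c / D * w q \<le> w (rlin qs (y # xs))" using D by (simp add: field_simps)
      moreover have "c' * w q \<le> c / D * w q" unfolding c'_def by (intro mult_right_mono) auto
      ultimately show ?thesis by linarith
    qed
  qed
  ultimately show ?thesis unfolding well_indep_def by blast
qed

lemma in_span_rlin:
  assumes "y \<in> rat_vs.span (set xs)"
  shows "\<exists>qs. set qs \<subseteq> \<rat> \<and> y = rlin qs xs"
proof -
  have *: "\<exists>qs. set qs \<subseteq> \<rat> \<and> x = rlin qs xs" if "x \<in> set xs" for x
    using that
  proof (induction xs)
    case (Cons z xs)
    show ?case
    proof (cases "x = z")
      case True
      then show ?thesis by (intro exI[of _ "[1]"]) auto
    next
      case False
      then obtain qs where "set qs \<subseteq> \<rat>" "x = rlin qs xs" using Cons by auto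
      then show ?thesis by (intro exI[of _ "0 # qs"]) auto
    qed
  qed auto
  have sub: "rat_vs.subspace {y. \<exists>qs. set qs \<subseteq> \<rat> \<and> y = rlin qs xs}"
  proof (rule rat_vs.subspaceI)
    show "0 \<in> {y. \<exists>qs. set qs \<subseteq> \<rat> \<and> y = rlin qs xs}" by (auto intro!: exI[of _ "[]"])
    fix x y assume "x \<in> {y. \<exists>qs. set qs \<subseteq> \<rat> \<and> y = rlin qs xs}" "y \<in> {y. \<exists>qs. set qs \<subseteq> \<rat> \<and> y = rlin qs xs}"
    then obtain ps' qs' where *: "set ps' \<subseteq> \<rat>" "x = rlin ps' xs" "set qs' \<subseteq> \<rat>" "y = rlin qs' xs"
      by blast
    obtain ps where "set ps \<subseteq> \<rat>" "length ps = length xs" "x = rlin ps xs"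
      using rlin_pad[OF *(1), of xs] *(2) by metis
    moreover obtain qs where "set qs \<subseteq> \<rat>" "length qs = length xs" "y = rlin qs xs"
      using rlin_pad[OF *(3), of xs] *(4) by metis
    ultimately show "x + y \<in> {y. \<exists>qs. set qs \<subseteq> \<rat> \<and> y = rlin qs xs}"
      by (intro CollectI exI[of _ "map2 (+) ps qs"] conjI)
        (simp_all add: rlin_add, fastforce dest: set_zip_leftD set_zip_rightD intro!: Rats_add)
  next
    fix c x assume "x \<in> {y. \<exists>qs. set qs \<subseteq> \<rat> \<and> y = rlin qs xs}"
    then obtain qs where "set qs \<subseteq> \<rat>" "x = rlin qs xs" by auto
    then show "of_rat c * x \<in> {y. \<exists>qs. set qs \<subseteq> \<rat> \<and> y = rlin qs xs}"
      by (auto simp: rlin_scale intro!: exI[of _ "map ((*) (of_rat c)) qs"] Rats_mult)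
  qed
  show ?thesis using rat_vs.span_minimal[OF _ sub, of "set xs"] * assms by blast
qed

lemma well_indep_independent:
  "well_indep c xs \<Longrightarrow> distinct xs \<and> rat_vs.independent (set xs)"
proof (induction xs)
  case (Cons y xs)
  have c0: "c > 0" using Cons by (simp add: well_indep_def)
  have "well_indep c xs" unfolding well_indep_def
  proof (intro conjI allI impI ballI)
    fix qs :: "'k list" and q assume qs: "set qs \<subseteq> \<rat>" "q \<in> set (take (length xs) qs)"
    have "set (0 # qs) \<subseteq> \<rat>" "q \<in> set (take (length (y # xs)) (0 # qs))" using qs by auto
    then have "c * w q \<le> w (rlin (0 # qs) (y # xs))" using Cons.prems unfolding well_indep_def by blast
    then show "c * w q \<le> w (rlin qs xs)" by simp
  qed (use c0 in auto)
  then have IH: "distinct xs" "rat_vs.independent (set xs)" using Cons.IH by auto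
  have "y \<notin> rat_vs.span (set xs)"
  proof
    assume "y \<in> rat_vs.span (set xs)"
    then obtain qs where qs: "set qs \<subseteq> \<rat>" "y = rlin qs xs" using in_span_rlin by blast
    have "set (1 # map ((*) (-1)) qs) \<subseteq> \<rat>" using qs by (auto intro: Rats_minus_iff[THEN iffD2])
    moreover have "1 \<in> set (take (length (y # xs)) (1 # map ((*) (-1)) qs))" by simp
    ultimately have "c * w 1 \<le> w (rlin (1 # map ((*) (-1)) qs) (y # xs))"
      using Cons.prems unfolding well_indep_def by blast
    then show False using qs(2) c0 by (simp add: rlin_scale del: map_map)
  qed
  then show ?case using IH by (auto simp: rat_vs.independent_insert rat_vs.span_base)
qed (simp add: rat_vs.independent_empty)

text \<open>A list of maximal length with this bound must be dense: an element at positive distance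
  from its span could be prepended. Lengths are bounded because such lists are linearly
  independent.\<close>

lemma exists_local_basis:
  assumes nf: "number_field TYPE('k)"
  shows "\<exists>c xs. well_indep c xs \<and> dense_list xs \<and> local_degree w = length xs"
proof -
  obtain B :: "'k set" where B: "finite B" "rat_vs.span B = UNIV" using nf by (auto simp: number_field_def)
  have bound: "length xs \<le> card B" if "well_indep c xs" for c xs
  proof -
    have "distinct xs" "rat_vs.independent (set xs)" using well_indep_independent[OF that] by auto
    then show ?thesis
      using rat_vs.independent_span_bound[OF B(1), of "set xs"] B(2) by (auto simp: distinct_card)
  qed
  define P where "P n \<longleftrightarrow> (\<exists>c xs. well_indep c xs \<and> length xs = n)" for n
  have "P 0" unfolding P_def by (intro exI[of _ 1] exI[of _ "[]"]) (auto simp: well_indep_def)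
  moreover have "\<forall>n. P n \<longrightarrow> n \<le> card B" using bound by (auto simp: P_def)
  ultimately obtain n where n: "P n" "\<And>k. P k \<Longrightarrow> k \<le> n"
    using Greatest_le_nat[of P _ "card B"] GreatestI_nat[of P 0 "card B"] by metis
  then obtain c xs where xs: "well_indep c xs" "length xs = n" by (auto simp: P_def)
  have "dense_list xs" unfolding dense_list_def
  proof (intro allI impI, rule ccontr)
    fix y and e :: real
    assume e: "e > 0" and "\<not> (\<exists>qs. set qs \<subseteq> \<rat> \<and> w (y - rlin qs xs) < e)"
    then have "w (y - rlin qs xs) \<ge> e" if "set qs \<subseteq> \<rat>" for qs using that by force
    from well_indep_extend[OF xs(1) e this] have "P (Suc n)" unfolding P_def using xs(2)
      by (metis length_Cons)
    then show False using n(2)[of "Suc n"] by simp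
  qed
  then show ?thesis using xs local_degree_eq by blast
qed

end

section \<open>Existence of places\<close>

text \<open>An ultrametric submultiplicative seminorm. The value at 1 stays open, since the norm
  built from coordinates below becomes normalised only after passing to
  \<open>spectral\<close>.\<close>

definition ring_norm :: "('k::field_char_0 \<Rightarrow> real) \<Rightarrow> bool" where
  "ring_norm f \<longleftrightarrow> (\<forall>x. f x \<ge> 0) \<and> f 0 = 0 \<and> (\<forall>x. f (- x) = f x) \<and>
     (\<forall>x y. f (x + y) \<le> max (f x) (f y)) \<and> (\<forall>x y. f (x * y) \<le> f x * f y)"

lemma ring_normD:
  assumes "ring_norm f"
  shows "f x \<ge> 0" "f 0 = 0" "f (- x) = f x" "f (x + y) \<le> max (f x) (f y)" "f (x * y) \<le> f x * f y"
  using assms by (auto simp: ring_norm_def)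

lemma ring_norm_sum:
  assumes f: "ring_norm f" and "B \<ge> 0" and "\<And>i. i \<in> A \<Longrightarrow> f (g i) \<le> B"
  shows "f (sum g A) \<le> B"
  using assms(3)
proof (induction A rule: infinite_finite_induct)
  case (insert x A)
  then have "f (g x) \<le> B" "f (sum g A) \<le> B" by auto
  then show ?case using ring_normD(4)[OF f, of "g x" "sum g A"] insert(1,2) by simp
qed (auto simp: assms(2) ring_normD[OF f])

lemma ring_norm_of_nat_mult: "ring_norm f \<Longrightarrow> f (of_nat n * x) \<le> f x"
proof (induction n)
  case (Suc n)
  then show ?case using ring_normD(4)[OF Suc.prems, of x "of_nat n * x"]
    by (simp add: algebra_simps)
qed (auto simp: ring_normD)

lemma ring_norm_of_int_mult: "ring_norm f \<Longrightarrow> f (of_int n * x) \<le> f x"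
  by (cases n) (use ring_norm_of_nat_mult ring_normD(3) in \<open>auto simp del: of_nat_Suc simp: ring_normD(3)\<close>)

lemma ring_norm_power_mult: "ring_norm f \<Longrightarrow> f (x ^ n * y) \<le> f x ^ n * f y"
proof (induction n)
  case (Suc n)
  have "f (x ^ Suc n * y) \<le> f x * f (x ^ n * y)"
    using ring_normD(5)[OF Suc.prems, of x "x ^ n * y"] by (simp add: mult.assoc)
  also have "\<dots> \<le> f x * (f x ^ n * f y)"
    using Suc by (intro mult_left_mono) (auto simp: ring_normD)
  finally show ?case by (simp add: mult.assoc)
qed simp

text \<open>The spectral radius formula, restricted to exponents 2 ^ k because there
  submultiplicativity at once makes the sequence of roots decreasing.\<close>

definition spectral :: "('k::field_char_0 \<Rightarrow> real) \<Rightarrow> 'k \<Rightarrow> real" where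
  "spectral f x = lim (\<lambda>k. root (2 ^ k) (f (x ^ (2 ^ k))))"

lemma root_power_2:
  assumes "r \<ge> 0" shows "root (2 ^ k) (r ^ (2 ^ k)) = r"
  using assms by (intro real_root_power_cancel) auto

context
  fixes f :: "'k::field_char_0 \<Rightarrow> real"
  assumes f: "ring_norm f"
begin

lemma spectral_step: "root (2 ^ Suc k) (f (x ^ (2 ^ Suc k))) \<le> root (2 ^ k) (f (x ^ (2 ^ k)))"
proof -
  have "f (x ^ (2 ^ Suc k)) \<le> f (x ^ (2 ^ k)) ^ 2"
    using ring_normD(5)[OF f, of "x ^ (2 ^ k)" "x ^ (2 ^ k)"]
    by (simp add: power_add[symmetric] power2_eq_square mult_2)
  then have "root (2 ^ Suc k) (f (x ^ (2 ^ Suc k))) \<le> root (2 ^ Suc k) (f (x ^ (2 ^ k)) ^ 2)"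
    by (intro real_root_le_mono) auto
  also have "\<dots> = root (2 ^ k) (root 2 (f (x ^ (2 ^ k)) ^ 2))"
    by (simp add: real_root_mult_exp[symmetric] mult.commute)
  also have "\<dots> = root (2 ^ k) (f (x ^ (2 ^ k)))"
    using ring_normD(1)[OF f] by (simp add: sqrt_def[symmetric])
  finally show ?thesis .
qed

lemma spectral_lim: "(\<lambda>k. root (2 ^ k) (f (x ^ (2 ^ k)))) \<longlonglongrightarrow> spectral f x"
proof -
  have "decseq (\<lambda>k. root (2 ^ k) (f (x ^ (2 ^ k))))"
    by (rule decseq_SucI) (rule spectral_step)
  moreover have "0 \<le> root (2 ^ k) (f (x ^ (2 ^ k)))" for k
    using ring_normD(1)[OF f] by simp
  ultimately have "convergent (\<lambda>k. root (2 ^ k) (f (x ^ (2 ^ k))))"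
    by (elim decseq_convergent[where B = 0]) (auto simp: convergent_def)
  then show ?thesis unfolding spectral_def by (rule convergent_LIMSEQ_iff[THEN iffD1])
qed

lemma spectral_le_root: "spectral f x \<le> root (2 ^ k) (f (x ^ (2 ^ k)))"
  by (rule decseq_ge[OF decseq_SucI spectral_lim]) (rule spectral_step)

lemma spectral_le: "spectral f x \<le> f x"
  using spectral_le_root[of x 0] by simp

lemma spectral_nonneg: "spectral f x \<ge> 0"
  by (rule LIMSEQ_le_const[OF spectral_lim]) (auto simp: ring_normD[OF f])

lemma root_const_lim:
  assumes "C > 0" shows "(\<lambda>k. root (2 ^ k) C) \<longlonglongrightarrow> 1"
proof -
  have "filterlim (\<lambda>k. 2 ^ k :: nat) at_top sequentially"
    by (rule filterlim_subseq) (auto simp: strict_mono_def)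
  from filterlim_compose[OF LIMSEQ_root_const[OF assms] this] show ?thesis .
qed

lemma spectral_leI:
  assumes "C > 0" "r \<ge> 0" "\<And>k. f (x ^ (2 ^ k)) \<le> C * r ^ (2 ^ k)"
  shows "spectral f x \<le> r"
proof (rule LIMSEQ_le[OF spectral_lim])
  show "(\<lambda>k. root (2 ^ k) C * r) \<longlonglongrightarrow> r"
    using tendsto_mult[OF root_const_lim[OF assms(1)] tendsto_const[of r]] by simp
  have "root (2 ^ k) (f (x ^ (2 ^ k))) \<le> root (2 ^ k) C * r" for k
  proof -
    have "root (2 ^ k) (f (x ^ (2 ^ k))) \<le> root (2 ^ k) (C * r ^ (2 ^ k))"
      using assms(3) by (intro real_root_le_mono) auto
    then show ?thesis using assms(2) by (simp add: real_root_mult root_power_2)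
  qed
  then show "\<exists>N. \<forall>k\<ge>N. root (2 ^ k) (f (x ^ (2 ^ k))) \<le> root (2 ^ k) C * r" by blast
qed

lemma spectral_mult: "spectral f (x * y) \<le> spectral f x * spectral f y"
proof (rule LIMSEQ_le[OF spectral_lim tendsto_mult[OF spectral_lim spectral_lim]])
  have "root (2 ^ k) (f ((x * y) ^ (2 ^ k))) \<le> root (2 ^ k) (f (x ^ (2 ^ k))) * root (2 ^ k) (f (y ^ (2 ^ k)))" for k
    using ring_normD(5)[OF f, of "x ^ (2 ^ k)" "y ^ (2 ^ k)"]
    by (simp add: power_mult_distrib real_root_mult[symmetric])
  then show "\<exists>N. \<forall>k\<ge>N. root (2 ^ k) (f ((x * y) ^ (2 ^ k))) \<le>
      root (2 ^ k) (f (x ^ (2 ^ k))) * root (2 ^ k) (f (y ^ (2 ^ k)))" by blast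
qed

lemma spectral_square: "spectral f (x ^ 2) = spectral f x ^ 2"
proof (rule LIMSEQ_unique[OF spectral_lim])
  have eq: "root (2 ^ k) (f ((x ^ 2) ^ (2 ^ k))) = root (2 ^ Suc k) (f (x ^ (2 ^ Suc k))) ^ 2" for k
  proof -
    have "root (2 ^ Suc k) (f (x ^ (2 ^ Suc k))) = root 2 (root (2 ^ k) (f ((x ^ 2) ^ (2 ^ k))))"
      by (simp add: real_root_mult_exp power_mult)
    then show ?thesis using ring_normD(1)[OF f] by simp
  qed
  show "(\<lambda>k. root (2 ^ k) (f ((x ^ 2) ^ (2 ^ k)))) \<longlonglongrightarrow> spectral f x ^ 2"
    unfolding eq using LIMSEQ_Suc[OF spectral_lim[of x]] by (intro tendsto_power)
qed

text \<open>For \<open>A\<close> above both spectral values, all powers satisfy f(z^i) <= C A^i. The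
  binomial expansion of (x + y)^N and the ultrametric inequality then give C1 C2 A^N, and the
  constants disappear when roots are taken.\<close>

lemma spectral_add: "spectral f (x + y) \<le> max (spectral f x) (spectral f y)"
proof (rule dense_ge)
  fix A assume A: "max (spectral f x) (spectral f y) < A"
  then have A0: "A > 0" using spectral_nonneg[of x] by linarith
  have bd: "\<exists>C>0. \<forall>i. f (z ^ i) \<le> C * A ^ i" if z: "spectral f z < A" for z
  proof -
    obtain k where k: "root (2 ^ k) (f (z ^ (2 ^ k))) < A"
      using order_tendstoD(2)[OF spectral_lim z] by (auto simp: eventually_sequentially)
    define K :: nat where "K = 2 ^ k"
    have K0: "K > 0" by (simp add: K_def)
    have "root K (f (z ^ K)) ^ K \<le> A ^ K"
      using k ring_normD(1)[OF f] by (intro power_mono) (auto simp: K_def)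
    then have fK: "f (z ^ K) \<le> A ^ K"
      using ring_normD(1)[OF f] K0 by simp
    define C where "C = Max ((\<lambda>r. f (z ^ r) / A ^ r) ` {..<K}) + 1"
    have Cr: "f (z ^ r) / A ^ r \<le> C - 1" if "r < K" for r
      using that by (auto simp: C_def intro!: Max_ge)
    have "f (z ^ 0) / A ^ 0 \<ge> 0" using ring_normD(1)[OF f] by simp
    then have C0: "C > 0" using Cr[OF K0] by linarith
    have "f (z ^ i) \<le> C * A ^ i" for i
    proof -
      \<comment> \<open>One exponent \<open>K\<close> with f(z^K) <= A^K controls all exponents; the
        finitely many remainders modulo \<open>K\<close> go into \<open>C\<close>.\<close>
      have "f (z ^ i) = f ((z ^ K) ^ (i div K) * z ^ (i mod K))"
        by (simp add: power_mult[symmetric] power_add[symmetric])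
      also have "\<dots> \<le> f (z ^ K) ^ (i div K) * f (z ^ (i mod K))"
        by (rule ring_norm_power_mult[OF f])
      also have "\<dots> \<le> (A ^ K) ^ (i div K) * (C * A ^ (i mod K))"
      proof (intro mult_mono power_mono fK)
        have "f (z ^ (i mod K)) / A ^ (i mod K) \<le> C" using Cr[of "i mod K"] K0 by simp
        then show "f (z ^ (i mod K)) \<le> C * A ^ (i mod K)" using A0 by (simp add: field_simps)
      qed (use A0 ring_normD(1)[OF f] in auto)
      also have "\<dots> = C * A ^ i"
        by (simp add: power_mult[symmetric] power_add[symmetric] mult.left_commute)
      finally show ?thesis .
    qed
    then show ?thesis using C0 by blast
  qed
  obtain C1 where C1: "C1 > 0" "\<And>i. f (x ^ i) \<le> C1 * A ^ i" using bd[of x] A by auto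
  obtain C2 where C2: "C2 > 0" "\<And>i. f (y ^ i) \<le> C2 * A ^ i" using bd[of y] A by auto
  show "spectral f (x + y) \<le> A"
  proof (rule spectral_leI[of "C1 * C2"])
    fix k
    define N :: nat where "N = 2 ^ k"
    have "f (\<Sum>i\<le>N. of_nat (N choose i) * x ^ i * y ^ (N - i)) \<le> C1 * C2 * A ^ N"
    proof (rule ring_norm_sum[OF f])
      fix i assume "i \<in> {..N}"
      then have "i \<le> N" by simp
      have "f (of_nat (N choose i) * x ^ i * y ^ (N - i)) \<le> f (x ^ i * y ^ (N - i))"
        using ring_norm_of_nat_mult[OF f, of "N choose i" "x ^ i * y ^ (N - i)"] by (simp add: mult.assoc)
      also have "\<dots> \<le> f (x ^ i) * f (y ^ (N - i))" by (rule ring_normD(5)[OF f])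
      also have "\<dots> \<le> (C1 * A ^ i) * (C2 * A ^ (N - i))"
        using C1 C2 A0 ring_normD(1)[OF f] by (intro mult_mono) auto
      also have "\<dots> = C1 * C2 * (A ^ i * A ^ (N - i))" by simp
      also have "A ^ i * A ^ (N - i) = A ^ N" using \<open>i \<le> N\<close> by (simp add: power_add[symmetric])
      finally show "f (of_nat (N choose i) * x ^ i * y ^ (N - i)) \<le> C1 * C2 * A ^ N" .
    qed (use C1 C2 A0 in auto)
    then show "f ((x + y) ^ (2 ^ k)) \<le> C1 * C2 * A ^ (2 ^ k)"
      by (simp add: binomial_ring N_def)
  qed (use C1 C2 A0 in auto)
qed

lemma spectral_0: "spectral f 0 = 0"
  using spectral_le[of 0] spectral_nonneg[of 0] ring_normD(2)[OF f] by simp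

lemma spectral_uminus: "spectral f (- x) = spectral f x"
proof -
  have "f ((- x) ^ n) = f (x ^ n)" for n
    by (cases "even n") (auto simp: ring_normD(3)[OF f])
  then show ?thesis by (simp add: spectral_def)
qed

lemma ring_norm_spectral: "ring_norm (spectral f)"
  unfolding ring_norm_def
  using spectral_nonneg spectral_0 spectral_uminus spectral_add spectral_mult by blast

lemma spectral_1:
  assumes "f 1 > 0" shows "spectral f 1 = 1"
  using LIMSEQ_unique[OF spectral_lim[of 1]] root_const_lim[OF assms] by simp

text \<open>The monic equation expresses x^N through lower powers with integer coefficients, and
  integer factors do not increase an ultrametric norm. Hence f(x^N) is bounded by a constant, whose
  roots tend to 1.\<close>

lemma spectral_algebraic_int:
  assumes "algebraic_int x" shows "spectral f x \<le> 1"
proof -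
  obtain p where p: "lead_coeff p = 1" "\<And>i. coeff p i \<in> \<int>" "poly p x = 0"
    using assms by (auto elim!: algebraic_int.cases)
  define n where "n = degree p"
  have n0: "n > 0"
  proof (rule ccontr)
    assume "\<not> n > 0"
    then have "p = 1" using p by (auto simp: n_def elim!: degree_eq_zeroE)
    then show False using p by simp
  qed
  have "poly p x = x ^ n + (\<Sum>i<n. coeff p i * x ^ i)"
    using p(1) by (simp add: poly_altdef n_def lessThan_Suc_atMost[symmetric])
  then have xn: "x ^ n = - (\<Sum>i<n. coeff p i * x ^ i)" using p(3) by (simp add: eq_neg_iff_add_eq_0)
  define C where "C = Max ((\<lambda>i. f (x ^ i)) ` {..<n}) + 1"
  have Cr: "f (x ^ i) \<le> C - 1" if "i < n" for i using that by (auto simp: C_def)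
  have C0: "C > 0" using Cr[OF n0] ring_normD(1)[OF f, of "x ^ 0"] by linarith
  have "f (x ^ N) \<le> C" for N
  proof (induction N rule: less_induct)
    case (less N)
    show ?case
    proof (cases "N < n")
      case True
      then show ?thesis using Cr[of N] by simp
    next
      case False
      then have "x ^ N = x ^ n * x ^ (N - n)" by (simp add: power_add[symmetric])
      also have "\<dots> = - (\<Sum>i<n. coeff p i * x ^ (i + (N - n)))"
        unfolding xn by (simp add: sum_distrib_right power_add mult.assoc)
      finally have "f (x ^ N) = f (\<Sum>i<n. coeff p i * x ^ (i + (N - n)))"
        by (simp add: ring_normD(3)[OF f])
      also have "\<dots> \<le> C"
      proof (rule ring_norm_sum[OF f])
        fix i assume i: "i \<in> {..<n}"
        obtain c where c: "coeff p i = of_int c" using p(2)[of i] by (auto elim: Ints_cases)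
        have "f (coeff p i * x ^ (i + (N - n))) \<le> f (x ^ (i + (N - n)))"
          unfolding c by (rule ring_norm_of_int_mult[OF f])
        also have "\<dots> \<le> C" using i False by (intro less) auto
        finally show "f (coeff p i * x ^ (i + (N - n))) \<le> C" .
      qed (use C0 in simp)
      finally show ?thesis .
    qed
  qed
  then show ?thesis using C0 by (intro spectral_leI[of C]) auto
qed

lemma spectral_eq_imp_power_2:
  assumes "\<And>x. f (x ^ 2) = f x ^ 2"
  shows "f (x ^ (2 ^ k)) = f x ^ (2 ^ k)"
proof (induction k)
  case (Suc k)
  have "f (x ^ (2 ^ Suc k)) = f ((x ^ (2 ^ k)) ^ 2)" by (simp add: power_mult[symmetric] mult.commute)
  also have "\<dots> = (f x ^ (2 ^ k)) ^ 2" by (simp only: assms Suc)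
  also have "\<dots> = f x ^ (2 ^ Suc k)" by (simp add: power_mult[symmetric] mult.commute)
  finally show ?case .
qed simp

end

text \<open>A smoothing of \<open>f\<close> that makes \<open>y\<close> multiplicative
  (\<open>localized_mult_self\<close>) and increases no value (\<open>localized_le\<close>). It is
  applied to power-multiplicative \<open>f\<close>, as otherwise the value at 1 could
  collapse.\<close>

definition localized :: "('k::field_char_0 \<Rightarrow> real) \<Rightarrow> 'k \<Rightarrow> 'k \<Rightarrow> real" where
  "localized f y z = lim (\<lambda>k. f (z * y ^ k) / f y ^ k)"

context
  fixes f :: "'k::field_char_0 \<Rightarrow> real" and y :: 'k
  assumes f: "ring_norm f" and f1: "f 1 = 1" and sq: "\<And>x. f (x ^ 2) = f x ^ 2" and y: "f y > 0"
begin

lemma localized_step: "f (z * y ^ Suc k) / f y ^ Suc k \<le> f (z * y ^ k) / f y ^ k"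
proof -
  have "f (z * y ^ Suc k) \<le> f (z * y ^ k) * f y"
    using ring_normD(5)[OF f, of "z * y ^ k" y] by (simp add: mult_ac)
  then show ?thesis using y by (simp add: field_simps)
qed

lemma localized_lim: "(\<lambda>k. f (z * y ^ k) / f y ^ k) \<longlonglongrightarrow> localized f y z"
proof -
  have "decseq (\<lambda>k. f (z * y ^ k) / f y ^ k)" by (rule decseq_SucI) (rule localized_step)
  moreover have "0 \<le> f (z * y ^ k) / f y ^ k" for k using ring_normD(1)[OF f] y by simp
  ultimately have "convergent (\<lambda>k. f (z * y ^ k) / f y ^ k)"
    by (elim decseq_convergent[where B = 0]) (auto simp: convergent_def)
  then show ?thesis unfolding localized_def by (rule convergent_LIMSEQ_iff[THEN iffD1])
qed

lemma localized_le_step: "localized f y z \<le> f (z * y ^ k) / f y ^ k"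
  by (rule decseq_ge[OF decseq_SucI localized_lim]) (rule localized_step)

lemma localized_le: "localized f y z \<le> f z"
  using localized_le_step[of z 0] by simp

text \<open>Power-multiplicativity gives the quotient 1 at each exponent 2 ^ k; as the quotients
  decrease, none of them lies below 1.\<close>

lemma localized_1: "localized f y 1 = 1"
proof (rule antisym)
  show "localized f y 1 \<le> 1" using localized_le[of 1] f1 by simp
  show "1 \<le> localized f y 1"
  proof (rule LIMSEQ_le_const[OF localized_lim], intro exI allI impI)
    fix k :: nat
    have dec: "decseq (\<lambda>k. f (1 * y ^ k) / f y ^ k)" by (rule decseq_SucI) (rule localized_step)
    have "1 = f (1 * y ^ (2 ^ k)) / f y ^ (2 ^ k)"
      using spectral_eq_imp_power_2[OF f sq, of y k] y by simp
    also have "\<dots> \<le> f (1 * y ^ k) / f y ^ k"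
      by (rule decseqD[OF dec]) (simp add: less_imp_le)
    finally show "1 \<le> f (1 * y ^ k) / f y ^ k" .
  qed
qed

lemma localized_mult_self: "localized f y (z * y) = localized f y z * f y"
proof (rule LIMSEQ_unique[OF localized_lim])
  have eq: "f (z * y * y ^ k) / f y ^ k = (f (z * y ^ Suc k) / f y ^ Suc k) * f y" for k
    using y by (simp add: mult_ac)
  show "(\<lambda>k. f (z * y * y ^ k) / f y ^ k) \<longlonglongrightarrow> localized f y z * f y"
    unfolding eq by (intro tendsto_mult tendsto_const LIMSEQ_Suc[OF localized_lim])
qed

lemma ring_norm_localized: "ring_norm (localized f y)"
  unfolding ring_norm_def
proof (intro conjI allI)
  show ge0: "localized f y x \<ge> 0" for x
    by (rule LIMSEQ_le_const[OF localized_lim]) (use y in \<open>auto simp: ring_normD[OF f]\<close>)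
  show "localized f y 0 = 0" using localized_le[of 0] ge0[of 0] ring_normD(2)[OF f] by simp
  show "localized f y (- x) = localized f y x" for x
    by (simp add: localized_def ring_normD(3)[OF f])
  show "localized f y (x + z) \<le> max (localized f y x) (localized f y z)" for x z
  proof (rule LIMSEQ_le[OF localized_lim tendsto_max[OF localized_lim localized_lim]], intro exI allI impI)
    fix k
    have "f ((x + z) * y ^ k) \<le> max (f (x * y ^ k)) (f (z * y ^ k))"
      using ring_normD(4)[OF f, of "x * y ^ k" "z * y ^ k"] by (simp add: distrib_right)
    then show "f ((x + z) * y ^ k) / f y ^ k \<le> max (f (x * y ^ k) / f y ^ k) (f (z * y ^ k) / f y ^ k)"
      using y by (auto simp: divide_simps max_def split: if_splits)
  qed
  show "localized f y (x * z) \<le> localized f y x * localized f y z" for x z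
  proof (rule LIMSEQ_le[OF tendsto_const tendsto_mult[OF localized_lim localized_lim]], intro exI allI impI)
    fix k
    \<comment> \<open>The exponent \<open>k + k\<close> leaves one copy of \<open>y ^ k\<close> for
      each factor.\<close>
    have "localized f y (x * z) \<le> f (x * z * y ^ (k + k)) / f y ^ (k + k)" by (rule localized_le_step)
    also have "\<dots> \<le> (f (x * y ^ k) * f (z * y ^ k)) / f y ^ (k + k)"
      using ring_normD(5)[OF f, of "x * y ^ k" "z * y ^ k"] y
      by (intro divide_right_mono) (simp_all add: power_add mult_ac)
    also have "\<dots> = f (x * y ^ k) / f y ^ k * (f (z * y ^ k) / f y ^ k)" by (simp add: power_add)
    finally show "localized f y (x * z) \<le> f (x * y ^ k) / f y ^ k * (f (z * y ^ k) / f y ^ k)" .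
  qed
qed

end

text \<open>On rationals only an upper bound is demanded, as this passes to infima and to
  \<open>spectral\<close> and \<open>localized\<close>. For a multiplicative norm the bound at the
  inverse of \<open>q\<close> turns it into an equality.\<close>

definition padic_norm :: "nat \<Rightarrow> ('k::field_char_0 \<Rightarrow> real) \<Rightarrow> bool" where
  "padic_norm p f \<longleftrightarrow> ring_norm f \<and> f 1 = 1 \<and> (\<forall>q. f (of_rat q) \<le> padic_abs p q)"

lemma chain_Inf_padic_norm:
  fixes C :: "('k::field_char_0 \<Rightarrow> real) set"
  assumes ne: "C \<noteq> {}" and C: "\<And>f. f \<in> C \<Longrightarrow> padic_norm p f"
    and chain: "\<And>f g. f \<in> C \<Longrightarrow> g \<in> C \<Longrightarrow> f \<le> g \<or> g \<le> f"
  defines "g \<equiv> \<lambda>x. INF f\<in>C. f x"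
  shows "padic_norm p g" and "\<And>f. f \<in> C \<Longrightarrow> g \<le> f"
proof -
  have rn: "ring_norm f" "f 1 = 1" "f (of_rat q) \<le> padic_abs p q" if "f \<in> C" for f q
    using C[OF that] by (auto simp: padic_norm_def)
  have bdd: "bdd_below ((\<lambda>f. f x) ` C)" for x
    using rn(1) by (auto intro!: bdd_belowI[of _ 0] simp: ring_normD)
  have le: "g x \<le> f x" if "f \<in> C" for f x
    unfolding g_def using that by (rule cINF_lower[OF bdd])
  show "\<And>f. f \<in> C \<Longrightarrow> g \<le> f" using le by (simp add: le_fun_def)
  have ge0: "g x \<ge> 0" for x
    unfolding g_def using ne rn(1) by (intro cINF_greatest) (auto simp: ring_normD)
  have ex: "\<exists>f\<in>C. f x < r" if "g x < r" for x r
    using that cINF_less_iff[OF ne bdd, of x r] by (simp add: g_def)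
  \<comment> \<open>Here the chain enters: of two norms that nearly attain the infimum at
    \<open>x\<close> and at \<open>y\<close>, the smaller one does both, so the laws with two
    arguments pass to the infimum.\<close>
  have ex2: "\<exists>f\<in>C. f x < r \<and> f y < s" if xr: "g x < r" and ys: "g y < s" for x y r s
  proof -
    obtain f1 f2 where f: "f1 \<in> C" "f1 x < r" "f2 \<in> C" "f2 y < s" using ex[OF xr] ex[OF ys] by blast
    from chain[OF f(1,3)] show ?thesis
    proof
      assume "f1 \<le> f2"
      then have "f1 y \<le> f2 y" by (simp add: le_fun_def)
      then show ?thesis using f by (intro bexI[of _ f1]) auto
    next
      assume "f2 \<le> f1"
      then have "f2 x \<le> f1 x" by (simp add: le_fun_def)
      then show ?thesis using f by (intro bexI[of _ f2]) auto
    qed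
  qed
  obtain f0 where f0: "f0 \<in> C" using ne by blast
  have "ring_norm g" unfolding ring_norm_def
  proof (intro conjI allI)
    show "g 0 = 0" using le[OF f0, of 0] ge0[of 0] ring_normD(2)[OF rn(1)[OF f0]] by simp
    show "g (- x) = g x" for x
      unfolding g_def using rn(1) by (intro INF_cong) (auto simp: ring_normD)
    show "g (x + y) \<le> max (g x) (g y)" for x y
    proof (rule dense_ge)
      fix r assume "max (g x) (g y) < r"
      then obtain f where f: "f \<in> C" "f x < r" "f y < r" using ex2[of x r y r] by auto
      show "g (x + y) \<le> r"
        using le[OF f(1), of "x + y"] ring_normD(4)[OF rn(1)[OF f(1)], of x y] f(2,3) by linarith
    qed
    show "g (x * y) \<le> g x * g y" for x y
    proof (rule LIMSEQ_le_const)
      show "(\<lambda>n. (g x + inverse (real (Suc n))) * (g y + inverse (real (Suc n)))) \<longlonglongrightarrow> g x * g y"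
        using tendsto_mult[OF tendsto_add[OF tendsto_const[of "g x"] LIMSEQ_inverse_real_of_nat]
            tendsto_add[OF tendsto_const[of "g y"] LIMSEQ_inverse_real_of_nat]] by simp
      have "g (x * y) \<le> (g x + inverse (real (Suc n))) * (g y + inverse (real (Suc n)))" for n
      proof -
        obtain f where f: "f \<in> C" "f x < g x + inverse (real (Suc n))" "f y < g y + inverse (real (Suc n))"
          using ex2[of x "g x + inverse (real (Suc n))" y "g y + inverse (real (Suc n))"] by auto
        have "g (x * y) \<le> f (x * y)" by (rule le[OF f(1)])
        also have "\<dots> \<le> f x * f y" by (rule ring_normD(5)[OF rn(1)[OF f(1)]])
        also have "\<dots> \<le> (g x + inverse (real (Suc n))) * (g y + inverse (real (Suc n)))"
          using f ring_normD(1)[OF rn(1)[OF f(1)]] ge0 by (intro mult_mono) (auto intro: add_nonneg_nonneg)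
        finally show ?thesis .
      qed
      then show "\<exists>N. \<forall>n\<ge>N. g (x * y) \<le> (g x + inverse (real (Suc n))) * (g y + inverse (real (Suc n)))"
        by blast
    qed
  qed (use ge0 in auto)
  moreover have "g 1 = 1"
  proof -
    have "g 1 = (INF f\<in>C. 1)" unfolding g_def using rn(2) by (intro INF_cong) auto
    then show ?thesis using ne by simp
  qed
  moreover have "g (of_rat q) \<le> padic_abs p q" for q
    using le[OF f0, of "of_rat q"] rn(3)[OF f0, of q] by linarith
  ultimately show "padic_norm p g" by (simp add: padic_norm_def)
qed

lemma minimal_padic_norm:
  fixes f0 :: "'k::field_char_0 \<Rightarrow> real"
  assumes f0: "padic_norm p f0"
  shows "\<exists>f. padic_norm p f \<and> f \<le> f0 \<and> (\<forall>g. padic_norm p g \<and> g \<le> f \<longrightarrow> g = f)"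
proof -
  define A where "A = {f. padic_norm p f \<and> f \<le> f0}"
  have "\<exists>m\<in>A. \<forall>a\<in>A. a \<le> m \<longrightarrow> a = m"
  proof (rule predicate_Zorn)
    show "partial_order_on A (relation_of (\<lambda>f g. g \<le> f) A)"
      by (rule partial_order_on_relation_ofI) auto
    fix C assume "C \<in> Chains (relation_of (\<lambda>f g. g \<le> f) A)"
    then have C: "C \<subseteq> A" "\<And>f g. f \<in> C \<Longrightarrow> g \<in> C \<Longrightarrow> f \<le> g \<or> g \<le> f"
      by (auto simp: Chains_def relation_of_def)
    show "\<exists>u\<in>A. \<forall>a\<in>C. u \<le> a"
    proof (cases "C = {}")
      case True
      then show ?thesis using f0 by (auto simp: A_def)
    next
      case False
      have pn: "padic_norm p f" if "f \<in> C" for f using that C(1) by (auto simp: A_def)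
      have g: "padic_norm p (\<lambda>x. INF f\<in>C. f x)" "\<And>f. f \<in> C \<Longrightarrow> (\<lambda>x. INF f\<in>C. f x) \<le> f"
        using chain_Inf_padic_norm[of C p] False pn C(2) by blast+
      obtain f where "f \<in> C" using False by blast
      then have "f \<le> f0" using C(1) by (auto simp: A_def)
      then have "(\<lambda>x. INF f\<in>C. f x) \<le> f0" using g(2)[OF \<open>f \<in> C\<close>] by (rule order_trans[rotated])
      then show ?thesis using g by (intro bexI[of _ "\<lambda>x. INF f\<in>C. f x"]) (auto simp: A_def)
    qed
  qed
  then obtain m where m: "m \<in> A" "\<And>a. a \<in> A \<Longrightarrow> a \<le> m \<Longrightarrow> a = m" by blast
  show ?thesis
  proof (intro exI[of _ m] conjI allI impI)
    fix g assume "padic_norm p g \<and> g \<le> m"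
    then show "g = m" using m by (auto simp: A_def intro: order_trans)
  qed (use m in \<open>auto simp: A_def\<close>)
qed

text \<open>Both improvements of a norm, \<open>spectral\<close> and \<open>localized\<close>, lie
  below it and are again p-adic norms, so a minimal norm equals each of them. The first equality
  provides the power-multiplicativity that the second requires; the second gives
  multiplicativity.\<close>

lemma minimal_padic_norm_mult:
  fixes f :: "'k::field_char_0 \<Rightarrow> real"
  assumes f: "padic_norm p f" and min: "\<And>g. padic_norm p g \<Longrightarrow> g \<le> f \<Longrightarrow> g = f"
  shows "f (x * y) = f x * f y" and "f x = 0 \<longleftrightarrow> x = 0"
proof -
  have rn: "ring_norm f" and f1: "f 1 = 1" and fq: "\<And>q. f (of_rat q) \<le> padic_abs p q"
    using f by (auto simp: padic_norm_def)
  have zero: "f x = 0 \<longleftrightarrow> x = 0" for x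
  proof
    assume "f x = 0"
    show "x = 0"
    proof (rule ccontr)
      assume "x \<noteq> 0"
      then show False using ring_normD(5)[OF rn, of x "inverse x"] f1 \<open>f x = 0\<close> by simp
    qed
  qed (simp add: ring_normD[OF rn])
  then show "f x = 0 \<longleftrightarrow> x = 0" .
  have "spectral f = f"
  proof (rule min)
    show "padic_norm p (spectral f)"
      unfolding padic_norm_def using ring_norm_spectral[OF rn] spectral_1[OF rn] f1
        spectral_le[OF rn] fq by (auto intro: order_trans)
  qed (simp add: le_fun_def spectral_le[OF rn])
  then have sq: "f (x ^ 2) = f x ^ 2" for x using spectral_square[OF rn, of x] by simp
  show "f (x * y) = f x * f y"
  proof (cases "y = 0")
    case False
    then have y: "f y > 0" using zero[of y] ring_normD(1)[OF rn, of y] by linarith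
    note L = rn f1 sq y
    have "localized f y = f"
    proof (rule min)
      show "padic_norm p (localized f y)"
        unfolding padic_norm_def using ring_norm_localized[OF L] localized_1[OF L]
          localized_le[OF L] fq by (auto intro: order_trans)
    qed (simp add: le_fun_def localized_le[OF L])
    then show ?thesis using localized_mult_self[OF L, of x] by simp
  qed (simp add: ring_normD[OF rn])
qed

section \<open>The p-adic absolute value on the rationals and the passage from norms to
  places\<close>

lemma padic_abs_of_frac:
  assumes p: "prime p" and ab: "a \<noteq> 0" "b \<noteq> 0"
  shows "padic_abs p (of_int a / of_int b) = real p powi (int (multiplicity (int p) b) - int (multiplicity (int p) a))"
proof -
  let ?q = "of_int a / of_int b :: rat"
  obtain n d where nd: "quotient_of ?q = (n, d)" by force
  have d: "d > 0" using quotient_of_denom_pos[OF nd] .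
  have q: "?q = of_int n / of_int d" using quotient_of_div[OF nd] .
  have n: "n \<noteq> 0" using q ab d by auto
  have "(of_int (a * d) :: rat) = of_int (n * b)" using q ab d by (simp add: field_simps)
  then have "a * d = n * b" by (simp only: of_int_eq_iff)
  then have "multiplicity (int p) (a * d) = multiplicity (int p) (n * b)" by simp
  then have "multiplicity (int p) a + multiplicity (int p) d = multiplicity (int p) n + multiplicity (int p) b"
    using p ab n d by (subst (asm) (1 2) prime_elem_multiplicity_mult_distrib) auto
  then have "int (multiplicity (int p) d) - int (multiplicity (int p) n)
      = int (multiplicity (int p) b) - int (multiplicity (int p) a)" by linarith
  then show ?thesis using ab nd by (simp add: padic_abs_def)
qed

lemma padic_abs_of_int:
  assumes "prime p" "a \<noteq> 0"
  shows "padic_abs p (of_int a) = inverse (real p ^ multiplicity (int p) a)"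
  using padic_abs_of_frac[OF assms, of 1] by (simp add: power_int_minus)

lemma rat_frac_cases:
  fixes q :: rat
  assumes "q \<noteq> 0" obtains a b where "a \<noteq> 0" "b \<noteq> 0" "q = of_int a / of_int b"
  using assms by (metis quotient_of_div divide_eq_0_iff of_int_0 surj_pair)

lemma padic_abs_absolute_value:
  assumes p: "prime p"
  shows "absolute_value (padic_abs p)" and "padic_abs p (x + y) \<le> max (padic_abs p x) (padic_abs p y)"
proof -
  have p1: "real p > 1" using prime_gt_1_nat[OF p] by simp
  have nn: "padic_abs p x \<ge> 0" for x using p1 by (auto simp: padic_abs_def)
  have z: "padic_abs p x = 0 \<longleftrightarrow> x = 0" for x using p1 by (auto simp: padic_abs_def)
  have m: "padic_abs p (x * y) = padic_abs p x * padic_abs p y" for x y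
  proof (cases "x = 0 \<or> y = 0")
    case False
    then obtain a b c d where *: "a \<noteq> 0" "b \<noteq> 0" "x = of_int a / of_int b" "c \<noteq> 0" "d \<noteq> 0" "y = of_int c / of_int d"
      by (metis rat_frac_cases)
    have "x * y = of_int (a * c) / of_int (b * d)" using * by simp
    then have "padic_abs p (x * y) = real p powi (int (multiplicity (int p) (b * d)) - int (multiplicity (int p) (a * c)))"
      using * p padic_abs_of_frac[of p "a * c" "b * d"] by simp
    also have "\<dots> = real p powi ((int (multiplicity (int p) b) - int (multiplicity (int p) a))
        + (int (multiplicity (int p) d) - int (multiplicity (int p) c)))"
      using * p by (subst (1 2) prime_elem_multiplicity_mult_distrib) (auto simp: algebra_simps)
    also have "\<dots> = padic_abs p x * padic_abs p y"
      using * p p1 by (subst power_int_add) (auto simp: padic_abs_of_frac)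
    finally show ?thesis .
  qed (auto simp: padic_abs_def)
  have u: "padic_abs p (x + y) \<le> max (padic_abs p x) (padic_abs p y)" for x y
  proof (cases "x = 0 \<or> y = 0 \<or> x + y = 0")
    case True
    then show ?thesis using nn[of x] nn[of y] by (auto simp: z[THEN iffD2] max_def)
  next
    case False
    then obtain a b c d where *: "a \<noteq> 0" "b \<noteq> 0" "x = of_int a / of_int b" "c \<noteq> 0" "d \<noteq> 0" "y = of_int c / of_int d"
      by (metis rat_frac_cases)
    define e where "e = a * d + c * b"
    have xy: "x + y = of_int e / of_int (b * d)" using * by (simp add: e_def field_simps)
    then have e0: "e \<noteq> 0" using False by auto
    have x': "x = of_int (a * d) / of_int (b * d)" and y': "y = of_int (c * b) / of_int (b * d)" using * by simp_all
    let ?k = "min (multiplicity (int p) (a * d)) (multiplicity (int p) (c * b))"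
    have "int p ^ ?k dvd e" unfolding e_def
      by (intro dvd_add) (auto intro: multiplicity_dvd')
    then have "multiplicity (int p) e \<ge> ?k"
      using e0 p by (intro multiplicity_geI) (auto dest: prime_gt_1_nat simp: prime_int_nat_transfer)
    then have "multiplicity (int p) e \<ge> multiplicity (int p) (a * d) \<or> multiplicity (int p) e \<ge> multiplicity (int p) (c * b)"
      by (auto simp: min_le_iff_disj)
    moreover have "real p powi s \<le> real p powi t" if "s \<le> t" for s t
      using that p1 by (intro power_int_increasing) auto
    moreover have "padic_abs p (x + y) = real p powi (int (multiplicity (int p) (b * d)) - int (multiplicity (int p) e))"
      unfolding xy using * e0 by (intro padic_abs_of_frac[OF p]) auto
    moreover have "padic_abs p x = real p powi (int (multiplicity (int p) (b * d)) - int (multiplicity (int p) (a * d)))"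
      unfolding x' using * by (intro padic_abs_of_frac[OF p]) auto
    moreover have "padic_abs p y = real p powi (int (multiplicity (int p) (b * d)) - int (multiplicity (int p) (c * b)))"
      unfolding y' using * by (intro padic_abs_of_frac[OF p]) auto
    ultimately have "padic_abs p (x + y) \<le> padic_abs p x \<or> padic_abs p (x + y) \<le> padic_abs p y"
      by auto
    then show ?thesis by auto
  qed
  then show "padic_abs p (x + y) \<le> max (padic_abs p x) (padic_abs p y)" .
  show "absolute_value (padic_abs p)"
    unfolding absolute_value_def
  proof (intro conjI allI)
    fix x y
    show "padic_abs p (x + y) \<le> padic_abs p x + padic_abs p y"
      using u[of x y] nn[of x] nn[of y] by linarith
  qed (use nn z m in auto)
qed

lemma place_from_padic_norm:
  fixes f0 :: "'k::field_char_0 \<Rightarrow> real"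
  assumes p: "prime p" and f0: "padic_norm p f0"
  shows "\<exists>w. place_over p w \<and> (\<forall>x. w x \<le> f0 x)"
proof -
  obtain f where f: "padic_norm p f" "f \<le> f0" and min: "\<And>g. padic_norm p g \<Longrightarrow> g \<le> f \<Longrightarrow> g = f"
    using minimal_padic_norm[OF f0] by blast
  have rn: "ring_norm f" and f1: "f 1 = 1" and fq: "\<And>q. f (of_rat q) \<le> padic_abs p q"
    using f by (auto simp: padic_norm_def)
  note mm = minimal_padic_norm_mult[OF f(1) min]
  have u: "f (x + y) \<le> max (f x) (f y)" for x y by (rule ring_normD(4)[OF rn])
  interpret Q: abs_val "padic_abs p" by unfold_locales (rule padic_abs_absolute_value[OF p])
  have "f (of_rat q) = padic_abs p q" for q
  proof (cases "q = 0")
    case False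
    have "f (of_rat q) * f (of_rat (inverse q)) = 1"
      using mm(1)[of "of_rat q" "of_rat (inverse q)"] False f1 by (simp add: of_rat_mult[symmetric])
    moreover have "f (of_rat (inverse q)) \<le> inverse (padic_abs p q)"
      using fq[of "inverse q"] by (simp add: Q.inverse)
    ultimately have "1 \<le> f (of_rat q) * inverse (padic_abs p q)"
      using ring_normD(1)[OF rn, of "of_rat q"] by (metis mult_left_mono)
    then have "padic_abs p q \<le> f (of_rat q)" using False by (simp add: field_simps)
    then show ?thesis using fq[of q] by simp
  qed (simp add: ring_normD[OF rn])
  moreover have "absolute_value f"
    unfolding absolute_value_def
  proof (intro conjI allI)
    fix x y
    show "f (x + y) \<le> f x + f y" using u[of x y] ring_normD(1)[OF rn] by (smt (verit))
  qed (use mm ring_normD[OF rn] in auto)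
  ultimately show ?thesis using u f(2) by (auto simp: place_over_def le_fun_def)
qed

text \<open>Minimality alone gives no control at \<open>x\<close>. Localising the spectral norm at
  \<open>x\<close> first gives the inverse of \<open>x\<close> a value below 1, and a place below
  that norm keeps it below 1.\<close>

lemma place_exists:
  fixes f :: "'k::field_char_0 \<Rightarrow> real"
  assumes p: "prime p" and rn: "ring_norm f" and f1: "f 1 > 0"
    and fq: "\<And>q. spectral f (of_rat q) \<le> padic_abs p q" and x: "spectral f x > 1"
  shows "\<exists>w. place_over p w \<and> w x > 1"
proof -
  let ?s = "spectral f"
  have L: "ring_norm ?s" "?s 1 = 1" "\<And>x. ?s (x ^ 2) = ?s x ^ 2" "?s x > 0"
    using ring_norm_spectral[OF rn] spectral_1[OF rn f1] spectral_square[OF rn] x by auto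
  have x0: "x \<noteq> 0" using x spectral_0[OF rn] by auto
  define g where "g = localized ?s x"
  have "padic_norm p g" unfolding padic_norm_def g_def
    using ring_norm_localized[OF L] localized_1[OF L] localized_le[OF L] fq by (auto intro: order_trans)
  then obtain w where w: "place_over p w" "\<And>z. w z \<le> g z"
    using place_from_padic_norm[OF p] by blast
  have "g (inverse x) * ?s x = 1"
    using localized_mult_self[OF L, of "inverse x"] localized_1[OF L] x0 by (simp add: g_def)
  then have "g (inverse x) = 1 / ?s x" using x by (simp add: field_simps)
  then have "g (inverse x) < 1" using x by simp
  then have "w (inverse x) < 1" using w(2)[of "inverse x"] by linarith
  interpret abs_val w using w(1) by unfold_locales (simp add: place_over_def)
  have "inverse (w x) < 1" using \<open>w (inverse x) < 1\<close> by (simp add: inverse)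
  then have "w x > 1" using x0 by (simp add: field_simps)
  then show ?thesis using w(1) by blast
qed

section \<open>Coordinates and primitive elements\<close>

locale nf_basis =
  fixes b :: "nat \<Rightarrow> 'k::field_char_0" and n :: nat
  assumes indep: "\<And>q i. (\<Sum>i<n. of_rat (q i) * b i) = 0 \<Longrightarrow> i < n \<Longrightarrow> q i = 0"
    and spans: "\<And>x. \<exists>q. x = (\<Sum>i<n. of_rat (q i) * b i)"
begin

definition crd :: "'k \<Rightarrow> nat \<Rightarrow> rat" where
  "crd x = (SOME q. x = (\<Sum>i<n. of_rat (q i) * b i))"

lemma crd_sum: "(\<Sum>i<n. of_rat (crd x i) * b i) = x"
  unfolding crd_def using someI_ex[OF spans[of x]] by simp

lemma crd_eqI:
  assumes "x = (\<Sum>i<n. of_rat (q i) * b i)" "i < n"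
  shows "crd x i = q i"
proof -
  have "(\<Sum>i<n. of_rat (crd x i - q i) * b i) = 0"
    using crd_sum[of x] assms by (simp add: of_rat_diff left_diff_distrib sum_subtractf)
  from indep[OF this assms(2)] show ?thesis by simp
qed

lemma crd_add: "i < n \<Longrightarrow> crd (x + y) i = crd x i + crd y i"
  by (rule crd_eqI) (simp_all only: of_rat_add distrib_right sum.distrib crd_sum)

lemma crd_scale: "i < n \<Longrightarrow> crd (of_rat q * x) i = q * crd x i"
  by (rule crd_eqI) (simp_all only: of_rat_mult mult.assoc sum_distrib_left[symmetric] crd_sum)

lemma crd_basis: "i < n \<Longrightarrow> j < n \<Longrightarrow> crd (b j) i = (if i = j then 1 else 0)"
proof (rule crd_eqI)
  assume "j < n"
  then have "b j = (\<Sum>i<n. if i = j then b i else 0)" by simp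
  also have "\<dots> = (\<Sum>i<n. of_rat (if i = j then 1 else 0) * b i)" by (intro sum.cong) auto
  finally show "b j = (\<Sum>i<n. of_rat (if i = j then 1 else 0) * b i)" .
qed

lemma n_pos: "n > 0"
  using spans[of 1] by (cases n) auto

lemma inj_basis: "inj_on b {..<n}"
proof (rule inj_onI)
  fix i j assume ij: "i \<in> {..<n}" "j \<in> {..<n}" "b i = b j"
  then have "crd (b j) i = 1" using crd_basis[of i i] by simp
  then show "i = j" using ij crd_basis[of i j] by (auto split: if_splits)
qed

lemma nf_degree_eq: "nf_degree TYPE('k) = n"
proof -
  have sum_B: "(\<Sum>x\<in>b ` {..<n}. of_rat (f x) * x) = (\<Sum>i<n. of_rat (f (b i)) * b i)" for f
    by (subst sum.reindex[OF inj_basis]) simp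
  have "rat_vs.independent (b ` {..<n})"
  proof (rule rat_vs.independent_if_scalars_zero)
    fix f x assume "(\<Sum>x\<in>b ` {..<n}. of_rat (f x) * x) = 0" "x \<in> b ` {..<n}"
    then show "f x = 0" using indep[of "\<lambda>i. f (b i)"] unfolding sum_B by auto
  qed simp
  moreover have "UNIV \<subseteq> rat_vs.span (b ` {..<n})"
  proof
    fix x
    have "(\<Sum>i<n. of_rat (crd x i) * b i) \<in> rat_vs.span (b ` {..<n})"
      by (intro rat_vs.span_sum rat_vs.span_scale rat_vs.span_base) auto
    then show "x \<in> rat_vs.span (b ` {..<n})" by (simp add: crd_sum)
  qed
  ultimately have "rat_vs.dim (UNIV :: 'k set) = card (b ` {..<n})"
    using rat_vs.basis_card_eq_dim[of "b ` {..<n}" UNIV] by simp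
  then show ?thesis by (simp add: nf_degree_def card_image[OF inj_basis])
qed

definition crd_norm :: "nat \<Rightarrow> 'k \<Rightarrow> real" where
  "crd_norm p x = Max (insert 0 ((\<lambda>i. padic_abs p (crd x i)) ` {..<n}))"

definition crd_const :: "nat \<Rightarrow> real" where
  "crd_const p = Max (insert 1 ((\<lambda>(i, j). crd_norm p (b i * b j)) ` ({..<n} \<times> {..<n})))"

text \<open>The maximum norm of the coordinates is submultiplicative up to the largest norm of a
  product of two basis vectors; scaling by that constant absorbs it.\<close>

definition alg_norm :: "nat \<Rightarrow> 'k \<Rightarrow> real" where
  "alg_norm p x = crd_const p * crd_norm p x"

lemma crd_const_ge_1: "crd_const p \<ge> 1"
  unfolding crd_const_def by (rule Max_ge) auto

lemma crd_norm_nonneg: "crd_norm p x \<ge> 0"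
  unfolding crd_norm_def by (rule Max_ge) auto

lemma crd_norm_ge: "i < n \<Longrightarrow> padic_abs p (crd x i) \<le> crd_norm p x"
  unfolding crd_norm_def by (rule Max_ge) auto

lemma crd_norm_leI: "B \<ge> 0 \<Longrightarrow> (\<And>i. i < n \<Longrightarrow> padic_abs p (crd x i) \<le> B) \<Longrightarrow> crd_norm p x \<le> B"
  unfolding crd_norm_def by (subst Max_le_iff) auto

lemma crd_norm_le_alg_norm: "crd_norm p x \<le> alg_norm p x"
  unfolding alg_norm_def using mult_right_mono[OF crd_const_ge_1 crd_norm_nonneg] by simp

context
  fixes p :: nat
  assumes p: "prime p"
begin

interpretation Q: abs_val "padic_abs p" by unfold_locales (rule padic_abs_absolute_value[OF p])

lemma padic_sum_le:
  assumes "B \<ge> 0" "\<And>i. i \<in> A \<Longrightarrow> padic_abs p (f i) \<le> B"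
  shows "padic_abs p (sum f A) \<le> B"
  using assms(2)
proof (induction A rule: infinite_finite_induct)
  case (insert x A)
  then show ?case using padic_abs_absolute_value(2)[OF p, of "f x" "sum f A"] by fastforce
qed (use assms(1) in auto)

lemma crd_norm_add: "crd_norm p (x + y) \<le> max (crd_norm p x) (crd_norm p y)"
proof (rule crd_norm_leI)
  fix i assume i: "i < n"
  show "padic_abs p (crd (x + y) i) \<le> max (crd_norm p x) (crd_norm p y)"
    using padic_abs_absolute_value(2)[OF p, of "crd x i" "crd y i"]
      crd_norm_ge[OF i, of p x] crd_norm_ge[OF i, of p y] by (simp add: crd_add[OF i])
qed (simp add: crd_norm_nonneg le_max_iff_disj)

lemma crd_norm_scale_le: "crd_norm p (of_rat q * x) \<le> padic_abs p q * crd_norm p x"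
  by (rule crd_norm_leI) (auto simp: crd_norm_nonneg crd_scale Q.mult intro!: mult_left_mono crd_norm_ge)

lemma crd_norm_scale: "crd_norm p (of_rat q * x) = padic_abs p q * crd_norm p x"
proof (cases "q = 0")
  case False
  have "crd_norm p x \<le> inverse (padic_abs p q) * crd_norm p (of_rat q * x)"
    using crd_norm_scale_le[of "inverse q" "of_rat q * x"] False
    by (simp add: mult.assoc[symmetric] of_rat_mult[symmetric] Q.inverse)
  then have "padic_abs p q * crd_norm p x \<le> crd_norm p (of_rat q * x)"
    using False by (simp add: field_simps)
  then show ?thesis using crd_norm_scale_le[of q x] by simp
next
  case True
  then show ?thesis using crd_norm_scale_le[of 0 x] crd_norm_nonneg[of p 0] by simp
qed

lemma crd_norm_eq_0_iff: "crd_norm p x = 0 \<longleftrightarrow> x = 0"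
proof
  assume z: "crd_norm p x = 0"
  have "crd x i = 0" if "i < n" for i
  proof -
    have "padic_abs p (crd x i) \<le> 0" using crd_norm_ge[OF that, of p x] z by simp
    then have "padic_abs p (crd x i) = 0" using Q.nonneg[of "crd x i"] by linarith
    then show ?thesis by simp
  qed
  then have "(\<Sum>i<n. of_rat (crd x i) * b i) = 0" by (intro sum.neutral) auto
  then show "x = 0" by (simp add: crd_sum)
next
  assume "x = 0"
  then show "crd_norm p x = 0" using crd_norm_scale[of 0 0] by simp
qed

lemma crd_norm_sum:
  assumes "B \<ge> 0" "\<And>i. i \<in> A \<Longrightarrow> crd_norm p (f i) \<le> B"
  shows "crd_norm p (sum f A) \<le> B"
  using assms(2)
proof (induction A rule: infinite_finite_induct)
  case (insert x A)
  then have "crd_norm p (f x) \<le> B" "crd_norm p (sum f A) \<le> B" by auto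
  then show ?case using crd_norm_add[of "f x" "sum f A"] insert(1,2) by simp
qed (simp_all add: assms(1) crd_norm_eq_0_iff[of 0, simplified])

lemma crd_norm_mult: "crd_norm p (x * y) \<le> crd_const p * (crd_norm p x * crd_norm p y)"
proof -
  have "x * y = (\<Sum>i<n. of_rat (crd x i) * b i) * (\<Sum>j<n. of_rat (crd y j) * b j)"
    by (simp add: crd_sum)
  also have "\<dots> = (\<Sum>i<n. \<Sum>j<n. of_rat (crd x i * crd y j) * (b i * b j))"
    by (simp add: sum_product of_rat_mult mult_ac)
  finally have eq: "x * y = (\<Sum>i<n. \<Sum>j<n. of_rat (crd x i * crd y j) * (b i * b j))" .
  have B: "crd_const p * (crd_norm p x * crd_norm p y) \<ge> 0"
    using crd_const_ge_1[of p] crd_norm_nonneg by (intro mult_nonneg_nonneg) auto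
  show ?thesis unfolding eq
  proof (intro crd_norm_sum B)
    fix i j assume ij: "i \<in> {..<n}" "j \<in> {..<n}"
    have "crd_norm p (b i * b j) \<le> crd_const p"
      unfolding crd_const_def using ij by (intro Max_ge) auto
    then show "crd_norm p (of_rat (crd x i * crd y j) * (b i * b j))
        \<le> crd_const p * (crd_norm p x * crd_norm p y)"
      unfolding crd_norm_scale Q.mult using ij
      by (subst mult.commute) (intro mult_mono crd_norm_ge mult_nonneg_nonneg crd_norm_nonneg Q.nonneg
          order_trans[OF zero_le_one crd_const_ge_1], auto)
  qed
qed

lemma ring_norm_alg_norm: "ring_norm (alg_norm p)"
  unfolding ring_norm_def
proof (intro conjI allI)
  have C: "crd_const p \<ge> 0" using crd_const_ge_1[of p] by simp
  show "alg_norm p x \<ge> 0" for x unfolding alg_norm_def using C crd_norm_nonneg by simp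
  show "alg_norm p 0 = 0" using crd_norm_eq_0_iff[of 0] by (simp add: alg_norm_def)
  show "alg_norm p (- x) = alg_norm p x" for x
    using crd_norm_scale[of "-1" x] by (simp add: alg_norm_def)
  show "alg_norm p (x + y) \<le> max (alg_norm p x) (alg_norm p y)" for x y
    using mult_left_mono[OF crd_norm_add C, of x y] C
    by (simp add: alg_norm_def max_mult_distrib_left)
  show "alg_norm p (x * y) \<le> alg_norm p x * alg_norm p y" for x y
    using mult_left_mono[OF crd_norm_mult C, of x y] by (simp add: alg_norm_def mult_ac)
qed

lemma alg_norm_scale: "alg_norm p (of_rat q * x) = padic_abs p q * alg_norm p x"
  by (simp add: alg_norm_def crd_norm_scale mult.left_commute)

lemma alg_norm_pos: "x \<noteq> 0 \<Longrightarrow> alg_norm p x > 0"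
  unfolding alg_norm_def using crd_const_ge_1[of p] crd_norm_eq_0_iff[of x] crd_norm_nonneg[of p x]
  by (intro mult_pos_pos) auto

lemma spectral_of_rat: "spectral (alg_norm p) (of_rat q) \<le> padic_abs p q"
proof (rule spectral_leI[OF ring_norm_alg_norm])
  show "alg_norm p 1 > 0" by (rule alg_norm_pos) simp
  show "alg_norm p (of_rat q ^ 2 ^ k) \<le> alg_norm p 1 * padic_abs p q ^ 2 ^ k" for k
    using alg_norm_scale[of "q ^ 2 ^ k" 1] by (simp add: of_rat_power Q.power)
qed simp

lemma place_of_spectral:
  assumes "spectral (alg_norm p) x > 1"
  shows "\<exists>w. place_over p w \<and> w x > 1"
  using place_exists[OF p ring_norm_alg_norm alg_norm_pos spectral_of_rat assms] by simp

lemma crd_mult_basis_le: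
  assumes "j < n" "k < n"
  shows "padic_abs p (crd (x * b j) k) \<le> alg_norm p x"
proof -
  have "padic_abs p (crd (x * b j) k) \<le> crd_norm p (x * b j)" using assms by (intro crd_norm_ge)
  also have "\<dots> \<le> crd_const p * (crd_norm p x * crd_norm p (b j))" by (rule crd_norm_mult)
  also have "crd_norm p (b j) \<le> 1"
    using assms by (intro crd_norm_leI) (auto simp: crd_basis Q.one)
  then have "crd_const p * (crd_norm p x * crd_norm p (b j)) \<le> crd_const p * (crd_norm p x * 1)"
    using crd_const_ge_1[of p] crd_norm_nonneg by (intro mult_left_mono) auto
  finally show ?thesis by (simp add: alg_norm_def)
qed

end

definition mult_mat :: "'k \<Rightarrow> rat mat" where
  "mult_mat x = mat n n (\<lambda>(j, k). crd (x * b j) k)"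

definition nf_norm :: "'k \<Rightarrow> rat" where
  "nf_norm x = det (mult_mat x)"

lemma mult_mat_carrier [simp]: "mult_mat x \<in> carrier_mat n n"
  by (simp add: mult_mat_def)

end

text \<open>The Leibniz expansion under the ultrametric inequality: each term takes one entry from
  every column. Bounds by column are what the argument with a few small columns requires.\<close>

lemma padic_det_le:
  assumes p: "prime p" and A: "A \<in> carrier_mat n n"
    and c: "\<And>i j. i < n \<Longrightarrow> j < n \<Longrightarrow> padic_abs p (A $$ (i, j)) \<le> c j"
  shows "padic_abs p (det A) \<le> (\<Prod>j<n. c j)"
proof -
  interpret Q: abs_val "padic_abs p" by unfold_locales (rule padic_abs_absolute_value[OF p])
  have c0: "c j \<ge> 0" if "j < n" for j using c[OF that that] Q.nonneg order_trans by blast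
  have prod: "padic_abs p (prod f S) = (\<Prod>i\<in>S. padic_abs p (f i))" for f :: "nat \<Rightarrow> rat" and S
    by (induction S rule: infinite_finite_induct) (auto simp: Q.mult Q.one)
  have "padic_abs p (\<Sum>\<pi>\<in>{\<pi>. \<pi> permutes {0..<n}}. signof \<pi> * (\<Prod>i=0..<n. A $$ (i, \<pi> i)))
      \<le> (\<Prod>j<n. c j)"
  \<comment> \<open>The basis 1 of \<open>rat\<close> over itself instantiates the locale in which
    \<open>padic_sum_le\<close> is stated.\<close>
  proof (rule nf_basis.padic_sum_le[OF _ p, of "\<lambda>_. 1 :: rat" 1])
    show "nf_basis (\<lambda>_. 1 :: rat) 1"
      by unfold_locales (auto intro: exI[of _ "\<lambda>_. x" for x])
    show "0 \<le> (\<Prod>j<n. c j)" using c0 by (intro prod_nonneg) auto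
    fix \<pi> assume "\<pi> \<in> {\<pi>. \<pi> permutes {0..<n}}"
    then have \<pi>: "\<pi> permutes {0..<n}" by simp
    have "padic_abs p (signof \<pi>) = 1" by (auto simp: sign_def Q.one)
    then have "padic_abs p (signof \<pi> * (\<Prod>i=0..<n. A $$ (i, \<pi> i))) = (\<Prod>i=0..<n. padic_abs p (A $$ (i, \<pi> i)))"
      by (simp add: Q.mult prod)
    also have "\<dots> \<le> (\<Prod>i=0..<n. c (\<pi> i))"
      using permutes_in_image[OF \<pi>] by (intro prod_mono) (auto intro!: c)
    also have "\<dots> = (\<Prod>j=0..<n. c j)" using prod.permute[OF \<pi>, of c] by (simp add: o_def)
    finally show "padic_abs p (signof \<pi> * (\<Prod>i=0..<n. A $$ (i, \<pi> i))) \<le> (\<Prod>j<n. c j)"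
      by (simp add: lessThan_atLeast0)
  qed
  then show ?thesis using det_def'[OF A] by simp
qed

lemma (in nf_basis) nf_norm_le_alg_norm:
  assumes "prime p" shows "padic_abs p (nf_norm x) \<le> alg_norm p x ^ n"
proof -
  have "padic_abs p (nf_norm x) \<le> (\<Prod>j<n. alg_norm p x)"
    unfolding nf_norm_def
    by (rule padic_det_le[OF assms mult_mat_carrier]) (auto simp: mult_mat_def crd_mult_basis_le[OF assms])
  then show ?thesis by simp
qed

text \<open>Prescribed first vectors occur twice: a local basis at a place, whose columns can be
  made small in the norm determinant, and the powers of an element, whose number is thereby bounded
  by the degree.\<close>

lemma nf_basis_extend:
  fixes xs :: "'k::field_char_0 list"
  assumes nf: "number_field TYPE('k)" and xs: "distinct xs" "rat_vs.independent (set xs)"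
  shows "\<exists>b. nf_basis b (nf_degree TYPE('k)) \<and> length xs \<le> nf_degree TYPE('k) \<and> (\<forall>i<length xs. b i = xs ! i)"
proof -
  obtain S :: "'k set" where S: "finite S" "rat_vs.span S = UNIV" using nf by (auto simp: number_field_def)
  define B where "B = rat_vs.extend_basis (set xs)"
  have B: "set xs \<subseteq> B" "rat_vs.independent B" "rat_vs.span B = UNIV"
    unfolding B_def using rat_vs.extend_basis_superset[OF xs(2)] rat_vs.independent_extend_basis[OF xs(2)]
      rat_vs.span_extend_basis[OF xs(2)] by auto
  have finB: "finite B" using rat_vs.independent_span_bound[OF S(1) B(2)] S(2) by auto
  obtain zs where zs: "set zs = B - set xs" "distinct zs"
    using finite_distinct_list[of "B - set xs"] finB by auto
  define ys where "ys = xs @ zs"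
  have ys: "set ys = B" "distinct ys" using zs xs B(1) by (auto simp: ys_def)
  define n where "n = length ys"
  have bij: "bij_betw ((!) ys) {..<n} B" using ys by (auto simp: n_def intro: bij_betw_nth)
  have sumB: "(\<Sum>i<n. of_rat (q i) * ys ! i) = (\<Sum>v\<in>B. of_rat (q (inv_into {..<n} ((!) ys) v)) * v)" for q
  proof -
    have "(\<Sum>v\<in>B. of_rat (q (inv_into {..<n} ((!) ys) v)) * v)
        = (\<Sum>i<n. of_rat (q (inv_into {..<n} ((!) ys) (ys ! i))) * ys ! i)"
      by (rule sum.reindex_bij_betw[OF bij, symmetric])
    then show ?thesis using bij_betw_inv_into_left[OF bij] by simp
  qed
  interpret nf_basis "(!) ys" n
  proof
    fix q i assume "(\<Sum>i<n. of_rat (q i) * ys ! i) = 0" "i < n"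
    then have "q (inv_into {..<n} ((!) ys) (ys ! i)) = 0"
      using rat_vs.independentD[OF B(2) finB order_refl, of "\<lambda>v. q (inv_into {..<n} ((!) ys) v)" "ys ! i"]
        bij_betwE[OF bij] by (simp add: sumB)
    then show "q i = 0" using bij_betw_inv_into_left[OF bij, of i] \<open>i < n\<close> by simp
  next
    fix x
    obtain u where u: "x = (\<Sum>v\<in>B. of_rat (u v) * v)"
      using B(3) rat_vs.span_finite[OF finB] by auto
    have "x = (\<Sum>i<n. of_rat (u (ys ! i)) * ys ! i)"
      unfolding u by (rule sum.reindex_bij_betw[OF bij, symmetric])
    then show "\<exists>q. x = (\<Sum>i<n. of_rat (q i) * ys ! i)" by (intro exI[of _ "\<lambda>i. u (ys ! i)"])
  qed
  show ?thesis using nf_degree_eq nf_basis_axioms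
    by (intro exI[of _ "(!) ys"]) (auto simp: n_def ys_def nth_append)
qed

section \<open>Polynomials in one element and the primitive element theorem\<close>

lemma independent_family:
  fixes v :: "nat \<Rightarrow> 'k::field_char_0"
  assumes "\<And>q i. (\<Sum>i<d. of_rat (q i) * v i) = 0 \<Longrightarrow> i < d \<Longrightarrow> q i = 0"
  shows "distinct (map v [0..<d])" "rat_vs.independent (set (map v [0..<d]))"
proof -
  have inj: "inj_on v {..<d}"
  proof (rule inj_onI, rule ccontr)
    fix i j assume ij: "i \<in> {..<d}" "j \<in> {..<d}" "v i = v j" "i \<noteq> j"
    have "(\<Sum>k<d. of_rat ((if k = i then 1 else 0) - (if k = j then 1 else 0)) * v k)
        = (\<Sum>k<d. (if k = i then v k else 0)) - (\<Sum>k<d. if k = j then v k else 0)"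
      unfolding sum_subtractf[symmetric] by (intro sum.cong) auto
    also have "\<dots> = 0" using ij by simp
    finally show False using assms[of "\<lambda>k. (if k = i then 1 else 0) - (if k = j then 1 else 0)" i] ij by auto
  qed
  then show "distinct (map v [0..<d])" by (simp add: distinct_map atLeast_upt lessThan_atLeast0)
  have "rat_vs.independent (v ` {..<d})"
  proof (rule rat_vs.independent_if_scalars_zero)
    fix f x assume "(\<Sum>x\<in>v ` {..<d}. of_rat (f x) * x) = 0" "x \<in> v ` {..<d}"
    then show "f x = 0" using assms[of "\<lambda>i. f (v i)"] by (subst (asm) sum.reindex[OF inj]) auto
  qed simp
  then show "rat_vs.independent (set (map v [0..<d]))" by (simp add: lessThan_atLeast0)
qed

text \<open>Rational polynomials are evaluated in the number field and in the complex numbers alike;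
  \<open>emb_ev\<close> links the two.\<close>

definition ev :: "rat poly \<Rightarrow> 'a::field_char_0 \<Rightarrow> 'a" where
  "ev p x = (\<Sum>i\<le>degree p. of_rat (coeff p i) * x ^ i)"

lemma ev_eq_sum: "degree p \<le> N \<Longrightarrow> ev p x = (\<Sum>i\<le>N. of_rat (coeff p i) * x ^ i)"
  unfolding ev_def by (rule sum.mono_neutral_left) (auto simp: coeff_eq_0)

lemma ev_0 [simp]: "ev 0 x = 0" by (simp add: ev_def)

lemma ev_1 [simp]: "ev 1 x = 1" by (simp add: ev_def)

lemma ev_pCons [simp]: "ev (pCons a p) x = of_rat a + x * ev p x"
proof -
  have "ev (pCons a p) x = (\<Sum>i\<le>Suc (degree p). of_rat (coeff (pCons a p) i) * x ^ i)"
    by (rule ev_eq_sum) (rule degree_pCons_le)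
  also have "\<dots> = of_rat a + x * ev p x"
    by (subst sum.atMost_Suc_shift) (simp add: ev_def sum_distrib_left mult_ac)
  finally show ?thesis .
qed

lemma ev_add: "ev (p + q) x = ev p x + ev q x"
proof -
  let ?N = "max (degree p) (degree q)"
  have "degree (p + q) \<le> ?N" by (rule degree_add_le_max)
  then show ?thesis by (simp add: ev_eq_sum[of _ ?N] of_rat_add distrib_right sum.distrib)
qed

lemma ev_smult: "ev (Polynomial.smult a p) x = of_rat a * ev p x"
  by (induction p rule: pCons_induct) (auto simp: of_rat_mult algebra_simps)

lemma ev_mult: "ev (p * q) x = ev p x * ev q x"
  by (induction p rule: pCons_induct) (auto simp: ev_add ev_smult algebra_simps)

lemma ev_diff: "ev (p - q) x = ev p x - ev q x"
  using ev_add[of "p - q" q x] by simp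

lemma ev_sum: "ev (sum f A) x = (\<Sum>i\<in>A. ev (f i) x)"
  by (induction A rule: infinite_finite_induct) (auto simp: ev_add)

lemma ev_monom: "ev (monom a k) x = of_rat a * x ^ k"
  by (induction k) (auto simp: monom_Suc monom_0)

lemma ev_monom_sum: "ev (\<Sum>i<d. monom (q i) i) x = (\<Sum>i<d. of_rat (q i) * x ^ i)"
  by (simp add: ev_sum ev_monom)

lemma degree_monom_sum: "d > 0 \<Longrightarrow> degree (\<Sum>i<d. monom (q i) i) < d"
  by (intro degree_lessI) (auto simp: coeff_sum)

lemma ev_lt_sum:
  assumes "degree p < d" shows "ev p x = (\<Sum>i<d. of_rat (coeff p i) * x ^ i)"
proof -
  have "ev p x = (\<Sum>i\<le>d - 1. of_rat (coeff p i) * x ^ i)" using assms by (intro ev_eq_sum) auto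
  also have "{..d - 1} = {..<d}" using assms by auto
  finally show ?thesis .
qed

context nf_basis
begin

text \<open>A Taylor expansion to first order, with a constant that does not depend on
  \<open>q\<close>. The two estimates are proved together, because the second one for
  \<open>pCons a P\<close> uses the first one for \<open>P\<close>.\<close>

lemma ev_perturb:
  assumes p: "prime p"
  shows "\<exists>C\<ge>0. \<forall>q. padic_abs p q \<le> 1 \<longrightarrow>
    alg_norm p (ev P (x + of_rat q * y) - ev P x) \<le> C * padic_abs p q \<and>
    alg_norm p (ev P (x + of_rat q * y) - ev P x - of_rat q * y * ev (pderiv P) x) \<le> C * padic_abs p q ^ 2"
proof (induction P rule: pCons_induct)
  case 0
  show ?case by (rule exI[of _ 0]) (simp add: ring_normD(2)[OF ring_norm_alg_norm[OF p]])
next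
  case (pCons a P)
  interpret Q: abs_val "padic_abs p" by unfold_locales (rule padic_abs_absolute_value[OF p])
  note rn = ring_norm_alg_norm[OF p]
  obtain C where C: "C \<ge> 0" and
    C1: "\<And>q. padic_abs p q \<le> 1 \<Longrightarrow> alg_norm p (ev P (x + of_rat q * y) - ev P x) \<le> C * padic_abs p q" and
    C2: "\<And>q. padic_abs p q \<le> 1 \<Longrightarrow>
      alg_norm p (ev P (x + of_rat q * y) - ev P x - of_rat q * y * ev (pderiv P) x) \<le> C * padic_abs p q ^ 2"
    using pCons.IH by blast
  define X Y Z where "X = alg_norm p x" and "Y = alg_norm p y" and "Z = alg_norm p (ev P x)"
  have nn: "X \<ge> 0" "Y \<ge> 0" "Z \<ge> 0" using ring_normD(1)[OF rn] by (auto simp: X_def Y_def Z_def)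
  define D where "D = X * C + Y * C + Y * Z"
  have nn3: "X * C \<ge> 0" "Y * C \<ge> 0" "Y * Z \<ge> 0" using nn C by auto
  show ?case
  proof (intro exI[of _ D] conjI allI impI)
    show "D \<ge> 0" using nn3 by (simp add: D_def)
    fix q assume q: "padic_abs p q \<le> 1"
    let ?r = "padic_abs p q"
    define \<Delta> where "\<Delta> = ev P (x + of_rat q * y) - ev P x"
    define E where "E = \<Delta> - of_rat q * y * ev (pderiv P) x"
    have \<Delta>: "alg_norm p \<Delta> \<le> C * ?r" and E: "alg_norm p E \<le> C * ?r ^ 2"
      using C1[OF q] C2[OF q] by (auto simp: \<Delta>_def E_def)
    have t1: "alg_norm p (x * \<Delta>) \<le> X * (C * ?r)"
      using ring_normD(5)[OF rn, of x \<Delta>] mult_left_mono[OF \<Delta> nn(1)] by (simp add: X_def)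
    have t2': "alg_norm p (y * \<Delta>) \<le> Y * (C * ?r)"
      using ring_normD(5)[OF rn, of y \<Delta>] mult_left_mono[OF \<Delta> nn(2)] by (simp add: Y_def)
    have t2: "alg_norm p (of_rat q * (y * \<Delta>)) \<le> ?r * (Y * (C * ?r))"
      unfolding alg_norm_scale[OF p] by (intro mult_left_mono t2') simp
    have t2'': "?r * (Y * (C * ?r)) \<le> 1 * (Y * (C * ?r))"
      using nn C q by (intro mult_right_mono) auto
    have t3: "alg_norm p (of_rat q * (y * ev P x)) \<le> ?r * (Y * Z)"
      unfolding alg_norm_scale[OF p] Y_def Z_def by (intro mult_left_mono ring_normD(5)[OF rn]) simp
    have t4: "alg_norm p (x * E) \<le> X * (C * ?r ^ 2)"
      using ring_normD(5)[OF rn, of x E] mult_left_mono[OF E nn(1)] by (simp add: X_def)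
    have r0: "?r \<ge> 0" by simp
    have m: "X * C * ?r \<ge> 0" "Y * C * ?r \<ge> 0" "Y * Z * ?r \<ge> 0"
      "X * C * ?r ^ 2 \<ge> 0" "Y * C * ?r ^ 2 \<ge> 0" "Y * Z * ?r ^ 2 \<ge> 0"
      using nn3 r0 by (auto intro: mult_nonneg_nonneg)
    have "ev (pCons a P) (x + of_rat q * y) - ev (pCons a P) x
        = x * \<Delta> + (of_rat q * (y * \<Delta>) + of_rat q * (y * ev P x))"
      by (simp add: \<Delta>_def algebra_simps)
    moreover have "alg_norm p (x * \<Delta> + (of_rat q * (y * \<Delta>) + of_rat q * (y * ev P x))) \<le> D * ?r"
      using ring_normD(4)[OF rn, of "x * \<Delta>" "of_rat q * (y * \<Delta>) + of_rat q * (y * ev P x)"]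
        ring_normD(4)[OF rn, of "of_rat q * (y * \<Delta>)" "of_rat q * (y * ev P x)"]
        t1 t2 t2'' t3 m(1-3) by (simp add: D_def algebra_simps max_def split: if_splits)
    ultimately show "alg_norm p (ev (pCons a P) (x + of_rat q * y) - ev (pCons a P) x) \<le> D * ?r" by simp
    have "ev (pCons a P) (x + of_rat q * y) - ev (pCons a P) x - of_rat q * y * ev (pderiv (pCons a P)) x
        = x * E + of_rat q * (y * \<Delta>)"
      by (simp add: \<Delta>_def E_def pderiv_pCons ev_add algebra_simps)
    moreover have "alg_norm p (x * E + of_rat q * (y * \<Delta>)) \<le> D * ?r ^ 2"
      using ring_normD(4)[OF rn, of "x * E" "of_rat q * (y * \<Delta>)"] t4 t2 m(4-6)
      by (simp add: D_def algebra_simps power2_eq_square max_def split: if_splits)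
    ultimately show "alg_norm p (ev (pCons a P) (x + of_rat q * y) - ev (pCons a P) x
        - of_rat q * y * ev (pderiv (pCons a P)) x) \<le> D * ?r ^ 2" by simp
  qed
qed

end

definition powers_indep :: "nat \<Rightarrow> 'k::field_char_0 \<Rightarrow> bool" where
  "powers_indep d x \<longleftrightarrow> (\<forall>g. g \<noteq> 0 \<longrightarrow> degree g < d \<longrightarrow> ev g x \<noteq> 0)"

lemma powers_indep_family:
  assumes "powers_indep d x" "(\<Sum>i<d. of_rat (q i) * x ^ i) = 0" "i < d"
  shows "q i = 0"
proof -
  let ?g = "\<Sum>i<d. monom (q i) i"
  have "degree ?g < d" using assms(3) by (intro degree_monom_sum) auto
  moreover have "ev ?g x = 0" using assms(2) by (simp add: ev_monom_sum)
  ultimately have "?g = 0" using assms(1) unfolding powers_indep_def by blast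
  then have "coeff ?g i = 0" by simp
  then show ?thesis using assms(3) by (simp add: coeff_sum)
qed

lemma powers_indep_le:
  fixes x :: "'k::field_char_0"
  assumes nf: "number_field TYPE('k)" and "powers_indep d x"
  shows "d \<le> nf_degree TYPE('k)"
proof -
  have "\<And>q i. (\<Sum>i<d. of_rat (q i) * x ^ i) = 0 \<Longrightarrow> i < d \<Longrightarrow> q i = 0"
    using powers_indep_family[OF assms(2)] by blast
  then have "distinct (map ((^) x) [0..<d])" "rat_vs.independent (set (map ((^) x) [0..<d]))"
    using independent_family[where d = d and v = "\<lambda>i. x ^ i"] by blast+
  from nf_basis_extend[OF nf this] show ?thesis by auto
qed

text \<open>If \<open>ev (pderiv f) \<theta> * \<beta>\<close> were not a polynomial in \<open>\<theta>\<close>, then for small \<open>c\<close> the powers of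
  \<open>\<theta> + c\<beta>\<close> would be independent in one degree more: up to lower powers and a factor \<open>c\<close>,
  the next power is \<open>f(\<theta> + c\<beta>) / c\<close>, a small perturbation of \<open>f'(\<theta>)\<beta>\<close>.  Smallness is meant
  2-adically, \<open>c = 2 ^ k\<close>.\<close>

lemma powers_indep_perturb:
  fixes \<theta> \<beta> :: "'k::field_char_0"
  assumes nf: "number_field TYPE('k)" and d: "d > 0" and ind: "powers_indep d \<theta>"
    and f: "lead_coeff f = 1" "degree f = d" "ev f \<theta> = 0"
    and notin: "\<And>g. degree g < d \<Longrightarrow> ev (pderiv f) \<theta> * \<beta> \<noteq> ev g \<theta>"
  shows "\<exists>\<gamma>::'k. powers_indep (Suc d) \<gamma>"
proof -
  \<comment> \<open>The powers of \<theta> below \<open>d\<close>, together with the element that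
    takes the place of the \<open>d\<close>-th power. By \<open>notin\<close> this family is
    independent, and a basis starting with it measures the perturbations.\<close>
  define v where "v i = (if i = d then ev (pderiv f) \<theta> * \<beta> else \<theta> ^ i)" for i
  have vsum: "(\<Sum>i<Suc d. of_rat (q i) * v i) = (\<Sum>i<d. of_rat (q i) * \<theta> ^ i) + of_rat (q d) * (ev (pderiv f) \<theta> * \<beta>)" for q
    by (simp add: v_def)
  have vind: "q i = 0" if z: "(\<Sum>i<Suc d. of_rat (q i) * v i) = 0" and i: "i < Suc d" for q i
  proof -
    have "q d = 0"
    proof (rule ccontr)
      assume qd: "q d \<noteq> 0"
      have "of_rat (q d) * (ev (pderiv f) \<theta> * \<beta>) = - (\<Sum>i<d. of_rat (q i) * \<theta> ^ i)"
        using z unfolding vsum by (simp add: eq_neg_iff_add_eq_0 add.commute)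
      then have "of_rat (- inverse (q d)) * (of_rat (q d) * (ev (pderiv f) \<theta> * \<beta>))
          = of_rat (- inverse (q d)) * - (\<Sum>i<d. of_rat (q i) * \<theta> ^ i)" by (rule arg_cong)
      moreover have "of_rat (- inverse (q d)) * of_rat (q d) = (-1 :: 'k)"
        using qd by (simp add: of_rat_mult[symmetric] of_rat_minus)
      ultimately have "ev (pderiv f) \<theta> * \<beta> = of_rat (- inverse (q d)) * (\<Sum>i<d. of_rat (q i) * \<theta> ^ i)"
        by (simp add: mult.assoc[symmetric] del: of_rat_minus) (metis add.inverse_inverse)
      also have "\<dots> = ev (Polynomial.smult (- inverse (q d)) (\<Sum>i<d. monom (q i) i)) \<theta>"
        by (simp only: ev_smult ev_monom_sum)
      finally show False using notin degree_monom_sum[OF d, of q]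
        by (metis degree_smult_le le_less_trans)
    qed
    moreover from this have "(\<Sum>i<d. of_rat (q i) * \<theta> ^ i) = 0"
      using trans[OF vsum[of q, symmetric] z] by simp
    ultimately show "q i = 0" using powers_indep_family[OF ind] i by (cases "i = d") auto
  qed
  obtain b where b: "nf_basis b (nf_degree TYPE('k))" "Suc d \<le> nf_degree TYPE('k)" "\<And>i. i < Suc d \<Longrightarrow> b i = v i"
  proof -
    have "distinct (map v [0..<Suc d])" "rat_vs.independent (set (map v [0..<Suc d]))"
      using independent_family[where d = "Suc d" and v = v] vind by blast+
    from nf_basis_extend[OF nf this] that show thesis by (auto simp del: upt_Suc)
  qed
  interpret nf_basis b "nf_degree TYPE('k)" by (rule b(1))
  have p: "prime (2::nat)" by (rule two_is_prime_nat)
  interpret Q: abs_val "padic_abs 2" by unfold_locales (rule padic_abs_absolute_value[OF p])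
  note rn = ring_norm_alg_norm[OF p]
  have coord: "padic_abs 2 (q i) \<le> alg_norm 2 (\<Sum>i<Suc d. of_rat (q i) * v i)" if "i < Suc d" for q i
  proof -
    have "(\<Sum>i<Suc d. of_rat (q i) * v i) = (\<Sum>i<nf_degree TYPE('k). of_rat (if i < Suc d then q i else 0) * b i)"
      using b(2,3) by (intro sum.mono_neutral_cong_left) auto
    from crd_eqI[OF this, of i] that b(2)
    have "crd (\<Sum>i<Suc d. of_rat (q i) * v i) i = q i" by simp
    then show ?thesis
      using crd_norm_ge[of i 2 "\<Sum>i<Suc d. of_rat (q i) * v i"] crd_norm_le_alg_norm[of 2 "\<Sum>i<Suc d. of_rat (q i) * v i"]
        that b(2) by simp
  qed
  obtain Cf where Cf: "Cf \<ge> 0" "\<And>q. padic_abs 2 q \<le> 1 \<Longrightarrow>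
      alg_norm 2 (ev f (\<theta> + of_rat q * \<beta>) - ev f \<theta> - of_rat q * \<beta> * ev (pderiv f) \<theta>) \<le> Cf * padic_abs 2 q ^ 2"
    using ev_perturb[OF p, of f \<theta> \<beta>] by blast
  have "\<forall>i. \<exists>C\<ge>0. \<forall>q. padic_abs 2 q \<le> 1 \<longrightarrow>
      alg_norm 2 (ev (monom 1 i) (\<theta> + of_rat q * \<beta>) - ev (monom 1 i) \<theta>) \<le> C * padic_abs 2 q"
    using ev_perturb[OF p, of _ \<theta> \<beta>] by blast
  then obtain Ci where Ci: "\<And>i. Ci i \<ge> 0" "\<And>i q. padic_abs 2 q \<le> 1 \<Longrightarrow>
      alg_norm 2 ((\<theta> + of_rat q * \<beta>) ^ i - \<theta> ^ i) \<le> Ci i * padic_abs 2 q"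
    by (auto simp: ev_monom) metis
  define C where "C = Cf + (\<Sum>i<d. Ci i)"
  have C: "Cf \<le> C" "i < d \<Longrightarrow> Ci i \<le> C" "C \<ge> 0" for i
    using Cf(1) Ci(1) member_le_sum[of i "{..<d}" Ci] by (auto simp: C_def sum_nonneg add_increasing)
  have "padic_abs 2 2 * 2 = 1" using padic_abs_of_int[OF p, of 2] by simp
  then have "padic_abs 2 2 = inverse 2" by (simp add: field_simps)
  then have abs2: "padic_abs 2 (2 ^ k) = inverse 2 ^ k" for k
    by (simp only: Q.power)
  \<comment> \<open>This makes \<open>C * r < 1\<close> for the 2-adic value \<open>r\<close> of
    \<open>c\<close>, so the errors below stay strictly under the largest coordinate.\<close>
  obtain k where k: "inverse 2 ^ k < inverse (C + 1)"
    using real_arch_pow_inv[of "inverse (C + 1)" "inverse 2"] C(3) by auto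
  define c :: rat where "c = 2 ^ k"
  define r where "r = padic_abs 2 c"
  have r: "r > 0" "r \<le> 1" "C * r < 1"
  proof -
    show "r > 0" "r \<le> 1" by (simp_all add: r_def c_def abs2 power_le_one)
    have "(C + 1) * r < 1" using k C(3) by (simp add: r_def c_def abs2 field_simps)
    then show "C * r < 1" using \<open>r > 0\<close> by (simp add: distrib_right)
  qed
  define \<gamma> where "\<gamma> = \<theta> + of_rat c * \<beta>"
  have "powers_indep (Suc d) \<gamma>" unfolding powers_indep_def
  proof (intro allI impI notI)
    fix g :: "rat poly" assume g: "g \<noteq> 0" "degree g < Suc d" "ev g \<gamma> = 0"
    \<comment> \<open>Division by the monic \<open>f\<close> of degree \<open>d\<close>:
      \<open>g\<close> is \<open>t * f + h\<close> with a constant \<open>t\<close>. Expanded at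
      \<gamma>, \<open>ev g\<close> is the combination of the \<open>v i\<close> with coordinates
      \<open>q\<close>, up to an error.\<close>
    define t where "t = coeff g d"
    define h where "h = g - Polynomial.smult t f"
    have hd: "degree h < d"
    proof (rule degree_lessI)
      show "h \<noteq> 0 \<or> 0 < d" using d by simp
      show "\<forall>k\<ge>d. coeff h k = 0"
      proof (intro allI impI)
        fix k assume "d \<le> k"
        then show "coeff h k = 0" using f g(2)
          by (cases "k = d") (auto simp: h_def t_def coeff_eq_0)
      qed
    qed
    define q where "q i = (if i = d then t * c else coeff h i)" for i
    have qne: "\<exists>i<Suc d. q i \<noteq> 0"
    proof (rule ccontr)
      assume "\<not> ?thesis"
      then have q0: "q i = 0" if "i < Suc d" for i using that by auto
      have "t = 0" using q0[of d] r(1) by (auto simp: q_def r_def)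
      moreover have "h = 0"
      proof (rule poly_eqI)
        fix i show "coeff h i = coeff 0 i"
          using q0[of i] hd by (cases "i < d") (auto simp: q_def coeff_eq_0)
      qed
      ultimately show False using g(1) by (simp add: h_def)
    qed
    define A where "A = Max ((\<lambda>i. padic_abs 2 (q i)) ` {..<Suc d})"
    have A_ge: "padic_abs 2 (q i) \<le> A" if "i < Suc d" for i unfolding A_def using that by (intro Max_ge) auto
    obtain i0 where i0: "i0 < Suc d" "padic_abs 2 (q i0) = A"
      using Max_in[of "(\<lambda>i. padic_abs 2 (q i)) ` {..<Suc d}"] unfolding A_def[symmetric] by fastforce
    have A0: "A > 0"
    proof -
      obtain i where i: "i < Suc d" "q i \<noteq> 0" using qne by blast
      then have "padic_abs 2 (q i) > 0" by simp
      then show ?thesis using A_ge[OF i(1)] by linarith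
    qed
    define E where "E = ev f \<gamma> - of_rat c * \<beta> * ev (pderiv f) \<theta>"
    have E: "alg_norm 2 E \<le> Cf * r ^ 2" using Cf(2)[of c] r f(3) by (simp add: E_def \<gamma>_def r_def)
    have "0 = of_rat t * ev f \<gamma> + ev h \<gamma>"
      using g(3) by (simp add: h_def ev_diff ev_smult)
    also have "ev h \<gamma> = (\<Sum>i<d. of_rat (q i) * \<theta> ^ i) + (\<Sum>i<d. of_rat (q i) * (\<gamma> ^ i - \<theta> ^ i))"
      unfolding ev_lt_sum[OF hd] sum.distrib[symmetric] by (intro sum.cong) (auto simp: q_def algebra_simps)
    also have "of_rat t * ev f \<gamma> = of_rat (q d) * (ev (pderiv f) \<theta> * \<beta>) + of_rat t * E"
    proof -
      have "ev f \<gamma> = E + of_rat c * (ev (pderiv f) \<theta> * \<beta>)" by (simp add: E_def mult_ac)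
      moreover have "q d = t * c" by (simp add: q_def)
      ultimately show ?thesis by (simp only: of_rat_mult distrib_left mult.assoc add.commute)
    qed
    finally have zero: "0 = of_rat (q d) * (ev (pderiv f) \<theta> * \<beta>) + of_rat t * E
        + ((\<Sum>i<d. of_rat (q i) * \<theta> ^ i) + (\<Sum>i<d. of_rat (q i) * (\<gamma> ^ i - \<theta> ^ i)))" .
    have "s1 + x = - (y + s2)" if "0 = x + y + (s1 + s2)" for x y s1 s2 :: 'k
      unfolding eq_neg_iff_add_eq_0 using that by (simp add: add_ac)
    from this[OF zero] have "(\<Sum>i<Suc d. of_rat (q i) * v i)
        = - (of_rat t * E + (\<Sum>i<d. of_rat (q i) * (\<gamma> ^ i - \<theta> ^ i)))"
      unfolding vsum .
    then have "alg_norm 2 (\<Sum>i<Suc d. of_rat (q i) * v i)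
        = alg_norm 2 (of_rat t * E + (\<Sum>i<d. of_rat (q i) * (\<gamma> ^ i - \<theta> ^ i)))"
      by (simp only: ring_normD(3)[OF rn])
    \<comment> \<open>\<open>A\<close> is the largest coordinate. By \<open>coord\<close> the main
      part has norm at least \<open>A\<close>, whereas the error is at most
      \<open>A * (C * r)\<close>, which is less.\<close>
    also have "\<dots> \<le> A * (C * r)"
    proof -
      have "alg_norm 2 (of_rat t * E) \<le> A * (C * r)"
      proof -
        have "padic_abs 2 t * r \<le> A" using A_ge[of d] by (simp add: q_def Q.mult r_def)
        have "alg_norm 2 (of_rat t * E) \<le> padic_abs 2 t * (Cf * r ^ 2)"
          unfolding alg_norm_scale[OF p] by (intro mult_left_mono E) simp
        also have "\<dots> = (padic_abs 2 t * r) * (Cf * r)" by (simp add: power2_eq_square)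
        also have "\<dots> \<le> A * (C * r)"
          using \<open>padic_abs 2 t * r \<le> A\<close> C r Cf(1) A0 by (intro mult_mono) auto
        finally show ?thesis .
      qed
      moreover have "alg_norm 2 (\<Sum>i<d. of_rat (q i) * (\<gamma> ^ i - \<theta> ^ i)) \<le> A * (C * r)"
      proof (rule ring_norm_sum[OF rn])
        fix i assume i: "i \<in> {..<d}"
        have "alg_norm 2 (\<gamma> ^ i - \<theta> ^ i) \<le> Ci i * r" using Ci(2)[of c i] r by (simp add: \<gamma>_def r_def)
        also have "\<dots> \<le> C * r" using C(2)[of i] i r by (intro mult_right_mono) auto
        finally show "alg_norm 2 (of_rat (q i) * (\<gamma> ^ i - \<theta> ^ i)) \<le> A * (C * r)"
          unfolding alg_norm_scale[OF p] using A_ge[of i] i A0 C(3) r ring_normD(1)[OF rn]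
          by (intro mult_mono) auto
      qed (use A0 C(3) r in auto)
      ultimately show ?thesis
        using ring_normD(4)[OF rn, of "of_rat t * E" "\<Sum>i<d. of_rat (q i) * (\<gamma> ^ i - \<theta> ^ i)"] by linarith
    qed
    also have "\<dots> < A * 1" using A0 r(3) by (intro mult_strict_left_mono) auto
    finally show False using coord[OF i0(1), of q] i0(2) by simp
  qed
  then show ?thesis by blast
qed

text \<open>Take \<theta> of largest degree \<open>d\<close> and its monic relation
  \<open>f\<close>. The derivative of \<open>f\<close> does not vanish at \<theta>, as its degree is
  below \<open>d\<close>. By \<open>powers_indep_perturb\<close> and maximality, each multiple of
  this value is a polynomial in \<theta>, hence so is each element of the field.\<close>

lemma primitive_element:
  assumes nf: "number_field TYPE('k::field_char_0)"
  shows "\<exists>(\<theta>::'k) f. lead_coeff f = 1 \<and> degree f = nf_degree TYPE('k) \<and> nf_degree TYPE('k) > 0 \<and> ev f \<theta> = 0 \<and>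
     powers_indep (nf_degree TYPE('k)) \<theta> \<and> (\<forall>y. \<exists>g. degree g < nf_degree TYPE('k) \<and> y = ev g \<theta>)"
proof -
  define P where "P d \<longleftrightarrow> (\<exists>x::'k. powers_indep d x)" for d
  have "P 1" unfolding P_def powers_indep_def
    by (intro exI[of _ 0]) (auto elim!: degree_eq_zeroE)
  moreover have "\<forall>n. P n \<longrightarrow> n \<le> nf_degree TYPE('k)" using powers_indep_le[OF nf] by (auto simp: P_def)
  ultimately obtain d where d: "P d" "\<And>k. P k \<Longrightarrow> k \<le> d"
    using Greatest_le_nat[of P _ "nf_degree TYPE('k)"] GreatestI_nat[of P 1 "nf_degree TYPE('k)"] by metis
  have d0: "d > 0" using d(2)[OF \<open>P 1\<close>] by simp
  obtain \<theta> :: 'k where \<theta>: "powers_indep d \<theta>" using d(1) by (auto simp: P_def)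
  have "\<not> powers_indep (Suc d) \<theta>" using d(2)[of "Suc d"] by (auto simp: P_def)
  then obtain g where g: "g \<noteq> 0" "degree g < Suc d" "ev g \<theta> = 0" by (auto simp: powers_indep_def)
  then have dg: "degree g = d" using \<theta> by (metis less_SucE powers_indep_def)
  define f where "f = Polynomial.smult (inverse (lead_coeff g)) g"
  have f: "lead_coeff f = 1" "degree f = d" "ev f \<theta> = 0"
    using g dg by (auto simp: f_def ev_smult)
  have fp: "ev (pderiv f) \<theta> \<noteq> 0"
  proof -
    have "pderiv f \<noteq> 0" using f(2) d0 by (simp add: pderiv_eq_0_iff)
    moreover have "degree (pderiv f) < d" using f(2) d0 by (simp add: degree_pderiv)
    ultimately show ?thesis using \<theta> by (auto simp: powers_indep_def)
  qed
  have all: "\<exists>g. degree g < d \<and> y = ev g \<theta>" for y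
  proof -
    have "\<exists>g. degree g < d \<and> ev (pderiv f) \<theta> * (y / ev (pderiv f) \<theta>) = ev g \<theta>"
    proof (rule ccontr)
      assume "\<not> ?thesis"
      then have "P (Suc d)" using powers_indep_perturb[OF nf d0 \<theta> f, of "y / ev (pderiv f) \<theta>"]
        unfolding P_def by blast
      then show False using d(2)[of "Suc d"] by simp
    qed
    then show ?thesis using fp by simp
  qed
  interpret nf_basis "\<lambda>i. \<theta> ^ i" d
  proof
    fix q i assume "(\<Sum>i<d. of_rat (q i) * \<theta> ^ i) = 0" "i < d"
    then show "q i = 0" using powers_indep_family[OF \<theta>] by blast
  next
    fix x show "\<exists>q. x = (\<Sum>i<d. of_rat (q i) * \<theta> ^ i)"
      using all[of x] ev_lt_sum by metis
  qed
  show ?thesis using f \<theta> all d0 nf_degree_eq by auto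
qed

section \<open>Embeddings and the norm\<close>

lemma map_poly_of_rat_simps:
  fixes f :: "rat poly"
  shows "poly (map_poly of_rat f) x = ev f (x :: 'a::field_char_0)"
    and "degree (map_poly of_rat f :: 'a poly) = degree f"
    and "pderiv (map_poly of_rat f :: 'a poly) = map_poly of_rat (pderiv f)"
proof -
  show d: "degree (map_poly of_rat f :: 'a poly) = degree f" for f :: "rat poly"
    by (intro degree_map_poly) auto
  show "poly (map_poly of_rat f) x = ev f x"
    by (simp add: poly_altdef ev_def d coeff_map_poly)
  show "pderiv (map_poly of_rat f :: 'a poly) = map_poly of_rat (pderiv f)"
    by (intro poly_eqI) (simp add: coeff_pderiv coeff_map_poly of_rat_mult del: of_nat_Suc)
qed

lemma card_complex_roots:
  fixes f :: "rat poly"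
  assumes "f \<noteq> 0" and "\<And>z::complex. \<not> (ev f z = 0 \<and> ev (pderiv f) z = 0)"
  shows "finite {z::complex. ev f z = 0}" "card {z::complex. ev f z = 0} = degree f"
proof -
  let ?F = "map_poly of_rat f :: complex poly"
  have F0: "?F \<noteq> 0" using assms(1) by (metis degree_0 map_poly_of_rat_simps(2) map_poly_0 of_rat_eq_iff
      coeff_map_poly leading_coeff_0_iff of_rat_0 coeff_0)
  have roots: "{z. poly ?F z = 0} = {z. ev f z = 0}" by (simp add: map_poly_of_rat_simps(1))
  show fin: "finite {z::complex. ev f z = 0}" using poly_roots_finite[OF F0] by (simp add: roots)
  have "rsquarefree ?F" unfolding rsquarefree_roots
    using assms(2) by (simp add: map_poly_of_rat_simps)
  from complex_poly_decompose_rsquarefree[OF this]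
  have "degree ?F = degree (Polynomial.smult (lead_coeff ?F) (\<Prod>z|poly ?F z = 0. [:- z, 1:]))" by simp
  also have "\<dots> = degree (\<Prod>z|poly ?F z = 0. [:- z, 1:])" using F0 by simp
  also have "\<dots> = (\<Sum>z|poly ?F z = 0. degree [:- z, 1:])" by (intro degree_prod_eq_sum_degree) auto
  also have "\<dots> = card {z::complex. ev f z = 0}" by (simp add: roots)
  finally show "card {z::complex. ev f z = 0} = degree f" by (simp add: map_poly_of_rat_simps)
qed

context
  fixes \<sigma> :: "'k::field_char_0 \<Rightarrow> complex"
  assumes \<sigma>: "field_embedding \<sigma>"
begin

lemma emb_1: "\<sigma> 1 = 1" and emb_add: "\<sigma> (x + y) = \<sigma> x + \<sigma> y" and emb_mult: "\<sigma> (x * y) = \<sigma> x * \<sigma> y"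
  using \<sigma> by (auto simp: field_embedding_def)

lemma emb_0: "\<sigma> 0 = 0" using emb_add[of 0 0] by simp

lemma emb_uminus: "\<sigma> (- x) = - \<sigma> x"
  using emb_add[of x "- x"] by (simp add: emb_0 eq_neg_iff_add_eq_0 add.commute)

lemma emb_diff: "\<sigma> (x - y) = \<sigma> x - \<sigma> y"
  using emb_add[of "x - y" y] by simp

lemma emb_eq_0_iff: "\<sigma> x = 0 \<longleftrightarrow> x = 0"
proof
  assume "\<sigma> x = 0"
  show "x = 0"
  proof (rule ccontr)
    assume "x \<noteq> 0"
    then show False using emb_mult[of x "inverse x"] \<open>\<sigma> x = 0\<close> by (simp add: emb_1)
  qed
qed (simp add: emb_0)

lemma emb_of_nat: "\<sigma> (of_nat k) = of_nat k"
  by (induction k) (auto simp: emb_0 emb_1 emb_add)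

lemma emb_of_int: "\<sigma> (of_int k) = of_int k"
  by (cases k) (auto simp: emb_of_nat emb_uminus simp del: of_nat_Suc)

lemma emb_inverse: "\<sigma> (inverse x) = inverse (\<sigma> x)"
  by (cases "x = 0") (use emb_mult[of x "inverse x"] in \<open>auto simp: emb_0 emb_1 emb_eq_0_iff field_simps\<close>)

lemma emb_of_rat: "\<sigma> (of_rat q) = of_rat q"
proof -
  obtain a b where "q = of_int a / of_int b" "b \<noteq> 0" by (metis quotient_of_div quotient_of_denom_pos less_irrefl surj_pair)
  then have "(of_rat q :: 'k) = of_int a * inverse (of_int b)" "(of_rat q :: complex) = of_int a * inverse (of_int b)"
    by (simp_all add: of_rat_divide divide_inverse[symmetric])
  then show ?thesis by (simp only: emb_mult emb_inverse emb_of_int)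
qed

lemma emb_power: "\<sigma> (x ^ k) = \<sigma> x ^ k"
  by (induction k) (auto simp: emb_1 emb_mult)

lemma emb_sum: "\<sigma> (sum g A) = (\<Sum>i\<in>A. \<sigma> (g i))"
  by (induction A rule: infinite_finite_induct) (auto simp: emb_0 emb_add)

lemma emb_ev: "\<sigma> (ev g x) = ev g (\<sigma> x)"
  by (simp add: ev_def emb_sum emb_mult emb_of_rat emb_power)

end

definition embeddings :: "('k::field_char_0 \<Rightarrow> complex) set" where
  "embeddings = {\<sigma>. field_embedding \<sigma>}"

text \<open>Embeddings correspond to the complex roots of \<open>f\<close> through their value at
  \<theta>. Conversely, a root \<open>z\<close> sends \<open>ev g\<close> at \<theta> to
  \<open>ev g\<close> at \<open>z\<close>; this is well defined because \<open>f\<close> divides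
  each polynomial that vanishes at \<theta>.\<close>

lemma embeddings_primitive:
  assumes nf: "number_field TYPE('k::field_char_0)"
  obtains \<theta> :: "'k::field_char_0" where "inj_on (\<lambda>\<sigma>. \<sigma> \<theta>) embeddings"
    "finite (embeddings :: ('k \<Rightarrow> complex) set)" "card (embeddings :: ('k \<Rightarrow> complex) set) = nf_degree TYPE('k)"
proof -
  obtain \<theta> :: 'k and f where f: "lead_coeff f = 1" "degree f = nf_degree TYPE('k)" "nf_degree TYPE('k) > 0"
     "ev f \<theta> = 0" and \<theta>: "powers_indep (nf_degree TYPE('k)) \<theta>"
     and all: "\<And>y. \<exists>g. degree g < nf_degree TYPE('k) \<and> y = ev g \<theta>"
    using primitive_element[OF nf] by blast
  have f0: "f \<noteq> 0" using f by auto
  have dvd: "f dvd h" if "ev h \<theta> = 0" for h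
  proof -
    have "ev h \<theta> = ev (h div f * f + h mod f) \<theta>" by simp
    then have "ev (h mod f) \<theta> = 0" using that f(4) unfolding ev_add ev_mult by simp
    moreover have "h mod f = 0 \<or> degree (h mod f) < degree f" using degree_mod_less[OF f0] .
    ultimately have "h mod f = 0" using \<theta> f(2) by (auto simp: powers_indep_def)
    then show ?thesis by (simp add: mod_eq_0_iff_dvd)
  qed
  \<comment> \<open>If the gcd vanished at \<theta>, \<open>f\<close> would divide its derivative.
    So the cofactor vanishes there, is a multiple of \<open>f\<close>, and the gcd is a unit; a
    Bezout identity then excludes multiple complex roots.\<close>
  have cop: "gcd f (pderiv f) = 1"
  proof -
    define g where "g = gcd f (pderiv f)"
    have "g dvd f" "g dvd pderiv f" by (simp_all add: g_def)
    then obtain k where k: "f = g * k" by auto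
    have "ev g \<theta> \<noteq> 0"
    proof
      assume "ev g \<theta> = 0"
      then have "f dvd pderiv f" using dvd \<open>g dvd pderiv f\<close> dvd_trans by blast
      moreover have "pderiv f \<noteq> 0" using f by (simp add: pderiv_eq_0_iff)
      ultimately have "degree f \<le> degree (pderiv f)" by (rule dvd_imp_degree_le)
      then show False using f by (simp add: degree_pderiv)
    qed
    then have "ev k \<theta> = 0" using f(4) k by (simp add: ev_mult)
    then obtain c where c: "k = f * c" using dvd by blast
    have "f * 1 = f * (g * c)" using k c by (simp add: mult_ac)
    then have "g dvd 1" using f0 by (metis dvd_triv_left mult_left_cancel)
    then show ?thesis unfolding g_def using is_unit_gcd_iff by blast
  qed
  define a b where "a = fst (bezout_coefficients f (pderiv f))" and "b = snd (bezout_coefficients f (pderiv f))"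
  have bez: "a * f + b * pderiv f = 1"
    using bezout_coefficients_fst_snd[of f "pderiv f"] cop by (simp add: a_def b_def)
  have sqf: "\<not> (ev f z = 0 \<and> ev (pderiv f) z = 0)" for z :: complex
  proof
    assume "ev f z = 0 \<and> ev (pderiv f) z = 0"
    then have "ev (a * f + b * pderiv f) z = 0" by (simp add: ev_add ev_mult)
    then show False by (simp add: bez)
  qed
  define Z where "Z = {z::complex. ev f z = 0}"
  have Z: "finite Z" "card Z = nf_degree TYPE('k)"
    using card_complex_roots[OF f0 sqf] f(2) by (auto simp: Z_def)
  define G where "G y = (SOME g. y = ev g \<theta>)" for y
  have G: "ev (G y) \<theta> = y" for y
    unfolding G_def using someI_ex[of "\<lambda>g. y = ev g \<theta>"] all[of y] by metis
  have Geq: "ev (G y) z = ev h z" if "z \<in> Z" "ev h \<theta> = y" for y h z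
  proof -
    have "f dvd G y - h" using that(2) by (intro dvd) (simp add: ev_diff G)
    then obtain k where "G y - h = f * k" by auto
    then have "ev (G y - h) z = 0" using that(1) by (simp add: ev_mult Z_def)
    then show ?thesis by (simp add: ev_diff)
  qed
  have bij: "bij_betw (\<lambda>\<sigma>. \<sigma> \<theta>) embeddings Z"
  proof (rule bij_betw_byWitness[where f' = "\<lambda>z y. ev (G y) z"])
    show "\<forall>\<sigma>\<in>embeddings. (\<lambda>y. ev (G y) (\<sigma> \<theta>)) = \<sigma>"
    proof
      fix \<sigma> :: "'k \<Rightarrow> complex" assume "\<sigma> \<in> embeddings"
      then have "field_embedding \<sigma>" by (simp add: embeddings_def)
      then show "(\<lambda>y. ev (G y) (\<sigma> \<theta>)) = \<sigma>" by (simp add: emb_ev[symmetric] G)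
    qed
    show "\<forall>z\<in>Z. ev (G \<theta>) z = z"
      using Geq[of _ "[:0, 1:]" \<theta>] by simp
    show "(\<lambda>\<sigma>. \<sigma> \<theta>) ` embeddings \<subseteq> Z"
      using f(4) by (auto simp: embeddings_def Z_def emb_ev[symmetric] emb_0)
    show "(\<lambda>z y. ev (G y) z) ` Z \<subseteq> embeddings"
    proof
      fix \<sigma> assume "\<sigma> \<in> (\<lambda>z y. ev (G y) z) ` Z"
      then obtain z where z: "z \<in> Z" "\<sigma> = (\<lambda>y. ev (G y) z)" by blast
      show "\<sigma> \<in> embeddings"
        unfolding embeddings_def field_embedding_def z(2) mem_Collect_eq
      proof (intro conjI allI)
        show "ev (G 1) z = 1" using Geq[OF z(1), of 1 1] by simp
        show "ev (G (x + y)) z = ev (G x) z + ev (G y) z" for x y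
          using Geq[OF z(1), of "G x + G y" "x + y"] by (simp add: ev_add G)
        show "ev (G (x * y)) z = ev (G x) z * ev (G y) z" for x y
          using Geq[OF z(1), of "G x * G y" "x * y"] by (simp add: ev_mult G)
      qed
    qed
  qed
  show thesis
  proof (rule that)
    show "inj_on (\<lambda>\<sigma>. \<sigma> \<theta>) embeddings" using bij by (rule bij_betw_imp_inj_on)
    show "finite (embeddings :: ('k \<Rightarrow> complex) set)" using bij_betw_finite[OF bij] Z(1) by simp
    show "card (embeddings :: ('k \<Rightarrow> complex) set) = nf_degree TYPE('k)"
      using bij_betw_same_card[OF bij] Z(2) by simp
  qed
qed

text \<open>Linear independence of characters, tested on the powers of a primitive element, where
  the relations form a Vandermonde system.\<close>

lemma embeddings_independent:
  assumes nf: "number_field TYPE('k::field_char_0)"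
    and zero: "\<And>x::'k. (\<Sum>\<sigma>\<in>embeddings. c \<sigma> * \<sigma> x) = 0" and \<tau>: "\<tau> \<in> embeddings"
  shows "c \<tau> = 0"
proof -
  obtain \<theta> :: 'k where inj: "inj_on (\<lambda>\<sigma>. \<sigma> \<theta>) embeddings" and fin: "finite (embeddings :: ('k \<Rightarrow> complex) set)"
    using embeddings_primitive[OF nf] by metis
  show ?thesis
  proof (rule vandermonde_independent[OF fin inj _ \<tau>])
    fix n
    have "(\<Sum>\<sigma>\<in>embeddings. c \<sigma> * \<sigma> \<theta> ^ n) = (\<Sum>\<sigma>\<in>embeddings. c \<sigma> * \<sigma> (\<theta> ^ n))"
      by (intro sum.cong) (auto simp: embeddings_def emb_power)
    then show "(\<Sum>\<sigma>\<in>embeddings. c \<sigma> * \<sigma> \<theta> ^ n) = 0" using zero by simp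
  qed
qed

section \<open>The norm as a product over embeddings, and its p-adic bounds\<close>

context nf_basis
begin

lemma emb_crd:
  assumes "field_embedding \<sigma>"
  shows "(\<Sum>k<n. of_rat (crd x k) * \<sigma> (b k)) = \<sigma> x"
proof -
  have "\<sigma> x = \<sigma> (\<Sum>k<n. of_rat (crd x k) * b k)" by (simp add: crd_sum)
  also have "\<dots> = (\<Sum>k<n. of_rat (crd x k) * \<sigma> (b k))"
    by (simp add: emb_sum[OF assms] emb_mult[OF assms] emb_of_rat[OF assms])
  finally show ?thesis by simp
qed

text \<open>The matrix \<open>B\<close> of the conjugates of the basis diagonalises multiplication
  by \<open>x\<close>, with eigenvalues \<open>s i x\<close>. A nonzero vector in the kernel of
  \<open>B\<close> would be a linear relation between the embeddings, so \<open>B\<close> is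
  invertible.\<close>

lemma nf_norm_embeddings:
  assumes nf: "number_field TYPE('k)"
  shows "of_rat (nf_norm x) = (\<Prod>\<sigma>\<in>embeddings. \<sigma> x)"
proof -
  have fin: "finite (embeddings :: ('k \<Rightarrow> complex) set)" and card: "card (embeddings :: ('k \<Rightarrow> complex) set) = n"
    using embeddings_primitive[OF nf] nf_degree_eq by metis+
  obtain s where s: "bij_betw s {..<n} (embeddings :: ('k \<Rightarrow> complex) set)"
    using ex_bij_betw_nat_finite[OF fin] card by (auto simp: lessThan_atLeast0)
  have semb: "field_embedding (s i)" if "i < n" for i
    using bij_betwE[OF s] that by (auto simp: embeddings_def)
  define B where "B = mat n n (\<lambda>(j, i). s i (b j))"
  define M :: "complex mat" where "M = map_mat of_rat (mult_mat x)"
  have car: "B \<in> carrier_mat n n" "M \<in> carrier_mat n n" by (simp_all add: B_def M_def)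
  have detB: "det B \<noteq> 0"
  proof
    assume "det B = 0"
    then obtain v where v: "v \<in> carrier_vec n" "v \<noteq> 0\<^sub>v n" "B *\<^sub>v v = 0\<^sub>v n"
      using det_0_iff_vec_prod_zero[OF car(1)] by blast
    have row: "(\<Sum>i<n. s i (b j) * v $ i) = 0" if j: "j < n" for j
    proof -
      have "(B *\<^sub>v v) $ j = (\<Sum>i<n. s i (b j) * v $ i)"
        using j v(1) by (simp add: B_def scalar_prod_def lessThan_atLeast0)
      then show ?thesis using v(3) j by simp
    qed
    define c where "c \<sigma> = v $ (inv_into {..<n} s \<sigma>)" for \<sigma>
    have cs: "c (s i) = v $ i" if "i < n" for i
      using bij_betw_inv_into_left[OF s] that by (simp add: c_def)
    have "(\<Sum>\<sigma>\<in>embeddings. c \<sigma> * \<sigma> y) = 0" for y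
    proof -
      have "(\<Sum>\<sigma>\<in>embeddings. c \<sigma> * \<sigma> y) = (\<Sum>i<n. v $ i * s i y)"
        by (subst sum.reindex_bij_betw[OF s, symmetric]) (simp add: cs)
      also have "\<dots> = (\<Sum>i<n. v $ i * (\<Sum>j<n. of_rat (crd y j) * s i (b j)))"
        by (intro sum.cong) (auto simp: emb_crd semb)
      also have "\<dots> = (\<Sum>j<n. of_rat (crd y j) * (\<Sum>i<n. s i (b j) * v $ i))"
        unfolding sum_distrib_left by (subst sum.swap) (simp add: mult_ac)
      also have "\<dots> = 0" by (simp add: row)
      finally show ?thesis .
    qed
    then have "c \<sigma> = 0" if "\<sigma> \<in> embeddings" for \<sigma>
      using embeddings_independent[OF nf, of c] that by blast
    then have "v $ i = 0" if "i < n" for i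
      using cs[OF that] bij_betwE[OF s] that by (metis lessThan_iff)
    then have "v = 0\<^sub>v n" using v(1) by (intro eq_vecI) auto
    then show False using v(2) by simp
  qed
  have "M * B = B * mat_diag n (\<lambda>i. s i x)"
  proof (rule eq_matI)
    show "dim_row (M * B) = dim_row (B * mat_diag n (\<lambda>i. s i x))"
      "dim_col (M * B) = dim_col (B * mat_diag n (\<lambda>i. s i x))"
      using car by (simp_all add: mat_diag_mult_right[OF car(1)])
    fix j i assume "j < dim_row (B * mat_diag n (\<lambda>i. s i x))" "i < dim_col (B * mat_diag n (\<lambda>i. s i x))"
    then have ij: "j < n" "i < n" using car by (auto simp: mat_diag_mult_right[OF car(1)])
    have "(M * B) $$ (j, i) = (\<Sum>k<n. of_rat (crd (x * b j) k) * s i (b k))"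
      using ij by (simp add: M_def B_def mult_mat_def scalar_prod_def lessThan_atLeast0)
    also have "\<dots> = s i (x * b j)" by (rule emb_crd[OF semb[OF ij(2)]])
    also have "\<dots> = s i (b j) * s i x" by (simp add: emb_mult[OF semb[OF ij(2)]])
    also have "\<dots> = (B * mat_diag n (\<lambda>i. s i x)) $$ (j, i)"
      using ij by (simp add: mat_diag_mult_right[OF car(1)]) (simp add: B_def)
    finally show "(M * B) $$ (j, i) = (B * mat_diag n (\<lambda>i. s i x)) $$ (j, i)" .
  qed
  then have "det M * det B = det B * det (mat_diag n (\<lambda>i. s i x))"
    using det_mult[OF car(2,1)] det_mult[OF car(1) mat_diag_dim] by metis
  then have "det M = det (mat_diag n (\<lambda>i. s i x))" using detB by simp
  also have "\<dots> = prod_list (diag_mat (mat_diag n (\<lambda>i. s i x)))"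
    by (rule det_lower_triangular[OF _ mat_diag_dim]) (simp add: mat_diag_def)
  also have "diag_mat (mat_diag n (\<lambda>i. s i x)) = map (\<lambda>i. s i x) [0..<n]"
    by (auto simp: diag_mat_def mat_diag_def)
  also have "prod_list (map (\<lambda>i. s i x) [0..<n]) = (\<Prod>i<n. s i x)"
    by (simp add: prod.distinct_set_conv_list[symmetric] lessThan_atLeast0)
  also have "\<dots> = (\<Prod>\<sigma>\<in>embeddings. \<sigma> x)" by (rule prod.reindex_bij_betw[OF s])
  finally show ?thesis by (simp add: M_def nf_norm_def)
qed

lemma nf_norm_mult:
  assumes "number_field TYPE('k)" shows "nf_norm (x * y) = nf_norm x * nf_norm y"
proof -
  have "(of_rat (nf_norm (x * y)) :: complex) = of_rat (nf_norm x * nf_norm y)"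
    unfolding nf_norm_embeddings[OF assms] of_rat_mult prod.distrib[symmetric]
    by (intro prod.cong) (auto simp: embeddings_def emb_mult)
  then show ?thesis by (simp only: of_rat_eq_iff)
qed

lemma nf_norm_of_rat:
  assumes "number_field TYPE('k)" shows "nf_norm (of_rat q) = q ^ n"
proof -
  have "(of_rat (nf_norm (of_rat q)) :: complex) = (\<Prod>\<sigma>\<in>(embeddings :: ('k \<Rightarrow> complex) set). of_rat q)"
    unfolding nf_norm_embeddings[OF assms] by (intro prod.cong) (auto simp: embeddings_def emb_of_rat)
  also have "\<dots> = of_rat (q ^ n)"
    using embeddings_primitive[OF assms] nf_degree_eq by (metis of_rat_power prod_constant)
  finally show ?thesis by (simp only: of_rat_eq_iff)
qed

lemma nf_norm_power:
  assumes "number_field TYPE('k)" shows "nf_norm (x ^ k) = nf_norm x ^ k"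
  by (induction k) (use nf_norm_of_rat[OF assms, of 1] in \<open>auto simp: nf_norm_mult[OF assms]\<close>)

lemma nf_norm_eq_0_iff:
  assumes "number_field TYPE('k)" shows "nf_norm x = 0 \<longleftrightarrow> x = 0"
proof -
  have "finite (embeddings :: ('k \<Rightarrow> complex) set)" "card (embeddings :: ('k \<Rightarrow> complex) set) = n"
    using embeddings_primitive[OF assms] nf_degree_eq by metis+
  then obtain \<tau> :: "'k \<Rightarrow> complex" where "\<tau> \<in> embeddings" using n_pos by fastforce
  have "nf_norm x = 0 \<longleftrightarrow> (of_rat (nf_norm x) :: complex) = 0" by simp
  also have "\<dots> \<longleftrightarrow> (\<exists>\<sigma>\<in>(embeddings :: ('k \<Rightarrow> complex) set). \<sigma> x = 0)"
    unfolding nf_norm_embeddings[OF assms] using \<open>finite embeddings\<close> by (simp add: prod_zero_iff)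
  also have "\<dots> \<longleftrightarrow> x = 0" using \<open>\<tau> \<in> embeddings\<close> by (auto simp: embeddings_def emb_eq_0_iff emb_0)
  finally show ?thesis .
qed

lemma abs_nf_norm:
  assumes "number_field TYPE('k)"
  shows "real_of_rat \<bar>nf_norm x\<bar> = (\<Prod>\<sigma>\<in>embeddings. cmod (\<sigma> x))"
proof -
  have "complex_of_real (real_of_rat q) = of_rat q" for q
    by (cases q) (simp add: of_rat_rat)
  then have "real_of_rat \<bar>nf_norm x\<bar> = cmod (of_rat (nf_norm x))"
    by (metis abs_of_rat norm_of_real)
  then show ?thesis by (simp add: nf_norm_embeddings[OF assms] prod_norm[symmetric])
qed

text \<open>The determinant bound for x^(2^k), after taking roots, replaces the algebra norm by its
  spectral version.\<close>

lemma nf_norm_le_spectral: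
  assumes nf: "number_field TYPE('k)" and p: "prime p"
  shows "padic_abs p (nf_norm x) \<le> spectral (alg_norm p) x ^ n"
proof -
  interpret Q: abs_val "padic_abs p" by unfold_locales (rule padic_abs_absolute_value[OF p])
  note rn = ring_norm_alg_norm[OF p]
  have "padic_abs p (nf_norm x) \<le> root (2 ^ k) (alg_norm p (x ^ (2 ^ k))) ^ n" for k
  proof -
    have "padic_abs p (nf_norm x) ^ (2 ^ k) \<le> alg_norm p (x ^ (2 ^ k)) ^ n"
      using nf_norm_le_alg_norm[OF p, of "x ^ (2 ^ k)"] by (simp add: nf_norm_power[OF nf] Q.power)
    then have "root (2 ^ k) (padic_abs p (nf_norm x) ^ (2 ^ k)) \<le> root (2 ^ k) (alg_norm p (x ^ (2 ^ k)) ^ n)"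
      by (intro real_root_le_mono) auto
    then show ?thesis using ring_normD(1)[OF rn] by (simp add: root_power_2 real_root_power)
  qed
  then show ?thesis
    by (intro LIMSEQ_le_const[OF tendsto_power[OF spectral_lim[OF rn]]]) auto
qed

text \<open>The determinant computing the norm has \<open>local_degree w\<close> columns that are as small as
  \<open>w x\<close>, once the basis vectors outside the local basis are corrected to be small at \<open>w\<close>.\<close>

lemma nf_norm_le_place:
  assumes nf: "number_field TYPE('k)" and p: "prime p" and w: "place_over p w"
    and wi: "abs_val.well_indep w c xs" and dn: "abs_val.dense_list w xs"
    and b: "\<And>i. i < length xs \<Longrightarrow> b i = xs ! i" and len: "length xs \<le> n"
  shows "\<exists>C>0. \<forall>x. x \<noteq> 0 \<longrightarrow> padic_abs p (nf_norm x) \<le> C * max 1 (alg_norm p x) ^ n * w x ^ length xs"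
proof -
  interpret Q: abs_val "padic_abs p" by unfold_locales (rule padic_abs_absolute_value[OF p])
  interpret w: abs_val w using w by unfold_locales (simp add: place_over_def)
  have ult: "w (x + y) \<le> max (w x) (w y)" and wq: "w (of_rat q) = padic_abs p q" for x y q
    using w by (auto simp: place_over_def)
  have ult_sum: "w (sum g A) \<le> B" if "B \<ge> 0" "\<And>i. i \<in> A \<Longrightarrow> w (g i) \<le> B" for g :: "nat \<Rightarrow> 'k" and A B
    using that(2)
  proof (induction A rule: infinite_finite_induct)
    case (insert x A)
    then have "w (g x) \<le> B" "w (sum g A) \<le> B" by auto
    then show ?case using ult[of "g x" "sum g A"] insert(1,2) by simp
  qed (use that(1) in auto)
  note rn = ring_norm_alg_norm[OF p]
  define d where "d = length xs"
  have c0: "c > 0" using wi by (simp add: w.well_indep_def)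
  have rlin_b: "rlin (map of_rat (map q [0..<d])) xs = (\<Sum>i<d. of_rat (q i) * b i)" for q
  proof -
    have gen: "rlin (map f [k..<k + length ys]) ys = (\<Sum>i<length ys. f (k + i) * ys ! i)"
      for f :: "nat \<Rightarrow> 'k" and ys k
    proof (induction ys arbitrary: k)
      case (Cons y ys)
      have "[k..<k + length (y # ys)] = k # [Suc k..<Suc k + length ys]"
        by (simp add: upt_conv_Cons del: upt_Suc)
      then show ?case using Cons[of "Suc k"] by (simp add: sum.lessThan_Suc_shift del: upt_Suc sum.lessThan_Suc)
    qed simp
    show ?thesis using gen[of "\<lambda>i. of_rat (q i)" 0 xs] b by (simp add: d_def o_def)
  qed
  have wi': "c * padic_abs p (q i) \<le> w (\<Sum>i<d. of_rat (q i) * b i)" if "i < d" for q i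
  proof -
    let ?qs = "map of_rat (map q [0..<d]) :: 'k list"
    have "set ?qs \<subseteq> \<rat>" by (auto simp: Rats_def)
    moreover have "of_rat (q i) \<in> set (take (length xs) ?qs)" using that by (simp add: d_def)
    ultimately have "c * w (of_rat (q i)) \<le> w (rlin ?qs xs)"
      using wi unfolding w.well_indep_def by blast
    then show ?thesis unfolding rlin_b wq .
  qed
  have dn': "\<exists>q. w (y - (\<Sum>i<d. of_rat (q i) * b i)) < e" if e: "e > 0" for y e
  proof -
    obtain qs where qs: "set qs \<subseteq> \<rat>" "w (y - rlin qs xs) < e" using dn e unfolding w.dense_list_def by blast
    obtain ps where ps: "set ps \<subseteq> \<rat>" "length ps = length xs" "rlin ps xs = rlin qs xs"
      using rlin_pad[OF qs(1)] by metis
    have "\<forall>i. \<exists>q. i < d \<longrightarrow> ps ! i = of_rat q"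
      using ps(1,2) by (metis Rats_cases d_def nth_mem subsetD)
    then obtain q where q: "\<And>i. i < d \<Longrightarrow> ps ! i = of_rat (q i)" by metis
    have "ps = map of_rat (map q [0..<d])" using ps(2) q by (intro nth_equalityI) (auto simp: d_def)
    then show ?thesis using qs(2) ps(3) rlin_b[of q] by metis
  qed
  define B where "B = Max (insert 1 ((\<lambda>j. w (b j)) ` {..<n}))"
  have B: "B \<ge> 1" "j < n \<Longrightarrow> w (b j) \<le> B" for j unfolding B_def by (auto intro: Max_ge)
  define C where "C = (B / c) ^ d"
  have "padic_abs p (nf_norm x) \<le> C * max 1 (alg_norm p x) ^ n * w x ^ d" if x: "x \<noteq> 0" for x
  proof -
    define r where "r = w x"
    define F where "F = max 1 (alg_norm p x)"
    have r: "r > 0" using x by (simp add: r_def)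
    have F: "F \<ge> 1" "alg_norm p x \<le> F" by (auto simp: F_def)
    \<comment> \<open>By density, each basis vector is corrected by a rational combination of the
      local basis so that it becomes smaller than \<open>w x\<close>.\<close>
    have "\<forall>k. \<exists>q. w (b k - (\<Sum>i<d. of_rat (q i) * b i)) < r" using dn'[OF r] by blast
    from choice[OF this] obtain q where q: "\<And>k. w (b k - (\<Sum>i<d. of_rat (q k i) * b i)) < r"
      by blast
    \<comment> \<open>A unitriangular column operation, so the determinant stays the norm. It adds
      to column \<open>i < d\<close> the columns \<open>k >= d\<close> weighted by
      \<open>q k i\<close>, which re-expands \<open>x * b j\<close> in the basis with corrected
      later vectors.\<close>
    define U where "U = mat n n (\<lambda>(k, i). if i < d \<and> d \<le> k then q k i else if k = i then 1 else 0)"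
    have U: "U \<in> carrier_mat n n" by (simp add: U_def)
    have "det U = prod_list (diag_mat U)"
      by (rule det_lower_triangular[OF _ U]) (auto simp: U_def)
    also have "diag_mat U = map (\<lambda>_. 1) [0..<n]" by (auto simp: diag_mat_def U_def)
    also have "prod_list (map (\<lambda>_. 1) [0..<n]) = (1 :: rat)" by (simp add: map_replicate_const)
    finally have "det (mult_mat x * U) = nf_norm x"
      using det_mult[OF mult_mat_carrier U] by (simp add: nf_norm_def)
    have entry: "(mult_mat x * U) $$ (j, i) = (\<Sum>k<n. crd (x * b j) k * U $$ (k, i))" if "j < n" "i < n" for j i
      using that U by (simp add: mult_mat_def scalar_prod_def lessThan_atLeast0)
    have big: "(mult_mat x * U) $$ (j, i) = crd (x * b j) i" if "j < n" "i < n" "\<not> i < d" for j i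
    proof -
      have "(mult_mat x * U) $$ (j, i) = (\<Sum>k<n. if k = i then crd (x * b j) k else 0)"
        unfolding entry[OF that(1,2)] using that by (intro sum.cong) (auto simp: U_def)
      then show ?thesis using that by simp
    qed
    have split': "(\<Sum>k<n. g k) = (\<Sum>k<d. g k) + (\<Sum>k\<in>{d..<n}. g k)" for g :: "nat \<Rightarrow> rat"
      using len by (simp add: lessThan_atLeast0 sum.atLeastLessThan_concat d_def)
    have split'': "(\<Sum>k<n. g k) = (\<Sum>k<d. g k) + (\<Sum>k\<in>{d..<n}. g k)" for g :: "nat \<Rightarrow> 'k"
      using len by (simp add: lessThan_atLeast0 sum.atLeastLessThan_concat d_def)
    have small: "(mult_mat x * U) $$ (j, i) = crd (x * b j) i + (\<Sum>k\<in>{d..<n}. crd (x * b j) k * q k i)"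
      if "j < n" "i < d" for j i
    proof -
      have "i < n" using that(2) len by (simp add: d_def)
      then have "(mult_mat x * U) $$ (j, i) = (\<Sum>k<d. if k = i then crd (x * b j) k else 0)
          + (\<Sum>k\<in>{d..<n}. crd (x * b j) k * q k i)"
        unfolding entry[OF that(1) \<open>i < n\<close>] split' using that(2) len
        by (intro arg_cong2[where f = "(+)"] sum.cong) (auto simp: U_def d_def)
      then show ?thesis using that by simp
    qed
    have smallb: "padic_abs p ((mult_mat x * U) $$ (j, i)) \<le> B / c * F * r" if j: "j < n" and i: "i < d" for j i
    proof -
      define y' where "y' k = b k - (\<Sum>i<d. of_rat (q k i) * b i)" for k
      have "x * b j = (\<Sum>k<d. of_rat (crd (x * b j) k) * b k) + (\<Sum>k\<in>{d..<n}. of_rat (crd (x * b j) k) * b k)"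
        unfolding split''[symmetric] by (rule crd_sum[symmetric])
      also have "(\<Sum>k\<in>{d..<n}. of_rat (crd (x * b j) k) * b k)
          = (\<Sum>k\<in>{d..<n}. of_rat (crd (x * b j) k) * y' k)
          + (\<Sum>k\<in>{d..<n}. \<Sum>i<d. of_rat (crd (x * b j) k * q k i) * b i)"
        by (simp add: y'_def sum.distrib[symmetric] sum_distrib_left algebra_simps of_rat_mult)
      also have "(\<Sum>k\<in>{d..<n}. \<Sum>i<d. of_rat (crd (x * b j) k * q k i) * b i)
          = (\<Sum>i<d. of_rat (\<Sum>k\<in>{d..<n}. crd (x * b j) k * q k i) * b i)"
        by (subst sum.swap) (simp add: of_rat_sum sum_distrib_right)
      finally have dec: "x * b j = (\<Sum>i<d. of_rat (crd (x * b j) i) * b i)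
          + ((\<Sum>k\<in>{d..<n}. of_rat (crd (x * b j) k) * y' k)
          + (\<Sum>i<d. of_rat (\<Sum>k\<in>{d..<n}. crd (x * b j) k * q k i) * b i))" .
      have "v - t = u + s" if "v = u + (t + s)" for v u t s :: 'k using that by simp
      from this[OF dec] have "x * b j - (\<Sum>k\<in>{d..<n}. of_rat (crd (x * b j) k) * y' k)
          = (\<Sum>i<d. of_rat (crd (x * b j) i) * b i) + (\<Sum>i<d. of_rat (\<Sum>k\<in>{d..<n}. crd (x * b j) k * q k i) * b i)" .
      also have "\<dots> = (\<Sum>i<d. of_rat ((mult_mat x * U) $$ (j, i)) * b i)"
        unfolding sum.distrib[symmetric] using j by (intro sum.cong) (auto simp: small of_rat_add distrib_right)
      \<comment> \<open>The combination of local basis vectors with the first \<open>d\<close>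
        entries of row \<open>j\<close> is \<open>x * b j\<close> up to multiples of the corrected
        vectors, hence of value at most \<open>B * F * r\<close>; \<open>well_indep\<close> passes
        this on to the entries.\<close>
      finally have eq: "(\<Sum>i<d. of_rat ((mult_mat x * U) $$ (j, i)) * b i)
          = x * b j + - (\<Sum>k\<in>{d..<n}. of_rat (crd (x * b j) k) * y' k)" by simp
      have "c * padic_abs p ((mult_mat x * U) $$ (j, i)) \<le> w (x * b j + - (\<Sum>k\<in>{d..<n}. of_rat (crd (x * b j) k) * y' k))"
        using wi'[OF i, of "\<lambda>i. (mult_mat x * U) $$ (j, i)"] unfolding eq .
      also have "\<dots> \<le> B * F * r"
      proof -
        have "w (x * b j) \<le> B * F * r"
        proof -
          have "w (x * b j) \<le> r * B" using B(2)[OF j] r by (simp add: w.mult r_def mult_left_mono)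
          also have "\<dots> \<le> B * F * r" using B(1) F(1) r by (simp add: mult_ac)
          finally show ?thesis .
        qed
        moreover have "w (\<Sum>k\<in>{d..<n}. of_rat (crd (x * b j) k) * y' k) \<le> B * F * r"
        proof (rule ult_sum)
          show "B * F * r \<ge> 0" using B F r by simp
          fix k assume k: "k \<in> {d..<n}"
          have "w (of_rat (crd (x * b j) k) * y' k) \<le> F * r"
            unfolding w.mult wq using crd_mult_basis_le[OF p j, of k x] F k q[of k] r
            by (intro mult_mono) (auto simp: y'_def)
          also have "\<dots> \<le> B * (F * r)" using mult_right_mono[OF B(1), of "F * r"] F r by simp
          finally show "w (of_rat (crd (x * b j) k) * y' k) \<le> B * F * r" by (simp add: mult.assoc)
        qed
        ultimately show ?thesis
          using ult[of "x * b j" "- (\<Sum>k\<in>{d..<n}. of_rat (crd (x * b j) k) * y' k)"] by simp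
      qed
      finally show ?thesis using c0 by (simp add: field_simps)
    qed
    have "padic_abs p (det (mult_mat x * U)) \<le> (\<Prod>i<n. if i < d then B / c * F * r else F)"
    proof (rule padic_det_le[OF p])
      show "mult_mat x * U \<in> carrier_mat n n" by (rule mult_carrier_mat[OF mult_mat_carrier U])
      fix j i assume ij: "j < n" "i < n"
      show "padic_abs p ((mult_mat x * U) $$ (j, i)) \<le> (if i < d then B / c * F * r else F)"
        using smallb[of j i] big[of j i] ij crd_mult_basis_le[OF p ij, of x] F(2) by auto
    qed
    also have "\<dots> = (\<Prod>i<d. B / c * F * r) * (\<Prod>i\<in>{d..<n}. F)"
    proof -
      have "(\<Prod>i<n. g i) = (\<Prod>i<d. g i) * (\<Prod>i\<in>{d..<n}. g i)" for g :: "nat \<Rightarrow> real"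
        using len by (simp add: lessThan_atLeast0 prod.atLeastLessThan_concat d_def)
      then show ?thesis by simp
    qed
    also have "\<dots> = C * (F ^ d * F ^ (n - d)) * r ^ d"
      by (simp add: C_def power_mult_distrib power_divide)
    also have "F ^ d * F ^ (n - d) = F ^ n" using len by (simp add: d_def power_add[symmetric])
    finally show ?thesis using \<open>det (mult_mat x * U) = nf_norm x\<close> by (simp add: F_def r_def)
  qed
  moreover have "C > 0" using B c0 by (simp add: C_def)
  ultimately show ?thesis unfolding d_def by blast
qed

end

section \<open>Integrality, the product formula inequality and places where an element is
  large\<close>

lemma padic_abs_of_nat:
  assumes "prime p" "a > 0"
  shows "padic_abs p (of_nat a) = inverse (real p ^ multiplicity p a)"
proof -
  have "multiplicity (int p) (int a) = multiplicity p a"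
    unfolding multiplicity_def by (simp flip: int_dvd_int_iff add: of_nat_power)
  then show ?thesis using padic_abs_of_int[OF assms(1), of "int a"] assms(2) by simp
qed

lemma rat_integer_if_padic:
  assumes "\<And>p. prime p \<Longrightarrow> padic_abs p q \<le> 1"
  shows "q \<in> \<int>"
proof (cases "q = 0")
  case False
  obtain n d where nd: "quotient_of q = (n, d)" by force
  have d: "d > 0" and q: "q = of_int n / of_int d" and cop: "coprime n d"
    using quotient_of_denom_pos[OF nd] quotient_of_div[OF nd] quotient_of_coprime[OF nd] by auto
  have "d = 1"
  proof (rule ccontr)
    assume "d \<noteq> 1"
    then obtain r where r: "prime r" "r dvd d" using d prime_divisor_exists[of d] by auto
    obtain p where p: "r = int p" "prime p" using r(1)
      by (metis prime_int_nat_transfer prime_ge_0_int int_nat_eq)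
    have "\<not> r dvd n" using cop r by (meson coprime_common_divisor not_prime_unit)
    then have m0: "multiplicity r n = 0" by (rule not_dvd_imp_multiplicity_0)
    have m1: "multiplicity r d > 0" using r d
      by (metis bot_nat_0.not_eq_extremum less_irrefl multiplicity_eq_zero_iff not_prime_unit)
    have "padic_abs p q > 1"
      using False nd m0 m1 prime_gt_1_nat[OF p(2)] unfolding p(1)
      by (simp add: padic_abs_def power_int_def one_less_power)
    then show False using assms[OF p(2)] by simp
  qed
  then show ?thesis using q by simp
qed simp

lemma padic_abs_integer_ge:
  assumes p: "prime p" and "q \<in> \<int>" "q \<noteq> 0"
  shows "real_of_rat \<bar>q\<bar> * padic_abs p q \<ge> 1"
proof -
  obtain a where a: "q = of_int a" "a \<noteq> 0" using assms by (auto elim!: Ints_cases)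
  have "int p ^ multiplicity (int p) a \<le> \<bar>a\<bar>"
    using a multiplicity_dvd[of "int p" a] by (intro zdvd_imp_le) auto
  then have "real p ^ multiplicity (int p) a \<le> real_of_int \<bar>a\<bar>"
    by (metis of_int_le_iff of_int_of_nat_eq of_int_power)
  moreover have "real_of_rat \<bar>q\<bar> = real_of_int \<bar>a\<bar>"
    unfolding a(1) by (metis of_int_abs of_rat_of_int_eq)
  ultimately have "real p ^ multiplicity (int p) a * inverse (real p ^ multiplicity (int p) a)
      \<le> real_of_rat \<bar>q\<bar> * padic_abs p q"
    unfolding a(1) padic_abs_of_int[OF p a(2)] by (intro mult_right_mono) auto
  then show ?thesis using prime_gt_0_nat[OF p] by simp
qed

definition integral_at :: "nat \<Rightarrow> 'k::field_char_0 set" where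
  "integral_at p = {z. \<forall>b n. nf_basis b n \<longrightarrow> spectral (nf_basis.alg_norm b n p) z \<le> 1}"

lemma integral_at_subring:
  assumes p: "prime p" shows "subring_set (integral_at p :: 'k::field_char_0 set)"
proof -
  have rs: "ring_norm (spectral (nf_basis.alg_norm b n p))"
    "spectral (nf_basis.alg_norm b n p) 1 = 1" if "nf_basis b n" for b :: "nat \<Rightarrow> 'k" and n
  proof -
    interpret nf_basis b n by (rule that)
    show "ring_norm (spectral (alg_norm p))" by (rule ring_norm_spectral[OF ring_norm_alg_norm[OF p]])
    show "spectral (alg_norm p) 1 = 1"
      by (rule spectral_1[OF ring_norm_alg_norm[OF p] alg_norm_pos[OF p]]) simp
  qed
  show ?thesis unfolding subring_set_def integral_at_def
  proof (intro conjI ballI CollectI allI impI)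
    fix b :: "nat \<Rightarrow> 'k" and n assume b: "nf_basis b n"
    note D = ring_normD[OF rs(1)[OF b]]
    show "spectral (nf_basis.alg_norm b n p) 0 \<le> 1" by (simp add: D(2))
    show "spectral (nf_basis.alg_norm b n p) 1 \<le> 1" by (simp add: rs(2)[OF b])
    fix x :: 'k assume "x \<in> {z. \<forall>b n. nf_basis b n \<longrightarrow> spectral (nf_basis.alg_norm b n p) z \<le> 1}"
    then have x: "spectral (nf_basis.alg_norm b n p) x \<le> 1" using b by blast
    then show "spectral (nf_basis.alg_norm b n p) (- x) \<le> 1" by (simp add: D(3))
    fix y :: 'k assume "y \<in> {z. \<forall>b n. nf_basis b n \<longrightarrow> spectral (nf_basis.alg_norm b n p) z \<le> 1}"
    then have y: "spectral (nf_basis.alg_norm b n p) y \<le> 1" using b by blast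
    show "spectral (nf_basis.alg_norm b n p) (x + y) \<le> 1" using D(4)[of x y] x y by linarith
    show "spectral (nf_basis.alg_norm b n p) (x * y) \<le> 1"
      using D(5)[of x y] mult_mono[OF x y _ D(1)] by simp
  qed
qed

lemma algebraic_int_integral_at: "prime p \<Longrightarrow> algebraic_int x \<Longrightarrow> x \<in> integral_at p"
  unfolding integral_at_def
  by (auto intro!: spectral_algebraic_int nf_basis.ring_norm_alg_norm)

lemma number_field_basis:
  assumes "number_field TYPE('k::field_char_0)"
  obtains b :: "nat \<Rightarrow> 'k::field_char_0" where "nf_basis b (nf_degree TYPE('k))"
  using nf_basis_extend[OF assms, of "[]"] by (auto simp: rat_vs.independent_empty)

lemma nf_norm_integer:
  assumes nf: "number_field TYPE('k::field_char_0)" and b: "nf_basis b n"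
    and x: "\<And>p. prime p \<Longrightarrow> (x::'k) \<in> integral_at p"
  shows "nf_basis.nf_norm b n x \<in> \<int>"
proof -
  interpret nf_basis b n by (rule b)
  show ?thesis
  proof (rule rat_integer_if_padic)
    fix p :: nat assume p: "prime p"
    have "spectral (alg_norm p) x \<le> 1" using x[OF p] b by (auto simp: integral_at_def)
    then have "spectral (alg_norm p) x ^ n \<le> 1"
      using spectral_nonneg[OF ring_norm_alg_norm[OF p]] by (intro power_le_one)
    then show "padic_abs p (nf_norm x) \<le> 1" using nf_norm_le_spectral[OF nf p, of x] by linarith
  qed
qed

text \<open>\<open>nf_norm_le_place\<close> is applied to the powers x^(2^k) and followed by roots:
  the constant tends to 1, and so does the factor from the algebra norm because \<open>x\<close> is
  integral at \<open>p\<close>. What remains bounds the p-adic value of the norm, a nonzero integer,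
  whose absolute value times p-adic value is at least 1.\<close>

lemma place_norm_lower_bound:
  fixes x :: "'k::field_char_0"
  assumes nf: "number_field TYPE('k)" and p: "prime p" and w: "place_over p w"
    and x: "\<And>p. prime p \<Longrightarrow> x \<in> integral_at p" and x0: "x \<noteq> 0"
  shows "(\<Prod>\<sigma>\<in>embeddings. cmod (\<sigma> x)) * w x ^ local_degree w \<ge> 1"
proof -
  interpret Q: abs_val "padic_abs p" by unfold_locales (rule padic_abs_absolute_value[OF p])
  interpret w: abs_val w using w by unfold_locales (simp add: place_over_def)
  obtain c xs where xs: "w.well_indep c xs" "w.dense_list xs" "local_degree w = length xs"
    using w.exists_local_basis[OF nf] by blast
  obtain b where b: "nf_basis b (nf_degree TYPE('k))" "length xs \<le> nf_degree TYPE('k)"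
    "\<And>i. i < length xs \<Longrightarrow> b i = xs ! i"
    using nf_basis_extend[OF nf] w.well_indep_independent[OF xs(1)] by metis
  define n where "n = nf_degree TYPE('k)"
  interpret nf_basis b n using b(1) by (simp add: n_def)
  note rn = ring_norm_alg_norm[OF p]
  let ?d = "length xs"
  obtain C where C: "C > 0" "\<And>x. x \<noteq> 0 \<Longrightarrow> padic_abs p (nf_norm x) \<le> C * max 1 (alg_norm p x) ^ n * w x ^ ?d"
    using nf_norm_le_place[OF nf p w xs(1,2) b(3)] b(2) by (auto simp: n_def)
  have sp: "spectral (alg_norm p) x \<le> 1" using x[OF p] nf_basis_axioms by (auto simp: integral_at_def)
  have "padic_abs p (nf_norm x) \<le> root (2 ^ k) C * max 1 (root (2 ^ k) (alg_norm p (x ^ (2 ^ k)))) ^ n * w x ^ ?d" for k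
  proof -
    have "padic_abs p (nf_norm x) ^ (2 ^ k) \<le> C * max 1 (alg_norm p (x ^ (2 ^ k))) ^ n * (w x ^ ?d) ^ (2 ^ k)"
      using C(2)[of "x ^ (2 ^ k)"] x0
      by (simp add: nf_norm_power[OF nf] Q.power w.power power_mult[symmetric] mult.commute)
    then have "root (2 ^ k) (padic_abs p (nf_norm x) ^ (2 ^ k))
        \<le> root (2 ^ k) (C * max 1 (alg_norm p (x ^ (2 ^ k))) ^ n * (w x ^ ?d) ^ (2 ^ k))"
      by (intro real_root_le_mono) auto
    moreover have "root (2 ^ k) (C * g ^ n * r ^ (2 ^ k)) = root (2 ^ k) C * root (2 ^ k) g ^ n * r"
      if "r \<ge> 0" for g r :: real
      using that by (simp add: root_power_2 real_root_mult real_root_power[of _ g])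
    ultimately have "padic_abs p (nf_norm x) \<le> root (2 ^ k) C * root (2 ^ k) (max 1 (alg_norm p (x ^ (2 ^ k)))) ^ n * w x ^ ?d"
      by (simp add: root_power_2)
    moreover have "root (2 ^ k) (max 1 (alg_norm p (x ^ (2 ^ k)))) = max 1 (root (2 ^ k) (alg_norm p (x ^ (2 ^ k))))"
      by (simp add: max_def)
    ultimately show ?thesis by simp
  qed
  moreover have "(\<lambda>k. root (2 ^ k) C * max 1 (root (2 ^ k) (alg_norm p (x ^ (2 ^ k)))) ^ n * w x ^ ?d)
      \<longlonglongrightarrow> 1 * max 1 (spectral (alg_norm p) x) ^ n * w x ^ ?d"
    by (intro tendsto_intros tendsto_max root_const_lim[OF rn C(1)] spectral_lim[OF rn])
  ultimately have "padic_abs p (nf_norm x) \<le> 1 * max 1 (spectral (alg_norm p) x) ^ n * w x ^ ?d"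
    by (intro LIMSEQ_le_const) auto
  then have le: "padic_abs p (nf_norm x) \<le> w x ^ ?d" using sp by (simp add: max_absorb1)
  have "1 \<le> real_of_rat \<bar>nf_norm x\<bar> * padic_abs p (nf_norm x)"
    using nf_norm_integer[OF nf nf_basis_axioms x] nf_norm_eq_0_iff[OF nf] x0
    by (intro padic_abs_integer_ge[OF p]) auto
  also have "\<dots> \<le> real_of_rat \<bar>nf_norm x\<bar> * w x ^ ?d" by (intro mult_left_mono le) auto
  finally show ?thesis by (simp add: abs_nf_norm[OF nf] xs(3))
qed

text \<open>Divide \<open>x\<close> by the part \<open>M\<close> of \<open>N\<close> supported on
  \<open>S\<close>. If the quotient had spectral value at most 1 at each \<open>p\<close> in
  \<open>S\<close>, its norm would be a nonzero integer, against \<open>small\<close>. A spectral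
  value above 1 yields a place where the quotient exceeds 1, so \<open>x\<close> exceeds
  \<open>M\<close> there, and \<open>N\<close> has the same value as \<open>M\<close>.\<close>

lemma exists_place_small:
  fixes x :: "'k::field_char_0"
  assumes nf: "number_field TYPE('k)"
    and x: "\<And>p. prime p \<Longrightarrow> x \<in> integral_at p" and x0: "x \<noteq> 0"
    and S: "finite S" "\<And>p. p \<in> S \<Longrightarrow> prime p" and N: "N > 0"
    and small: "(\<Prod>\<sigma>\<in>embeddings. cmod (\<sigma> x)) < real (\<Prod>p\<in>S. p ^ multiplicity p N) ^ nf_degree TYPE('k)"
  shows "\<exists>p\<in>S. \<exists>w. place_over p w \<and> w x > w (of_nat N)"
proof -
  define n where "n = nf_degree TYPE('k)"
  obtain b :: "nat \<Rightarrow> 'k" where "nf_basis b n" using number_field_basis[OF nf] n_def by metis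
  then interpret nf_basis b n .
  define M where "M = (\<Prod>p\<in>S. p ^ multiplicity p N)"
  have M: "M > 0" unfolding M_def using S by (intro prod_pos) (auto dest: prime_gt_0_nat)
  have mM: "multiplicity p M = (if p \<in> S then multiplicity p N else 0)" if "prime p" for p
    unfolding M_def using S that by (subst multiplicity_prod_prime_powers) auto
  define y where "y = x / of_nat M"
  have xy: "x = of_rat (of_nat M) * y" using M by (simp add: y_def)
  have y0: "y \<noteq> 0" using x0 xy by auto
  have Nx: "nf_norm x = of_nat M ^ n * nf_norm y"
    unfolding xy by (simp only: nf_norm_mult[OF nf] nf_norm_of_rat[OF nf])
  have "\<exists>p\<in>S. spectral (alg_norm p) y > 1"
  proof (rule ccontr)
    assume "\<not> ?thesis"
    then have le1: "spectral (alg_norm p) y \<le> 1" if "p \<in> S" for p using that by force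
    have "nf_norm y \<in> \<int>"
    proof (rule rat_integer_if_padic)
      fix p :: nat assume p: "prime p"
      interpret Q: abs_val "padic_abs p" by unfold_locales (rule padic_abs_absolute_value[OF p])
      show "padic_abs p (nf_norm y) \<le> 1"
      proof (cases "p \<in> S")
        case True
        then have "spectral (alg_norm p) y ^ n \<le> 1"
          using le1 spectral_nonneg[OF ring_norm_alg_norm[OF p]] by (intro power_le_one) auto
        then show ?thesis using nf_norm_le_spectral[OF nf p, of y] by linarith
      next
        case False
        \<comment> \<open>Outside \<open>S\<close> the number \<open>M\<close> is a unit, so the
          integrality of \<open>x\<close> decides.\<close>
        have "padic_abs p (of_nat M) = 1" using padic_abs_of_nat[OF p M] mM[OF p] False by simp
        then have "padic_abs p (nf_norm y) = padic_abs p (nf_norm x)"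
          unfolding Nx by (simp add: Q.mult Q.power)
        also have "\<dots> \<le> spectral (alg_norm p) x ^ n" by (rule nf_norm_le_spectral[OF nf p])
        also have "\<dots> \<le> 1" using x[OF p] nf_basis_axioms spectral_nonneg[OF ring_norm_alg_norm[OF p]]
          by (intro power_le_one) (auto simp: integral_at_def)
        finally show ?thesis .
      qed
    qed
    moreover have "nf_norm y \<noteq> 0" using nf_norm_eq_0_iff[OF nf] y0 by simp
    ultimately have "\<bar>nf_norm y\<bar> \<ge> 1" by (auto elim!: Ints_cases simp: abs_if)
    then have "of_nat M ^ n \<le> \<bar>nf_norm x\<bar>"
      unfolding Nx using mult_left_mono[of 1 "\<bar>nf_norm y\<bar>" "of_nat M ^ n"] by (simp add: abs_mult)
    then have "real_of_rat (of_nat M ^ n) \<le> real_of_rat \<bar>nf_norm x\<bar>" by (simp only: of_rat_less_eq)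
    then have "real M ^ n \<le> (\<Prod>\<sigma>\<in>embeddings. cmod (\<sigma> x))"
      unfolding abs_nf_norm[OF nf] by (simp add: of_rat_power)
    then show False using small by (simp add: M_def n_def)
  qed
  then obtain p where p: "p \<in> S" "spectral (alg_norm p) y > 1" by blast
  have pp: "prime p" using S p by simp
  obtain w where w: "place_over p w" "w y > 1" using place_of_spectral[OF pp p(2)] by blast
  interpret w: abs_val w using w by unfold_locales (simp add: place_over_def)
  have wn: "w (of_nat a) = padic_abs p (of_nat a)" for a
    using w(1) by (metis place_over_def of_rat_of_nat_eq)
  have "w (of_nat N) = w (of_nat M)"
    unfolding wn padic_abs_of_nat[OF pp N] padic_abs_of_nat[OF pp M] using mM[OF pp] p(1) by simp
  also have "\<dots> < w (of_nat M) * w y" using mult_strict_left_mono[OF w(2), of "w (of_nat M)"] M by simp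
  also have "\<dots> = w x" by (simp add: xy w.mult)
  finally show ?thesis using p(1) w(1) by (auto intro!: bexI[of _ p])
qed

section \<open>Archimedean places, their local degrees and the embeddings\<close>

lemma embeddings_cnj_cases:
  fixes \<sigma> \<tau> :: "'k::field_char_0 \<Rightarrow> complex"
  assumes \<sigma>: "field_embedding \<sigma>" and \<tau>: "field_embedding \<tau>" and eq: "\<And>x. cmod (\<sigma> x) = cmod (\<tau> x)"
  shows "\<tau> = \<sigma> \<or> \<tau> = (\<lambda>x. cnj (\<sigma> x))"
proof -
  have pt: "\<tau> x = \<sigma> x \<or> \<tau> x = cnj (\<sigma> x)" for x
  proof -
    have 1: "Re (\<sigma> x) ^ 2 + Im (\<sigma> x) ^ 2 = Re (\<tau> x) ^ 2 + Im (\<tau> x) ^ 2"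
      using eq[of x] by (simp add: cmod_power2[symmetric])
    \<comment> \<open>The moduli at \<open>x\<close> and at x + 1 together determine the real
      part.\<close>
    have "(Re (\<sigma> x) + 1) ^ 2 + Im (\<sigma> x) ^ 2 = (Re (\<tau> x) + 1) ^ 2 + Im (\<tau> x) ^ 2"
    proof -
      have "cmod (\<sigma> x + 1) ^ 2 = cmod (\<tau> x + 1) ^ 2"
        using eq[of "x + 1"] by (simp add: emb_add[OF \<sigma>] emb_add[OF \<tau>] emb_1[OF \<sigma>] emb_1[OF \<tau>])
      then show ?thesis by (simp add: cmod_power2)
    qed
    then have re: "Re (\<sigma> x) = Re (\<tau> x)" using 1 by (simp add: power2_eq_square algebra_simps)
    then have "Im (\<tau> x) = Im (\<sigma> x) \<or> Im (\<tau> x) = - Im (\<sigma> x)" using 1 by (simp add: power2_eq_iff) argo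
    then show ?thesis using re by (auto simp: complex_eq_iff)
  qed
  show ?thesis
  proof (rule ccontr)
    assume "\<not> ?thesis"
    \<comment> \<open>The choice between identity and conjugation is uniform: two proper additive
      subgroups never cover the whole group.\<close>
    then obtain x y where x: "\<tau> x \<noteq> \<sigma> x" and y: "\<tau> y \<noteq> cnj (\<sigma> y)" by fastforce
    have x': "\<tau> x = cnj (\<sigma> x)" and y': "\<tau> y = \<sigma> y" using pt x y by blast+
    have "\<tau> (x + y) = \<tau> x + \<tau> y" "\<sigma> (x + y) = \<sigma> x + \<sigma> y"
      by (rule emb_add[OF \<tau>], rule emb_add[OF \<sigma>])
    then show False using pt[of "x + y"] x y x' y' by auto
  qed
qed

lemma emb_absolute_value:
  assumes "field_embedding \<sigma>" shows "absolute_value (\<lambda>x. cmod (\<sigma> x))"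
  unfolding absolute_value_def
  using emb_eq_0_iff[OF assms] emb_mult[OF assms] emb_add[OF assms] norm_triangle_ineq
  by (auto simp: norm_mult)

lemma rat_approx_real:
  fixes r e :: real
  assumes "e > 0" obtains q :: rat where "\<bar>r - of_rat q\<bar> < e"
proof -
  obtain x where x: "x \<in> \<rat>" "r - e < x" "x < r + e" using Rats_dense_in_real[of "r - e" "r + e"] assms by auto
  from x(1) obtain q :: rat where "x = of_rat q" by (rule Rats_cases)
  then show thesis using that[of q] x by (simp add: abs_less_iff)
qed

text \<open>Local bases are \<open>[1]\<close> for a real embedding and \<open>[y0, 1]\<close> with
  a non-real value of \<open>y0\<close> otherwise. Density comes from the density of the rationals
  in the reals; the imaginary part keeps \<open>y0\<close> away from the rationals.\<close>

lemma local_degree_arch: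
  fixes \<sigma> :: "'k::field_char_0 \<Rightarrow> complex"
  assumes \<sigma>: "field_embedding \<sigma>"
  shows "local_degree (\<lambda>x. cmod (\<sigma> x)) = (if \<forall>x. Im (\<sigma> x) = 0 then 1 else 2)"
proof -
  let ?w = "\<lambda>x. cmod (\<sigma> x)"
  interpret w: abs_val ?w by unfold_locales (rule emb_absolute_value[OF \<sigma>])
  have cof: "(of_rat q :: complex) = of_real (of_rat q)" for q
    by (cases q) (simp add: of_rat_rat)
  have wi1: "w.well_indep 1 [1]"
    unfolding w.well_indep_def
  proof (intro conjI allI impI ballI)
    fix qs :: "'k list" and q assume "q \<in> set (take (length [1]) qs)"
    then show "1 * ?w q \<le> ?w (rlin qs [1])" by (cases qs) auto
  qed simp
  show ?thesis
  proof (cases "\<forall>x. Im (\<sigma> x) = 0")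
    case True
    have "w.dense_list [1]" unfolding w.dense_list_def
    proof (intro allI impI)
      fix y and e :: real assume "e > 0"
      then obtain q where q: "\<bar>Re (\<sigma> y) - of_rat q\<bar> < e" by (rule rat_approx_real)
      have "\<sigma> (y - of_rat q) = of_real (Re (\<sigma> y) - of_rat q)"
        using emb_add[OF \<sigma>, of y "- of_rat q"] True
        by (simp add: emb_uminus[OF \<sigma>] emb_of_rat[OF \<sigma>] cof complex_eq_iff)
      then have "?w (y - rlin [of_rat q] [1]) < e" using q by (simp del: of_real_diff)
      then show "\<exists>qs. set qs \<subseteq> \<rat> \<and> ?w (y - rlin qs [1]) < e" by (intro exI[of _ "[of_rat q]"]) auto
    qed
    then show ?thesis using w.local_degree_eq[OF wi1] True by simp
  next
    case False
    then obtain y0 where y0: "Im (\<sigma> y0) \<noteq> 0" by blast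
    define t where "t = Im (\<sigma> y0)"
    have "\<exists>c. w.well_indep c [y0, 1]"
    proof (rule w.well_indep_extend[OF wi1])
      show "\<bar>t\<bar> > 0" using y0 by (simp add: t_def)
      fix qs :: "'k list" assume qs: "set qs \<subseteq> \<rat>"
      obtain q where q: "rlin qs [1] = of_rat q"
      proof (cases qs)
        case (Cons a as)
        then show ?thesis using qs that by (auto elim!: Rats_cases)
      qed (use that[of 0] in simp)
      have "Im (\<sigma> (y0 - rlin qs [1])) = t"
        using emb_add[OF \<sigma>, of y0 "- of_rat q"] unfolding q
        by (simp add: emb_uminus[OF \<sigma>] emb_of_rat[OF \<sigma>] cof t_def)
      then show "\<bar>t\<bar> \<le> ?w (y0 - rlin qs [1])" using abs_Im_le_cmod[of "\<sigma> (y0 - rlin qs [1])"] by simp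
    qed
    then obtain c where c: "w.well_indep c [y0, 1]" by blast
    have "w.dense_list [y0, 1]" unfolding w.dense_list_def
    proof (intro allI impI)
      fix y and e :: real assume e: "e > 0"
      define B where "B = Im (\<sigma> y) / t"
      define A where "A = Re (\<sigma> y) - B * Re (\<sigma> y0)"
      have dec: "\<sigma> y = of_real A + of_real B * \<sigma> y0"
        using y0 by (simp add: complex_eq_iff A_def B_def t_def)
      have m: "cmod (\<sigma> y0) + 1 > 0" using norm_ge_zero[of "\<sigma> y0"] by linarith
      obtain q1 where q1: "\<bar>B - of_rat q1\<bar> < e / (2 * (cmod (\<sigma> y0) + 1))"
        using rat_approx_real[of "e / (2 * (cmod (\<sigma> y0) + 1))" B] e m by auto
      obtain q0 where q0: "\<bar>A - of_rat q0\<bar> < e / 2" using rat_approx_real[of "e / 2" A] e by auto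
      have "\<sigma> (y - (of_rat q1 * y0 + of_rat q0)) = of_real (A - of_rat q0) + of_real (B - of_rat q1) * \<sigma> y0"
        by (simp add: emb_diff[OF \<sigma>] emb_add[OF \<sigma>] emb_mult[OF \<sigma>] emb_of_rat[OF \<sigma>] dec cof algebra_simps)
      then have "?w (y - (of_rat q1 * y0 + of_rat q0)) \<le> \<bar>A - of_rat q0\<bar> + \<bar>B - of_rat q1\<bar> * cmod (\<sigma> y0)"
        using norm_triangle_ineq[of "of_real (A - of_rat q0)" "of_real (B - of_rat q1) * \<sigma> y0"]
        by (simp add: norm_mult del: of_real_diff)
      also have "\<bar>B - of_rat q1\<bar> * cmod (\<sigma> y0) \<le> \<bar>B - of_rat q1\<bar> * (cmod (\<sigma> y0) + 1)"
        by (intro mult_left_mono) auto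
      also have "\<dots> < e / 2" using q1 m by (simp add: field_simps)
      finally have "?w (y - rlin [of_rat q1, of_rat q0] [y0, 1]) < e" using q0 by simp
      then show "\<exists>qs. set qs \<subseteq> \<rat> \<and> ?w (y - rlin qs [y0, 1]) < e"
        by (intro exI[of _ "[of_rat q1, of_rat q0]"]) auto
    qed
    then show ?thesis using w.local_degree_eq[OF c] False by simp
  qed
qed

lemma card_place_embeddings:
  assumes \<sigma>: "field_embedding (\<sigma> :: 'k::field_char_0 \<Rightarrow> complex)"
  shows "card {\<tau>\<in>embeddings. (\<lambda>x. cmod (\<tau> x)) = (\<lambda>x. cmod (\<sigma> x))} = local_degree (\<lambda>x. cmod (\<sigma> x))"
proof -
  have cj: "field_embedding (\<lambda>x. cnj (\<sigma> x))"
    using \<sigma> by (auto simp: field_embedding_def)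
  have "{\<tau>\<in>embeddings. (\<lambda>x. cmod (\<tau> x)) = (\<lambda>x. cmod (\<sigma> x))} = {\<sigma>, (\<lambda>x. cnj (\<sigma> x))}"
    using embeddings_cnj_cases[OF \<sigma>] \<sigma> cj by (auto simp: embeddings_def fun_eq_iff) metis
  moreover have "\<sigma> = (\<lambda>x. cnj (\<sigma> x)) \<longleftrightarrow> (\<forall>x. Im (\<sigma> x) = 0)"
    by (auto simp: fun_eq_iff complex_eq_iff)
  ultimately show ?thesis by (auto simp: local_degree_arch[OF \<sigma>] card_insert_if)
qed

lemma arch_places_embeddings: "arch_places = (\<lambda>\<sigma> x. cmod (\<sigma> x)) ` embeddings"
  by (auto simp: arch_places_def embeddings_def)

lemma finite_arch_places:
  assumes "number_field TYPE('k::field_char_0)"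
  shows "finite (arch_places :: ('k \<Rightarrow> real) set)"
  unfolding arch_places_embeddings using embeddings_primitive[OF assms] by (metis finite_imageI)

text \<open>Grouping the embeddings by the absolute value they induce; by
  \<open>card_place_embeddings\<close> the size of a group is the local degree.\<close>

lemma prod_embeddings_arch:
  assumes nf: "number_field TYPE('k::field_char_0)"
  shows "(\<Prod>\<sigma>\<in>embeddings. h (\<lambda>x::'k. cmod (\<sigma> x))) = (\<Prod>v\<in>arch_places. (h v :: real) ^ local_degree v)"
proof -
  have fin: "finite (embeddings :: ('k \<Rightarrow> complex) set)" using embeddings_primitive[OF nf] by metis
  have "(\<Prod>\<sigma>\<in>embeddings. h (\<lambda>x::'k. cmod (\<sigma> x)))
     = (\<Prod>v\<in>arch_places. \<Prod>\<sigma>\<in>{\<sigma>\<in>embeddings. (\<lambda>x. cmod (\<sigma> x)) = v}. h (\<lambda>x. cmod (\<sigma> x)))"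
    unfolding arch_places_embeddings by (rule prod.image_gen[OF fin])
  also have "\<dots> = (\<Prod>v\<in>arch_places. h v ^ local_degree v)"
  proof (rule prod.cong[OF refl])
    fix v :: "'k \<Rightarrow> real" assume "v \<in> arch_places"
    then obtain \<tau> where \<tau>: "field_embedding \<tau>" "v = (\<lambda>x. cmod (\<tau> x))"
      by (auto simp: arch_places_def)
    have "(\<Prod>\<sigma>\<in>{\<sigma>\<in>embeddings. (\<lambda>x. cmod (\<sigma> x)) = v}. h (\<lambda>x. cmod (\<sigma> x)))
        = (\<Prod>\<sigma>\<in>{\<sigma>\<in>embeddings. (\<lambda>x. cmod (\<sigma> x)) = v}. h v)"
      by (intro prod.cong) auto
    also have "\<dots> = h v ^ local_degree v" using card_place_embeddings[OF \<tau>(1)] \<tau>(2) by simp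
    finally show "(\<Prod>\<sigma>\<in>{\<sigma>\<in>embeddings. (\<lambda>x. cmod (\<sigma> x)) = v}. h (\<lambda>x. cmod (\<sigma> x))) = h v ^ local_degree v" .
  qed
  finally show ?thesis .
qed

lemma arch_place_props:
  assumes "v \<in> arch_places"
  shows "absolute_value v" and "local_degree v > 0" and "v (of_nat k) = real k"
proof -
  obtain \<sigma> where \<sigma>: "field_embedding \<sigma>" "v = (\<lambda>x. cmod (\<sigma> x))" using assms by (auto simp: arch_places_def)
  show "absolute_value v" "local_degree v > 0" "v (of_nat k) = real k"
    using emb_absolute_value[OF \<sigma>(1)] local_degree_arch[OF \<sigma>(1)] \<sigma>(2) by (auto simp: emb_of_nat[OF \<sigma>(1)])
qed

lemma nf_degree_pos:
  assumes "number_field TYPE('k::field_char_0)" shows "nf_degree TYPE('k) > 0"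
  using number_field_basis[OF assms] nf_basis.n_pos by metis

text \<open>Inserting the constant function 2 into \<open>prod_embeddings_arch\<close> turns the
  count of embeddings into a comparison of exponents.\<close>

lemma sum_local_degree_arch:
  assumes nf: "number_field TYPE('k::field_char_0)"
  shows "(\<Sum>v\<in>(arch_places :: ('k \<Rightarrow> real) set). local_degree v) = nf_degree TYPE('k)"
proof -
  have "(2::real) ^ nf_degree TYPE('k) = (\<Prod>\<sigma>\<in>(embeddings :: ('k \<Rightarrow> complex) set). 2)"
    using embeddings_primitive[OF nf] by (metis prod_constant)
  also have "\<dots> = 2 ^ (\<Sum>v\<in>(arch_places :: ('k \<Rightarrow> real) set). local_degree v)"
    using prod_embeddings_arch[OF nf, of "\<lambda>_. 2"] by (simp add: power_sum)
  finally show ?thesis by simp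
qed

lemma prod_place_norm_arch:
  assumes nf: "number_field TYPE('k::field_char_0)"
  shows "(\<Prod>v\<in>arch_places. place_norm v (x::'k)) ^ nf_degree TYPE('k) = (\<Prod>\<sigma>\<in>embeddings. cmod (\<sigma> x))"
proof -
  have "place_norm v x ^ nf_degree TYPE('k) = v x ^ local_degree v" if "v \<in> arch_places" for v
  proof -
    interpret abs_val v by unfold_locales (rule arch_place_props(1)[OF that])
    have "place_norm v x ^ nf_degree TYPE('k) = v x powr (real (local_degree v))" if "v x > 0"
      unfolding place_norm_def using that nf_degree_pos[OF nf]
      by (simp add: powr_realpow[symmetric] powr_powr)
    then show ?thesis
      using arch_place_props(2)[OF that] nf_degree_pos[OF nf]
      by (cases "x = 0") (auto simp: place_norm_def powr_realpow zero_power)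
  qed
  then show ?thesis
    using prod_embeddings_arch[OF nf, of "\<lambda>v. v x"] by (simp add: prod_power_distrib)
qed

section \<open>Size of the approximations\<close>

context abs_val
begin

text \<open>The l1 norm of the coefficients after rescaling the variable by \<open>M\<close>. It is
  submultiplicative, so a product of linear factors is bounded by the product of the values
  \<open>w (a j) + M\<close>.\<close>

definition weighted :: "real \<Rightarrow> 'k poly \<Rightarrow> real" where
  "weighted M p = (\<Sum>i\<le>degree p. w (coeff p i) * M ^ i)"

lemma weighted_eq_sum: "degree p \<le> N \<Longrightarrow> weighted M p = (\<Sum>i\<le>N. w (coeff p i) * M ^ i)"
  unfolding weighted_def by (rule sum.mono_neutral_left) (auto simp: coeff_eq_0)

lemma weighted_nonneg: "M \<ge> 0 \<Longrightarrow> weighted M p \<ge> 0"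
  unfolding weighted_def by (intro sum_nonneg) simp

lemma weighted_pCons: "weighted M (pCons a p) = w a + M * weighted M p"
proof -
  have "weighted M (pCons a p) = (\<Sum>i\<le>Suc (degree p). w (coeff (pCons a p) i) * M ^ i)"
    by (rule weighted_eq_sum) (rule degree_pCons_le)
  also have "\<dots> = w a + M * weighted M p"
    by (subst sum.atMost_Suc_shift) (simp add: weighted_def sum_distrib_left mult_ac)
  finally show ?thesis .
qed

lemma weighted_add:
  assumes "M \<ge> 0" shows "weighted M (p + q) \<le> weighted M p + weighted M q"
proof -
  let ?N = "max (degree p) (degree q)"
  have "degree (p + q) \<le> ?N" by (rule degree_add_le_max)
  then show ?thesis using assms
    by (simp add: weighted_eq_sum[of _ ?N] sum.distrib[symmetric] distrib_right[symmetric])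
      (intro sum_mono mult_right_mono triangle, auto)
qed

lemma weighted_smult: "weighted M (Polynomial.smult a p) = w a * weighted M p"
  by (subst weighted_eq_sum[of _ "degree p"])
    (auto simp: weighted_def mult sum_distrib_left mult.assoc intro: degree_smult_le)

lemma weighted_mult:
  assumes M: "M \<ge> 0" shows "weighted M (p * q) \<le> weighted M p * weighted M q"
proof (induction p rule: pCons_induct)
  case 0
  show ?case by (simp add: weighted_def)
next
  case (pCons a p)
  have "weighted M (pCons a p * q) \<le> w a * weighted M q + M * weighted M (p * q)"
    using weighted_add[OF M, of "Polynomial.smult a q" "pCons 0 (p * q)"]
    by (simp add: weighted_smult weighted_pCons)
  also have "\<dots> \<le> w a * weighted M q + M * (weighted M p * weighted M q)"
    using mult_left_mono[OF pCons.IH M] by simp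
  finally show ?case by (simp add: weighted_pCons algebra_simps)
qed

lemma weighted_node_poly:
  assumes M: "M \<ge> 0"
  shows "weighted M (node_poly m a (\<lambda>_. r)) \<le> (\<Prod>j\<in>{1..m}. w (a j) + M) ^ r"
proof -
  have pow: "weighted M ([:- c, 1:] ^ k) \<le> (w c + M) ^ k" for c k
  proof (induction k)
    case (Suc k)
    have "weighted M ([:- c, 1:] ^ Suc k) \<le> weighted M [:- c, 1:] * weighted M ([:- c, 1:] ^ k)"
      unfolding power_Suc by (rule weighted_mult[OF M])
    also have "weighted M [:- c, 1:] = w c + M" by (simp add: weighted_pCons weighted_def)
    also have "(w c + M) * weighted M ([:- c, 1:] ^ k) \<le> (w c + M) * (w c + M) ^ k"
      using M by (intro mult_left_mono Suc) auto
    finally show ?case by simp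
  qed (simp add: weighted_def)
  have "weighted M (\<Prod>j\<in>A. [:- a j, 1:] ^ r) \<le> (\<Prod>j\<in>A. (w (a j) + M) ^ r)" if "finite A" for A
    using that
  proof (induction A rule: finite_induct)
    case (insert j A)
    have "weighted M (\<Prod>j\<in>insert j A. [:- a j, 1:] ^ r)
        \<le> weighted M ([:- a j, 1:] ^ r) * weighted M (\<Prod>j\<in>A. [:- a j, 1:] ^ r)"
      unfolding prod.insert[OF insert(1,2)] by (rule weighted_mult[OF M])
    also have "\<dots> \<le> (w (a j) + M) ^ r * (\<Prod>j\<in>A. (w (a j) + M) ^ r)"
      using M by (intro mult_mono pow insert.IH weighted_nonneg) auto
    finally show ?case using insert by simp
  qed (simp add: weighted_def)
  then show ?thesis unfolding node_poly_def by (simp add: prod_power_distrib)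
qed

lemma sum_le_w: "w (sum f A) \<le> (\<Sum>i\<in>A. w (f i))"
proof (induction A rule: infinite_finite_induct)
  case (insert x A)
  then show ?case using triangle[of "f x" "sum f A"] by simp
qed auto

text \<open>Each truncated form has one constant term and at most \<open>m * (m * r + n)\<close>
  further terms; after multiplication by the quotient of factorials, each factorial in them is at
  most \<open>fact (m * r + n)\<close>. The powers of the nodes are absorbed by M^(i + n), and the
  sum over \<open>i\<close> becomes a \<open>weighted\<close> norm.\<close>

lemma pade_value_arch_bound:
  assumes nat: "\<And>k. w (of_nat k) = real k" and M: "M \<ge> 1" "\<And>j. j \<in> {1..m} \<Longrightarrow> w (a j) \<le> M"
    and \<Lambda>: "\<And>i. i \<in> {0..m} \<Longrightarrow> w (l i) \<le> \<Lambda>"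
  shows "w (pade_value m r l a n) \<le>
    fact (m * r + n) * (1 + real m * real (m * r + n)) * \<Lambda> * M ^ n * (\<Prod>j\<in>{1..m}. w (a j) + M) ^ r"
proof -
  define L where "L = m * r"
  define F :: real where "F = fact (L + n)"
  define P where "P = node_poly m a (\<lambda>_. r)"
  define G where "G = 1 + real m * real (L + n)"
  have "w (l 0) \<le> \<Lambda>" by (rule \<Lambda>) simp
  then have \<Lambda>0: "\<Lambda> \<ge> 0" using nonneg[of "l 0"] by linarith
  have degP: "degree P = L" by (simp add: P_def L_def degree_node_poly)
  have form: "real (fact (L + n) div fact k) * w (partial_form m l a k) \<le> F * G * \<Lambda> * M ^ k" if k: "k \<le> L + n" for k
  proof -
    have Q: "real (fact (L + n) div fact k) = F / fact k"
      using of_nat_fact_div[OF k, where ?'a = real] by (simp add: F_def)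
    have Fk: "F / fact k * fact h \<le> F" if "h \<le> k" for h
    proof -
      have "(fact h :: real) \<le> fact k" using that by (rule fact_mono)
      moreover have "F \<ge> 0" by (simp add: F_def)
      ultimately show ?thesis by (simp add: field_simps mult_left_mono)
    qed
    have "w (partial_form m l a k) \<le> w (l 0) + (\<Sum>j\<in>{1..m}. w (l j * (\<Sum>h<k. of_nat (fact h) * a j ^ h)))"
      unfolding partial_form_def by (intro order_trans[OF triangle] add_left_mono sum_le_w)
    also have "\<dots> \<le> \<Lambda> + (\<Sum>j\<in>{1..m}. \<Lambda> * (\<Sum>h<k. fact h * M ^ k))"
    proof (intro add_mono sum_mono \<Lambda>)
      fix j assume j: "j \<in> {1..m}"
      have "w (\<Sum>h<k. of_nat (fact h) * a j ^ h) \<le> (\<Sum>h<k. w (of_nat (fact h) * a j ^ h))" by (rule sum_le_w)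
      also have "\<dots> \<le> (\<Sum>h<k. fact h * M ^ k)"
      proof (intro sum_mono)
        fix h assume h: "h \<in> {..<k}"
        have "w (a j) ^ h \<le> M ^ h" using M(2)[OF j] by (intro power_mono) auto
        also have "\<dots> \<le> M ^ k" using M(1) h by (intro power_increasing) auto
        finally show "w (of_nat (fact h) * a j ^ h) \<le> fact h * M ^ k"
          unfolding mult power nat by (simp add: mult_left_mono)
      qed
      finally show "w (l j * (\<Sum>h<k. of_nat (fact h) * a j ^ h)) \<le> \<Lambda> * (\<Sum>h<k. fact h * M ^ k)"
        unfolding mult using \<Lambda>[of j] j \<Lambda>0 by (intro mult_mono) auto
    qed auto
    finally have "F / fact k * w (partial_form m l a k) \<le> F / fact k * (\<Lambda> + (\<Sum>j\<in>{1..m}. \<Lambda> * (\<Sum>h<k. fact h * M ^ k)))"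
      by (intro mult_left_mono) (auto simp: F_def)
    also have "\<dots> = \<Lambda> * (F / fact k * fact 0 + real m * (\<Sum>h<k. (F / fact k * fact h) * M ^ k))"
      by (simp add: algebra_simps sum_distrib_left sum_distrib_right)
    also have "\<dots> \<le> \<Lambda> * (F + real m * (\<Sum>h<k. F * M ^ k))"
      using M by (intro mult_left_mono[OF _ \<Lambda>0] add_mono mult_left_mono sum_mono mult_right_mono Fk) auto
    also have "\<dots> = \<Lambda> * F * (1 + real m * real k * M ^ k)" by (simp add: algebra_simps)
    also have "\<dots> \<le> \<Lambda> * F * (G * M ^ k)"
    proof (intro mult_left_mono)
      have Mk: "M ^ k \<ge> 1" using M(1) by (rule one_le_power)
      have "real m * real k * M ^ k \<le> real m * real (L + n) * M ^ k"
        using k Mk by (intro mult_right_mono mult_left_mono) auto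
      then show "1 + real m * real k * M ^ k \<le> G * M ^ k" using Mk by (simp add: G_def distrib_right)
    qed (use \<Lambda>0 in \<open>auto simp: F_def\<close>)
    finally show ?thesis unfolding Q by (simp add: mult_ac)
  qed
  have "w (pade_value m r l a n) \<le> (\<Sum>i\<le>L. w (pade_weight m r a n i * partial_form m l a (i + n)))"
    unfolding pade_value_def L_def by (rule sum_le_w)
  also have "\<dots> \<le> (\<Sum>i\<le>L. F * G * \<Lambda> * M ^ n * (w (coeff P i) * M ^ i))"
  proof (intro sum_mono)
    fix i assume "i \<in> {..L}"
    then have "w (coeff P i) * (real (fact (L + n) div fact (i + n)) * w (partial_form m l a (i + n)))
        \<le> w (coeff P i) * (F * G * \<Lambda> * M ^ (i + n))"
      by (intro mult_left_mono form) auto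
    then show "w (pade_weight m r a n i * partial_form m l a (i + n)) \<le> F * G * \<Lambda> * M ^ n * (w (coeff P i) * M ^ i)"
      unfolding pade_weight_def mult nat P_def[symmetric] L_def[symmetric] by (simp add: power_add mult_ac)
  qed
  also have "\<dots> = F * G * \<Lambda> * M ^ n * weighted M P"
    by (simp add: weighted_def degP sum_distrib_left)
  also have "\<dots> \<le> F * G * \<Lambda> * M ^ n * (\<Prod>j\<in>{1..m}. w (a j) + M) ^ r"
    unfolding P_def using M \<Lambda>0
    by (intro mult_left_mono weighted_node_poly mult_nonneg_nonneg) (auto simp: F_def G_def)
  finally show ?thesis by (simp add: F_def G_def L_def)
qed

end

text \<open>After scaling to x + y = 1 this is u <= u powr t on the unit interval. The constant
  \<open>c1\<close> adds normalised values, whereas \<open>pade_value_arch_bound\<close> adds the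
  values themselves.\<close>

lemma powr_add_le:
  fixes x y t :: real
  assumes "x \<ge> 0" "y \<ge> 0" "0 < t" "t \<le> 1"
  shows "(x + y) powr t \<le> x powr t + y powr t"
proof (cases "x + y = 0")
  case False
  define s where "s = x + y"
  have s: "s > 0" using False assms by (simp add: s_def)
  have ge: "u \<le> u powr t" if "0 \<le> u" "u \<le> 1" for u
  proof (cases "u = 0")
    case False
    then show ?thesis using that assms powr_mono'[of t 1 u] by simp
  qed (use assms in auto)
  have "1 = x / s + y / s" using False by (simp add: s_def add_divide_distrib[symmetric])
  also have "\<dots> \<le> (x / s) powr t + (y / s) powr t"
  proof (intro add_mono ge)
    show "x / s \<le> 1" "y / s \<le> 1" using assms s by (simp_all add: divide_le_eq_1_pos) (simp_all add: s_def)
  qed (use assms s in auto)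
  also have "\<dots> = (x powr t + y powr t) / s powr t"
    using assms s by (simp add: powr_divide add_divide_distrib)
  finally have "1 \<le> (x powr t + y powr t) / s powr t" .
  moreover have "s powr t > 0" using s by simp
  ultimately have "s powr t \<le> x powr t + y powr t" by (simp add: pos_le_divide_eq)
  then show ?thesis by (simp add: s_def)
qed (use assms in auto)

lemma place_norm_pade_value:
  fixes l a :: "nat \<Rightarrow> 'k::field_char_0"
  assumes nf: "number_field TYPE('k)" and v: "v \<in> arch_places" and n: "n \<le> m"
  defines "t \<equiv> real (local_degree v) / real (nf_degree TYPE('k))"
    and "Mn \<equiv> Max (insert 1 ((\<lambda>j. place_norm v (a j)) ` {1..m}))"
    and "\<Lambda>n \<equiv> Max ((\<lambda>i. place_norm v (l i)) ` {0..m})"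
  shows "place_norm v (pade_value m r l a n) \<le>
    (fact (m * r + n) * (1 + real m * real (m * r + n))) powr t * \<Lambda>n * Mn ^ m * (\<Prod>j\<in>{1..m}. place_norm v (a j) + Mn) ^ r"
proof -
  interpret abs_val v by unfold_locales (rule arch_place_props(1)[OF v])
  have n0: "nf_degree TYPE('k) > 0" by (rule nf_degree_pos[OF nf])
  have "local_degree v \<le> nf_degree TYPE('k)"
    using member_le_sum[of v arch_places local_degree] finite_arch_places[OF nf] v sum_local_degree_arch[OF nf] by simp
  then have t: "t > 0" "t \<le> 1" using arch_place_props(2)[OF v] n0 by (auto simp: t_def)
  have pn: "place_norm v x = v x powr t" for x by (simp add: place_norm_def t_def)
  have inv: "v x = place_norm v x powr (1 / t)" for x
    using t by (simp add: pn powr_powr)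
  have "1 \<le> Mn" unfolding Mn_def by (intro Max_ge) auto
  moreover have "place_norm v (a j) \<le> Mn" if "j \<in> {1..m}" for j
    unfolding Mn_def by (intro Max_ge) (use that in auto)
  ultimately have Mn: "Mn \<ge> 1" "\<And>j. j \<in> {1..m} \<Longrightarrow> place_norm v (a j) \<le> Mn" by blast+
  have \<Lambda>n: "place_norm v (l i) \<le> \<Lambda>n" if "i \<in> {0..m}" for i
    unfolding \<Lambda>n_def by (intro Max_ge) (use that in auto)
  have \<Lambda>n0: "\<Lambda>n \<ge> 0" using \<Lambda>n[of 0] by (simp add: pn order_trans[OF powr_ge_zero])
  \<comment> \<open>The maxima of the normalised values are transported back to \<open>v\<close> by
    the exponent 1/t; raising the final bound to the power \<open>t\<close> then restores the maxima
    that occur in \<open>c1\<close> and in the bound by \<open>H\<close>.\<close>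
  define M where "M = Mn powr (1 / t)"
  define \<Lambda> where "\<Lambda> = \<Lambda>n powr (1 / t)"
  have M1: "M \<ge> 1" unfolding M_def using Mn(1) t by (intro ge_one_powr_ge_zero) auto
  have Mt: "M powr t = Mn" using Mn(1) t by (simp add: M_def powr_powr)
  have \<Lambda>t: "\<Lambda> powr t = \<Lambda>n" using \<Lambda>n0 t by (simp add: \<Lambda>_def powr_powr)
  have \<Lambda>0: "\<Lambda> \<ge> 0" by (simp add: \<Lambda>_def)
  define F :: real where "F = fact (m * r + n) * (1 + real m * real (m * r + n))"
  have F0: "F \<ge> 0" by (simp add: F_def)
  have "v (pade_value m r l a n) \<le> F * \<Lambda> * M ^ n * (\<Prod>j\<in>{1..m}. v (a j) + M) ^ r"
    unfolding F_def
  proof (rule pade_value_arch_bound)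
    show "v (of_nat k) = real k" for k by (rule arch_place_props(3)[OF v])
    show "v (a j) \<le> M" if "j \<in> {1..m}" for j
      unfolding inv[of "a j"] M_def using Mn(2)[OF that] t by (intro powr_mono2) (auto simp: pn)
    show "v (l i) \<le> \<Lambda>" if "i \<in> {0..m}" for i
      unfolding inv[of "l i"] \<Lambda>_def using \<Lambda>n[OF that] t by (intro powr_mono2) (auto simp: pn)
  qed (rule M1)
  then have "v (pade_value m r l a n) powr t \<le> (F * \<Lambda> * M ^ n * (\<Prod>j\<in>{1..m}. v (a j) + M) ^ r) powr t"
    using t by (intro powr_mono2) auto
  also have "\<dots> = F powr t * \<Lambda>n * (M ^ n) powr t * ((\<Prod>j\<in>{1..m}. v (a j) + M) ^ r) powr t"
    using F0 \<Lambda>0 M1 by (simp add: powr_mult \<Lambda>t prod_nonneg)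
  also have "(M ^ n) powr t = Mn ^ n"
    using M1 by (simp add: Mt[symmetric] powr_realpow[symmetric] powr_powr mult.commute)
  also have "((\<Prod>j\<in>{1..m}. v (a j) + M) ^ r) powr t = (\<Prod>j\<in>{1..m}. (v (a j) + M) powr t) ^ r"
  proof -
    have pos: "v (a j) + M > 0" for j using M1 nonneg[of "a j"] by linarith
    have "(\<Prod>j\<in>{1..m}. v (a j) + M) > 0" using pos by (intro prod_pos) auto
    moreover have "(P ^ r) powr t = (P powr t) ^ r" if "P > 0" for P :: real
      using that by (simp add: powr_realpow[symmetric] powr_powr mult.commute)
    ultimately have "((\<Prod>j\<in>{1..m}. v (a j) + M) ^ r) powr t = ((\<Prod>j\<in>{1..m}. v (a j) + M) powr t) ^ r"
      by blast
    also have "(\<Prod>j\<in>{1..m}. v (a j) + M) powr t = (\<Prod>j\<in>{1..m}. (v (a j) + M) powr t)"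
      by (rule prod_powr_distrib)
    finally show ?thesis .
  qed
  also have "F powr t * \<Lambda>n * Mn ^ n * (\<Prod>j\<in>{1..m}. (v (a j) + M) powr t) ^ r
      \<le> F powr t * \<Lambda>n * Mn ^ m * (\<Prod>j\<in>{1..m}. place_norm v (a j) + Mn) ^ r"
  proof (intro mult_mono power_mono prod_mono conjI)
    show "Mn ^ n \<le> Mn ^ m" using Mn(1) n by (intro power_increasing)
    fix j
    show "(v (a j) + M) powr t \<le> place_norm v (a j) + Mn"
      using powr_add_le[of "v (a j)" M t] M1 t by (simp add: pn Mt)
  qed (use \<Lambda>n0 Mn(1) in \<open>auto intro!: prod_nonneg mult_nonneg_nonneg zero_le_power\<close>)
  finally show ?thesis by (simp add: pn F_def)
qed

lemma prod_place_norm_pade_value: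
  fixes l a :: "nat \<Rightarrow> 'k::field_char_0"
  assumes nf: "number_field TYPE('k)" and n: "n \<le> m" and r: "r > 0"
    and H: "(\<Prod>v\<in>arch_places. Max ((\<lambda>i. place_norm v (l i)) ` {0..m})) \<le> H"
  shows "(\<Prod>v\<in>arch_places. place_norm v (pade_value m r l a n))
    \<le> fact (m * r + n) * (1 + real m * real (m * r + n)) * H * c1 m a ^ r"
proof -
  define F :: real where "F = fact (m * r + n) * (1 + real m * real (m * r + n))"
  have F: "F > 0" unfolding F_def by (intro mult_pos_pos) (auto simp: add_pos_nonneg)
  define t where "t v = real (local_degree v) / real (nf_degree TYPE('k))" for v :: "'k \<Rightarrow> real"
  define Mn where "Mn v = Max (insert 1 ((\<lambda>j. place_norm v (a j)) ` {1..m}))" for v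
  define \<Lambda>n where "\<Lambda>n v = Max ((\<lambda>i. place_norm v (l i)) ` {0..m})" for v
  define Q where "Q v = (\<Prod>j\<in>{1..m}. place_norm v (a j) + Mn v)" for v
  have pn0: "place_norm v x \<ge> 0" for v and x :: 'k by (simp add: place_norm_def)
  have Mn1: "Mn v \<ge> 1" for v unfolding Mn_def by (intro Max_ge) auto
  have \<Lambda>n0: "\<Lambda>n v \<ge> 0" for v
  proof -
    have "place_norm v (l 0) \<le> \<Lambda>n v" unfolding \<Lambda>n_def by (intro Max_ge) auto
    then show ?thesis using pn0[of v "l 0"] by linarith
  qed
  have Q0: "Q v \<ge> 0" for v unfolding Q_def using Mn1[of v] pn0 by (intro prod_nonneg ballI add_nonneg_nonneg) auto
  have "(\<Prod>v\<in>arch_places. place_norm v (pade_value m r l a n))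
      \<le> (\<Prod>v\<in>arch_places. F powr t v * \<Lambda>n v * (Mn v ^ m * Q v) ^ r)"
  proof (intro prod_mono conjI)
    fix v :: "'k \<Rightarrow> real" assume v: "v \<in> arch_places"
    show "0 \<le> place_norm v (pade_value m r l a n)" by (rule pn0)
    have "place_norm v (pade_value m r l a n) \<le> F powr t v * \<Lambda>n v * Mn v ^ m * Q v ^ r"
      using place_norm_pade_value[OF nf v n, of r l a]
      by (simp add: F_def t_def Mn_def \<Lambda>n_def Q_def)
    also have "\<dots> \<le> F powr t v * \<Lambda>n v * (Mn v ^ m) ^ r * Q v ^ r"
    proof (intro mult_right_mono mult_left_mono)
      \<comment> \<open>Wasteful, but it brings the bound into the form of the \<open>r\<close>-th
        power of a factor of \<open>c1\<close>.\<close>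
      show "Mn v ^ m \<le> (Mn v ^ m) ^ r" using one_le_power[OF Mn1, of v m] r by (intro self_le_power) auto
    qed (use \<Lambda>n0 Q0 in auto)
    finally show "place_norm v (pade_value m r l a n) \<le> F powr t v * \<Lambda>n v * (Mn v ^ m * Q v) ^ r"
      by (simp add: power_mult_distrib mult.assoc)
  qed
  also have "\<dots> = (\<Prod>v\<in>arch_places. F powr t v) * (\<Prod>v\<in>arch_places. \<Lambda>n v) * c1 m a ^ r"
  proof -
    have "c1 m a = (\<Prod>v\<in>arch_places. Mn v ^ m * Q v)" unfolding c1_def Mn_def Q_def ..
    then show ?thesis by (simp only: prod_power_distrib) (simp only: prod.distrib)
  qed
  also have "(\<Prod>v\<in>arch_places. F powr t v) = F powr (\<Sum>v\<in>arch_places. t v)"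
    using F finite_arch_places[OF nf] by (simp add: powr_sum)
  \<comment> \<open>The factorial factor is therefore counted once, however many Archimedean places
    there are.\<close>
  also have "(\<Sum>v\<in>arch_places. t v) = 1"
    using nf_degree_pos[OF nf] sum_local_degree_arch[OF nf]
    by (simp add: t_def sum_divide_distrib[symmetric] of_nat_sum[symmetric] del: of_nat_sum)
  also have "F powr 1 * (\<Prod>v\<in>arch_places. \<Lambda>n v) * c1 m a ^ r \<le> F * H * c1 m a ^ r"
  proof -
    have "c1 m a \<ge> 0" unfolding c1_def Mn_def[symmetric] Q_def[symmetric]
      by (intro prod_nonneg ballI mult_nonneg_nonneg Q0 zero_le_power order_trans[OF zero_le_one Mn1])
    then show ?thesis using F H by (intro mult_right_mono mult_left_mono) (auto simp: \<Lambda>n_def)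
  qed
  finally show ?thesis by (simp add: F_def)
qed

section \<open>Non-Archimedean places and the value of the linear form\<close>

locale ultra_place =
  fixes p :: nat and w :: "'k::field_char_0 \<Rightarrow> real"
  assumes p: "prime p" and place: "place_over p w"
begin

sublocale abs_val w using place by unfold_locales (simp add: place_over_def)

lemma ultra: "w (x + y) \<le> max (w x) (w y)" and w_rat: "w (of_rat q) = padic_abs p q"
  using place by (auto simp: place_over_def)

lemma ring_norm_w: "ring_norm w"
  unfolding ring_norm_def using ultra by (auto simp: mult)

lemma spectral_w: "spectral w x = w x"
  by (rule LIMSEQ_unique[OF spectral_lim[OF ring_norm_w]]) (simp add: power root_power_2)

lemma algebraic_int_le_1: "algebraic_int x \<Longrightarrow> w x \<le> 1"
  using spectral_algebraic_int[OF ring_norm_w, of x] by (simp add: spectral_w)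

lemma unit_ball_subring: "subring_set {x. w x \<le> 1}"
  unfolding subring_set_def
proof (intro conjI ballI)
  fix x y assume "x \<in> {x. w x \<le> 1}" "y \<in> {x. w x \<le> 1}"
  then show "x + y \<in> {x. w x \<le> 1}" "x * y \<in> {x. w x \<le> 1}"
    using ultra[of x y] by (auto simp: mult intro: mult_le_one)
qed auto

lemma of_nat_le_1: "w (of_nat k) \<le> 1"
  using subring_set_of_nat[OF unit_ball_subring, of k] by simp

lemma w_dvd: "a dvd b \<Longrightarrow> w (of_nat b) \<le> w (of_nat a)"
  by (elim dvdE) (simp add: mult mult_left_le of_nat_le_1)

text \<open>One factor \<open>p\<close> for each block of \<open>p\<close> consecutive numbers; this
  is enough for the series to converge.\<close>

lemma w_fact_mult: "w (of_nat (fact (k * p))) \<le> (1 / real p) ^ k"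
proof (induction k)
  case (Suc k)
  have p0: "p > 0" using prime_gt_0_nat[OF p] .
  have "fact (k * p) dvd (fact (Suc k * p - 1) :: nat)" using p0 by (intro fact_dvd) simp
  moreover have "(fact (Suc k * p) :: nat) = (Suc k * p) * fact (Suc k * p - 1)"
    using p0 fact_reduce[of "Suc k * p", where 'a = nat] by simp
  ultimately have "p * fact (k * p) dvd (fact (Suc k * p) :: nat)" by (simp add: mult_dvd_mono)
  from w_dvd[OF this] have "w (of_nat (fact (Suc k * p))) \<le> w (of_nat p) * w (of_nat (fact (k * p)))"
    by (simp only: of_nat_mult mult)
  also have "w (of_nat p) = 1 / real p"
    using w_rat[of "of_nat p"] padic_abs_of_nat[OF p p0] p0 p
    by (simp add: multiplicity_self inverse_eq_divide)
  also have "1 / real p * w (of_nat (fact (k * p))) \<le> 1 / real p * (1 / real p) ^ k"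
    by (intro mult_left_mono Suc) auto
  finally show ?case by simp
qed simp

lemma factorial_series_cauchy:
  assumes a: "w a \<le> 1" shows "cauchy_seq w (\<lambda>N. \<Sum>n<N. fact n * a ^ n)"
  unfolding cauchy_seq_def
proof (intro allI impI)
  fix e :: real assume e: "e > 0"
  have "1 / real p < 1" using prime_gt_1_nat[OF p] by simp
  then obtain k where k: "(1 / real p) ^ k < e" using real_arch_pow_inv[OF e] by auto
  define N where "N = k * p"
  have bound: "w (fact n * a ^ n) \<le> (1 / real p) ^ k" if "n \<ge> N" for n
  proof -
    have "w (fact n) \<le> w (of_nat (fact N))" using w_dvd[OF fact_dvd[OF that]] by simp
    also have "\<dots> \<le> (1 / real p) ^ k" unfolding N_def by (rule w_fact_mult)
    finally have "w (fact n) \<le> (1 / real p) ^ k" .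
    moreover have "w (a ^ n) \<le> 1" using a by (simp add: power power_le_one)
    ultimately show ?thesis unfolding mult using mult_mono[of "w (fact n)" "(1 / real p) ^ k" "w (a ^ n)" 1] by simp
  qed
  have half: "w ((\<Sum>n<i. fact n * a ^ n) - (\<Sum>n<j. fact n * a ^ n)) < e" if "i \<ge> j" "j \<ge> N" for i j
  proof -
    have "(\<Sum>n<i. fact n * a ^ n) - (\<Sum>n<j. fact n * a ^ n) = (\<Sum>n\<in>{j..<i}. fact n * a ^ n)"
      using that(1) by (simp add: lessThan_atLeast0 sum.atLeastLessThan_concat[of 0 j i, symmetric])
    moreover have "w (\<Sum>n\<in>{j..<i}. fact n * a ^ n) \<le> (1 / real p) ^ k"
      using that(2) by (intro ring_norm_sum[OF ring_norm_w] bound) auto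
    ultimately show ?thesis using k by simp
  qed
  show "\<exists>N. \<forall>i\<ge>N. \<forall>j\<ge>N. w ((\<Sum>n<i. fact n * a ^ n) - (\<Sum>n<j. fact n * a ^ n)) < e"
  proof (intro exI allI impI)
    fix i j assume "i \<ge> N" "j \<ge> N"
    then show "w ((\<Sum>n<i. fact n * a ^ n) - (\<Sum>n<j. fact n * a ^ n)) < e"
      using half[of j i] half[of i j] minus_commute by (cases "i \<ge> j") auto
  qed
qed

text \<open>For each long truncation \<open>M\<close>, W is the multiplier times \<open>S M\<close>
  minus the remainder. As the remainder is strictly smaller than W, the ultrametric inequality
  leaves w W <= w (S M), and letting \<open>M\<close> grow gives the value of the linear
  form.\<close>

lemma pade_value_le_linear_form:
  assumes a: "\<And>j. j \<in> {1..m} \<Longrightarrow> w (a j) \<le> 1" and l: "\<And>j. j \<in> {0..m} \<Longrightarrow> w (l j) \<le> 1"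
    and big: "w (pade_value m r l a n) > w (of_nat (fact (m * r + n) * fact r))"
  shows "w (pade_value m r l a n) \<le> completion_abs w (linear_form w m l a)"
proof -
  define S where "S = partial_form m l a"
  have cs: "\<And>j. j \<in> {1..m} \<Longrightarrow> cauchy_seq w (\<lambda>N. \<Sum>n<N. fact n * a j ^ n)"
    by (intro factorial_series_cauchy a)
  have S: "S = (\<lambda>N. l 0 + (\<Sum>j\<in>{1..m}. l j * (\<Sum>n<N. fact n * a j ^ n)))"
    by (simp add: S_def partial_form_def fun_eq_iff)
  have "linear_form w m l a = cls S" "cauchy_seq w S"
    unfolding S using linear_form_cls[of m a l] cs by blast+
  then have lim: "(\<lambda>M. w (S M)) \<longlonglongrightarrow> completion_abs w (linear_form w m l a)"
    using cauchy_abs_lim[of S] by simp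
  have le: "w (pade_value m r l a n) \<le> w (S M)" if M: "M \<ge> m * r + n + r" for M
  proof -
    obtain E where E: "w E \<le> 1" "pade_denom m r a n * S M - pade_value m r l a n = of_nat (fact (m * r + n) * fact r) * E"
      using pade_remainder[OF unit_ball_subring, of m a l r n M] a l M unfolding S_def by auto
    have A: "w (pade_denom m r a n) \<le> 1" using pade_denom_in[OF unit_ball_subring, of m a r n] a by simp
    have "pade_value m r l a n = pade_denom m r a n * S M + - (of_nat (fact (m * r + n) * fact r) * E)"
      using E(2) by (simp add: algebra_simps)
    then have "w (pade_value m r l a n) \<le> max (w (pade_denom m r a n * S M)) (w (of_nat (fact (m * r + n) * fact r) * E))"
      using ultra[of "pade_denom m r a n * S M" "- (of_nat (fact (m * r + n) * fact r) * E)"] by (simp only: minus)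
    moreover have "w (of_nat (fact (m * r + n) * fact r) * E) \<le> w (of_nat (fact (m * r + n) * fact r))"
      using E(1) mult[of "of_nat (fact (m * r + n) * fact r)" E] by (simp add: mult_left_le del: of_nat_mult)
    moreover have "w (pade_denom m r a n * S M) \<le> w (S M)"
      unfolding mult using A by (simp add: mult_left_le_one_le)
    ultimately show ?thesis using big by linarith
  qed
  show ?thesis
    by (rule LIMSEQ_le_const[OF lim]) (use le in blast)
qed

end

text \<open>\<open>small\<close> keeps the size of W below the part of (L + n)! r! composed of
  primes in \<open>S\<close>. So at some place over such a prime W exceeds the remainder, and there
  the linear form is at least as large as W; the product formula inequality for W gives the claim
  after a root of order \<kappa>.\<close>

lemma linear_form_lower_bound:
  fixes l a :: "nat \<Rightarrow> 'k::field_char_0"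
  assumes nf: "number_field TYPE('k)" and r: "r > 0"
    and a: "\<And>j. j \<in> {1..m} \<Longrightarrow> algebraic_int (a j) \<and> a j \<noteq> 0" and inj: "inj_on a {1..m}"
    and l: "\<And>i. i \<in> {0..m} \<Longrightarrow> algebraic_int (l i)" "\<exists>i\<in>{0..m}. l i \<noteq> 0"
    and H: "(\<Prod>v\<in>arch_places. Max ((\<lambda>i. place_norm v (l i)) ` {0..m})) \<le> H"
    and S: "finite S" "\<And>p. p \<in> S \<Longrightarrow> prime p"
    and small: "\<And>n. n \<le> m \<Longrightarrow> fact (m * r + n) * (1 + real m * real (m * r + n)) * H * c1 m a ^ r
        < real (\<Prod>p\<in>S. p ^ multiplicity p (fact (m * r + n) * fact r))"
  shows "\<exists>n\<le>m. \<exists>p\<in>S. \<exists>w. place_over p w \<and>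
     1 \<le> fact (m * r + n) * (1 + real m * real (m * r + n)) * H * c1 m a ^ r * completion_norm w (linear_form w m l a)"
proof -
  obtain n where n: "n \<le> m" and W0: "pade_value m r l a n \<noteq> 0"
    using pade_value_nonzero[OF inj _ l(2), of r] a by blast
  define W where "W = pade_value m r l a n"
  define N where "N = fact (m * r + n) * (fact r :: nat)"
  define \<kappa> where "\<kappa> = nf_degree TYPE('k)"
  define T where "T = fact (m * r + n) * (1 + real m * real (m * r + n)) * H * c1 m a ^ r"
  define \<rho> where "\<rho> = (\<Prod>v\<in>arch_places. place_norm v W)"
  have \<kappa>: "\<kappa> > 0" unfolding \<kappa>_def by (rule nf_degree_pos[OF nf])
  have \<rho>0: "\<rho> \<ge> 0" unfolding \<rho>_def by (intro prod_nonneg) (simp add: place_norm_def)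
  have \<rho>T: "\<rho> \<le> T" unfolding \<rho>_def W_def T_def by (rule prod_place_norm_pade_value[OF nf n r H])
  have emb: "(\<Prod>\<sigma>\<in>embeddings. cmod (\<sigma> W)) = \<rho> ^ \<kappa>"
    unfolding \<rho>_def \<kappa>_def by (rule prod_place_norm_arch[OF nf, symmetric])
  have int: "W \<in> integral_at p" if "prime p" for p
    unfolding W_def using a l(1) algebraic_int_integral_at[OF that]
    by (intro pade_value_in[OF integral_at_subring[OF that]]) auto
  have "\<exists>p\<in>S. \<exists>w. place_over p w \<and> w W > w (of_nat N)"
  proof (rule exists_place_small[OF nf int _ S])
    show "W \<noteq> 0" using W0 by (simp add: W_def)
    show "N > 0" by (simp add: N_def)
    show "(\<Prod>\<sigma>\<in>embeddings. cmod (\<sigma> W)) < real (\<Prod>p\<in>S. p ^ multiplicity p N) ^ nf_degree TYPE('k)"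
      unfolding emb \<kappa>_def[symmetric] using small[OF n] \<rho>T \<rho>0 \<kappa>
      by (intro power_strict_mono) (auto simp: T_def N_def)
  qed
  then obtain p w where p: "p \<in> S" and w: "place_over p w" "w W > w (of_nat N)" by blast
  have pS: "p \<in> S" and pp: "prime p" using S(2)[OF p] p by auto
  interpret ultra_place p w using pp w(1) by unfold_locales
  have le: "w W \<le> completion_abs w (linear_form w m l a)"
    unfolding W_def using w(2) a l(1) algebraic_int_le_1
    by (intro pade_value_le_linear_form) (auto simp: W_def N_def)
  define d where "d = local_degree w"
  have lb: "\<rho> ^ \<kappa> * w W ^ d \<ge> 1"
    using place_norm_lower_bound[OF nf pp w(1), of W] int W0[folded W_def] by (simp add: emb d_def)
  define \<Omega> where "\<Omega> = completion_abs w (linear_form w m l a)"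
  have \<Omega>0: "\<Omega> > 0"
  proof -
    have "w W > 0" using W0 by (simp add: W_def)
    then show ?thesis using le unfolding \<Omega>_def by linarith
  qed
  have cn: "completion_norm w (linear_form w m l a) = \<Omega> powr (real d / real \<kappa>)"
    by (simp add: completion_norm_def \<Omega>_def d_def \<kappa>_def)
  \<comment> \<open>The power \<kappa> clears the normalising exponent d/\<kappa>.\<close>
  have "1 \<le> (\<rho> * completion_norm w (linear_form w m l a)) ^ \<kappa>"
  proof -
    have "1 \<le> \<rho> ^ \<kappa> * \<Omega> ^ d"
      using lb mult_left_mono[OF power_mono[OF le[folded \<Omega>_def] nonneg, of d], of "\<rho> ^ \<kappa>"] \<rho>0
      by (meson order_trans zero_le_power)
    also have "\<Omega> ^ d = (\<Omega> powr (real d / real \<kappa>)) ^ \<kappa>"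
      using \<Omega>0 \<kappa> by (simp add: powr_realpow[symmetric] powr_powr)
    finally show ?thesis by (simp add: cn power_mult_distrib)
  qed
  then have "1 \<le> \<rho> * completion_norm w (linear_form w m l a)"
    using \<rho>0 \<kappa> by (smt (verit) cn mult_nonneg_nonneg powr_ge_zero power_less_one_iff)
  also have "\<dots> \<le> T * completion_norm w (linear_form w m l a)"
    using \<rho>T by (intro mult_right_mono) (auto simp: cn)
  finally show ?thesis using n pS w(1) unfolding T_def by blast
qed

section \<open>Prime factors of factorials\<close>

text \<open>The two middle coefficients are equal, and their sum is at most 2^(2k + 1).\<close>

lemma central_binomial_le: "(2 * k + 1) choose k \<le> 4 ^ k"
proof -
  have "2 * ((2 * k + 1) choose k) = ((2 * k + 1) choose k) + ((2 * k + 1) choose (k + 1))"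
    using binomial_symmetric[of k "2 * k + 1"] by simp
  also have "\<dots> = (\<Sum>i\<in>{k, k + 1}. (2 * k + 1) choose i)" by simp
  also have "\<dots> \<le> (\<Sum>i\<le>2 * k + 1. (2 * k + 1) choose i)"
    by (intro sum_mono2) auto
  also have "\<dots> = 2 * 4 ^ k" by (subst choose_row_sum) (simp add: power_mult)
  finally show ?thesis by simp
qed

lemma prod_primes_dvd:
  fixes c :: nat
  assumes "finite A" "\<And>p. p \<in> A \<Longrightarrow> prime p \<and> p dvd c"
  shows "\<Prod>A dvd c"
  using assms
proof (induction A rule: finite_induct)
  case (insert p A)
  have "coprime p (\<Prod>A)"
    using insert by (intro prod_coprime_right) (auto intro: primes_coprime)
  then show ?case using insert by (simp add: divides_mult)
qed simp

lemma finite_primes_le: "finite {p::nat. prime p \<and> p \<le> n}"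
  by (rule finite_subset[of _ "{..n}"]) auto

text \<open>Erdos' induction: for n = 2k + 1 the primes above k + 1 divide a middle binomial
  coefficient, which is at most 4^k; an even \<open>n > 2\<close> is not prime and adds
  nothing.\<close>

lemma primorial_le: "(\<Prod>{p::nat. prime p \<and> p \<le> n}) \<le> 4 ^ n"
proof (induction n rule: less_induct)
  case (less n)
  consider "n \<le> 1" | "n = 2" | "n > 2" "even n" | "n > 2" "odd n" by linarith
  then show ?case
  proof cases
    case 1
    then have "{p::nat. prime p \<and> p \<le> n} = {}" by (auto dest: prime_gt_1_nat)
    then show ?thesis by (simp only: prod.empty) simp
  next
    case 2
    have "{p::nat. prime p \<and> p \<le> n} = {2}" using 2 by (auto dest: prime_ge_2_nat)
    then show ?thesis using 2 by simp
  next
    case 3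
    have "\<not> prime n" using 3 prime_odd_nat by blast
    then have "p \<le> n \<longleftrightarrow> p \<le> n - 1" if "prime p" for p using that by (cases "p = n") auto
    then have "{p::nat. prime p \<and> p \<le> n} = {p. prime p \<and> p \<le> n - 1}" by blast
    also have "\<Prod>\<dots> \<le> 4 ^ (n - 1)" using 3 by (intro less) auto
    also have "\<dots> \<le> (4::nat) ^ n" by (intro power_increasing) auto
    finally show ?thesis .
  next
    case 4
    then obtain k where k: "n = 2 * k + 1" by (auto elim: oddE)
    have k1: "k \<ge> 1" using 4 k by simp
    have "\<Prod>{p::nat. prime p \<and> k + 1 < p \<and> p \<le> n} dvd (n choose k)"
    proof (rule prod_primes_dvd)
      show "finite {p::nat. prime p \<and> k + 1 < p \<and> p \<le> n}" by (rule finite_subset[of _ "{..n}"]) auto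
      fix p assume "p \<in> {p::nat. prime p \<and> k + 1 < p \<and> p \<le> n}"
      then have p: "prime p" "k + 1 < p" "p \<le> n" by auto
      have "p dvd fact n" using p by (simp add: prime_dvd_fact_iff)
      moreover have "fact k * fact (k + 1) * (n choose k) = fact n"
        using binomial_fact_lemma[of k n] k by (simp add: mult_2)
      ultimately have "p dvd fact k * fact (k + 1) * (n choose k)" by simp
      moreover have "\<not> p dvd (fact k :: nat)" "\<not> p dvd (fact (k + 1) :: nat)"
        using p prime_dvd_fact_iff[OF p(1)] by (simp_all del: fact_Suc)
      ultimately show "prime p \<and> p dvd (n choose k)" using p(1) prime_dvd_mult_iff by blast
    qed
    moreover have "n choose k > 0" using k by (simp add: zero_less_binomial)
    ultimately have "\<Prod>{p::nat. prime p \<and> k + 1 < p \<and> p \<le> n} \<le> n choose k" by (rule dvd_imp_le)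
    also have "\<dots> \<le> 4 ^ k" unfolding k by (rule central_binomial_le)
    finally have hi: "\<Prod>{p::nat. prime p \<and> k + 1 < p \<and> p \<le> n} \<le> 4 ^ k" .
    have lo: "\<Prod>{p::nat. prime p \<and> p \<le> k + 1} \<le> 4 ^ (k + 1)" using k1 k by (intro less) auto
    have set_eq: "{p::nat. prime p \<and> p \<le> n} = {p. prime p \<and> p \<le> k + 1} \<union> {p. prime p \<and> k + 1 < p \<and> p \<le> n}"
      using k by auto
    have "\<Prod>{p::nat. prime p \<and> p \<le> n} = \<Prod>{p::nat. prime p \<and> p \<le> k + 1} * \<Prod>{p::nat. prime p \<and> k + 1 < p \<and> p \<le> n}"
      unfolding set_eq
    proof (rule prod.union_disjoint)
      show "finite {p::nat. prime p \<and> k + 1 < p \<and> p \<le> n}"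
        by (rule finite_subset[OF _ finite_primes_le[of n]]) auto
    qed (use finite_primes_le[of "k + 1"] in auto)
    also have "\<dots> \<le> 4 ^ (k + 1) * 4 ^ k" by (rule mult_le_mono[OF lo hi])
    also have "(4::nat) ^ (k + 1) * 4 ^ k = 4 ^ n" unfolding k power_add[symmetric] by (simp add: mult_2)
    finally show ?thesis .
  qed
qed

lemma theta_le: "(\<Sum>p | prime p \<and> p \<le> n. ln (real p)) \<le> real n * ln 4"
proof -
  have "ln (\<Prod>p | prime p \<and> p \<le> n. real p) = (\<Sum>p | prime p \<and> p \<le> n. ln (real p))"
    using finite_primes_le[of n] by (intro ln_prod) (auto dest: prime_gt_0_nat)
  then have "(\<Sum>p | prime p \<and> p \<le> n. ln (real p)) = ln (real (\<Prod>{p::nat. prime p \<and> p \<le> n}))"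
    by simp
  also have "\<dots> \<le> ln (real (4 ^ n))"
  proof (rule ln_mono)
    show "real (\<Prod>{p::nat. prime p \<and> p \<le> n}) > 0"
      using finite_primes_le[of n] by (auto intro!: prod_pos dest: prime_gt_0_nat)
    show "real (\<Prod>{p::nat. prime p \<and> p \<le> n}) \<le> real (4 ^ n)"
      using primorial_le[of n] by (simp only: of_nat_le_iff)
  qed
  also have "\<dots> = real n * ln 4" by (simp add: ln_realpow)
  finally show ?thesis .
qed

section \<open>Legendre's formula and the logarithm of factorials\<close>

lemma multiplicity_fact_sum:
  assumes p: "prime p"
  shows "multiplicity p (fact N :: nat) = (\<Sum>k\<in>{1..N}. multiplicity p k)"
proof (induction N)
  case (Suc N)
  have "multiplicity p (fact (Suc N) :: nat) = multiplicity p (Suc N) + multiplicity p (fact N :: nat)"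
    using p unfolding fact_Suc of_nat_id by (subst prime_elem_multiplicity_mult_distrib) auto
  then show ?case using Suc by simp
qed simp

lemma multiplicity_fact_rec:
  assumes p: "prime (p::nat)"
  shows "multiplicity p (fact N :: nat) = N div p + multiplicity p (fact (N div p) :: nat)"
proof -
  have p0: "p > 0" using prime_gt_0_nat[OF p] .
  have "(\<Sum>k\<in>{1..N}. multiplicity p k) = (\<Sum>k\<in>(*) p ` {1..N div p}. multiplicity p k)"
  proof (rule sum.mono_neutral_right)
    show "(*) p ` {1..N div p} \<subseteq> {1..N}"
      using p0 by (auto simp: less_eq_div_iff_mult_less_eq mult.commute Suc_le_eq)
    show "\<forall>i\<in>{1..N} - (*) p ` {1..N div p}. multiplicity p i = 0"
    proof
      fix i assume i: "i \<in> {1..N} - (*) p ` {1..N div p}"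
      have "\<not> p dvd i"
      proof
        assume "p dvd i"
        then obtain j where j: "i = p * j" by auto
        then have "j \<in> {1..N div p}" using i p0 by (auto simp: less_eq_div_iff_mult_less_eq mult.commute Suc_le_eq)
        then show False using i j by auto
      qed
      then show "multiplicity p i = 0" by (rule not_dvd_imp_multiplicity_0)
    qed
  qed simp
  also have "\<dots> = (\<Sum>j\<in>{1..N div p}. multiplicity p (p * j))"
    using p0 by (subst sum.reindex) (auto simp: inj_on_def)
  also have "\<dots> = (\<Sum>j\<in>{1..N div p}. Suc (multiplicity p j))"
  proof (rule sum.cong[OF refl])
    fix j assume "j \<in> {1..N div p}"
    then show "multiplicity p (p * j) = Suc (multiplicity p j)"
      using p p0 by (subst prime_elem_multiplicity_mult_distrib) (auto simp: multiplicity_self)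
  qed
  also have "\<dots> = N div p + (\<Sum>j\<in>{1..N div p}. multiplicity p j)"
    by (simp add: sum_Suc)
  finally show ?thesis by (simp only: multiplicity_fact_sum[OF p])
qed

text \<open>Legendre's recursion summed as a geometric series; the denominator p - 1 is the reason
  why \<open>sum_ln_prime_le\<close> is stated with p - 1.\<close>

lemma multiplicity_fact_le:
  assumes p: "prime (p::nat)"
  shows "(p - 1) * multiplicity p (fact N :: nat) \<le> N"
proof (induction N rule: less_induct)
  case (less N)
  show ?case
  proof (cases "N = 0")
    case False
    have "p > 1" using prime_gt_1_nat[OF p] .
    then have "N div p < N" using False by simp
    then have IH: "(p - 1) * multiplicity p (fact (N div p) :: nat) \<le> N div p" by (rule less)
    have "(p - 1) * multiplicity p (fact N :: nat)
        = (p - 1) * (N div p) + (p - 1) * multiplicity p (fact (N div p) :: nat)"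
      by (subst multiplicity_fact_rec[OF p]) (simp add: distrib_left)
    also have "\<dots> \<le> (p - 1) * (N div p) + N div p" using IH by simp
    also have "\<dots> = p * (N div p)" using \<open>p > 1\<close> by (simp add: algebra_simps diff_mult_distrib)
    also have "\<dots> \<le> N" by simp
    finally show ?thesis .
  qed simp
qed

lemma multiplicity_fact_ge: "prime (p::nat) \<Longrightarrow> N div p \<le> multiplicity p (fact N :: nat)"
  by (subst multiplicity_fact_rec) auto

lemma prime_factors_fact_subset: "prime_factors (fact N :: nat) \<subseteq> {p. prime p \<and> p \<le> N}"
  by (auto simp: in_prime_factors_iff prime_dvd_fact_iff)

lemma ln_fact_eq: "ln (fact N :: real) = (\<Sum>p | prime p \<and> p \<le> N. real (multiplicity p (fact N :: nat)) * ln (real p))"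
proof -
  have "real (fact N) = real (\<Prod>p\<in>prime_factors (fact N). p ^ multiplicity p (fact N))"
    by (subst prime_factorization_nat[of "fact N"]) auto
  also have "\<dots> = (\<Prod>p\<in>prime_factors (fact N). real p ^ multiplicity p (fact N :: nat))" by simp
  also have "\<dots> = (\<Prod>p | prime p \<and> p \<le> N. real p ^ multiplicity p (fact N :: nat))"
    using prime_factors_fact_subset[of N] finite_primes_le[of N]
    by (intro prod.mono_neutral_left) (auto simp: prime_factors_multiplicity)
  finally have "ln (real (fact N)) = ln (\<Prod>p | prime p \<and> p \<le> N. real p ^ multiplicity p (fact N :: nat))"
    by simp
  also have "\<dots> = (\<Sum>p | prime p \<and> p \<le> N. ln (real p ^ multiplicity p (fact N :: nat)))"
    using finite_primes_le[of N] by (intro ln_prod) (auto dest: prime_gt_0_nat)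
  also have "\<dots> = (\<Sum>p | prime p \<and> p \<le> N. real (multiplicity p (fact N :: nat)) * ln (real p))"
    by (intro sum.cong) (auto simp: ln_realpow dest: prime_gt_0_nat)
  finally show ?thesis by simp
qed

section \<open>Explicit logarithmic estimates and a Mertens type bound\<close>

lemma ln_fact_upper:
  assumes "n > 0" shows "ln (fact n :: real) \<le> (real n + 1) * ln n - n + 1"
  using assms
proof (induction n)
  case (Suc n)
  show ?case
  proof (cases "n = 0")
    case False
    then have n: "real n > 0" by simp
    have "ln (real n / real (Suc n)) \<le> real n / real (Suc n) - 1"
      using n by (intro ln_le_minus_one) auto
    then have "ln (real n) - ln (real (Suc n)) \<le> - 1 / (real n + 1)"
      using n by (simp add: ln_div field_simps)
    then have "(real n + 1) * (ln (real n) - ln (real (Suc n))) \<le> -1"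
      using n by (simp add: field_simps)
    then have key: "(real n + 1) * ln (real n) + 1 \<le> (real n + 1) * ln (real (Suc n))"
      by (simp add: right_diff_distrib)
    have "ln (fact (Suc n) :: real) = ln (real (Suc n)) + ln (fact n)"
      by (subst fact_Suc) (simp add: ln_mult del: of_nat_Suc)
    also have "\<dots> \<le> ln (real (Suc n)) + ((real n + 1) * ln n - n + 1)" using Suc False by simp
    also have "\<dots> \<le> (real (Suc n) + 1) * ln (real (Suc n)) - real (Suc n) + 1"
      using key by (simp add: algebra_simps)
    finally show ?thesis .
  qed simp
qed simp

lemma ln_fact_lower: "real n * ln n - n \<le> ln (fact n :: real)"
proof (cases "n = 0")
  case False
  have "real n ^ n / fact n \<le> exp (real n)"
  proof -
    have "(\<Sum>k\<in>{n}. real n ^ k /\<^sub>R fact k) \<le> exp (real n)"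
      unfolding exp_def by (intro sum_le_suminf summable_exp_generic) auto
    then show ?thesis by (simp add: divide_inverse mult.commute)
  qed
  then have "ln (real n ^ n / fact n) \<le> ln (exp (real n))"
    using False by (intro ln_mono) auto
  then show ?thesis using False by (simp add: ln_div ln_realpow)
qed simp

text \<open>With exp (x / 16) bounded below by its quadratic Taylor polynomial, the hypothesis is a
  rational inequality that can be evaluated; the four logarithms below are obtained this
  way.\<close>

lemma ln_le_by_power:
  fixes x a :: real
  assumes "0 \<le> x" "0 < a" "a \<le> (1 + x / 16 + (x / 16) ^ 2 / 2) ^ 16"
  shows "ln a \<le> x"
proof -
  have "a \<le> (1 + x / 16 + (x / 16) ^ 2 / 2) ^ 16" by (rule assms)
  also have "\<dots> \<le> exp (x / 16) ^ 16"
    using assms(1) exp_lower_Taylor_quadratic[of "x / 16"] by (intro power_mono) auto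
  also have "\<dots> = exp x" by (simp add: exp_of_nat_mult[symmetric])
  finally show ?thesis using assms(2) by (metis ln_exp ln_mono)
qed

lemma ln_bounds_small: "ln (2::real) \<le> 7/10" "ln (3::real) \<le> 111/100" "ln (5::real) \<le> 162/100" "ln (7::real) \<le> 196/100"
  by (rule ln_le_by_power; simp add: power2_eq_square power_numeral_reduce)+

text \<open>Each summand is at most the drop of (ln k + 8/7)/k from k - 1 to k. The constant 8/7
  bounds (n + 1)(ln (n + 1) - ln n), which is at most (n + 1)/n, for \<open>n >= 7\<close>.\<close>

lemma sum_ln_telescope:
  assumes "n \<ge> 7"
  shows "(\<Sum>k\<in>{8..n}. ln (real k) / (real k * (real k - 1))) \<le> (ln 7 + 8/7) / 7 - (ln (real n) + 8/7) / real n"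
  using assms
proof (induction n rule: dec_induct)
  case (step n)
  have n: "real n \<ge> 7" using step by simp
  have "ln (real (Suc n) / real n) \<le> real (Suc n) / real n - 1"
    using n by (intro ln_le_minus_one) auto
  have l: "ln (real (Suc n)) - ln (real n) \<le> 1 / real n"
  proof -
    have "n \<noteq> 0" using step(1) by linarith
    then have "real (Suc n) / real n = 1 / real n + 1" by (simp add: field_simps)
    moreover have "ln (real (Suc n) / real n) = ln (real (Suc n)) - ln (real n)" using n by (intro ln_divide_pos) auto
    ultimately show ?thesis using \<open>ln (real (Suc n) / real n) \<le> real (Suc n) / real n - 1\<close> by linarith
  qed
  have "(real n + 1) * (ln (real (Suc n)) - ln (real n)) \<le> (real n + 1) * (1 / real n)"
    using l n by (intro mult_left_mono) auto
  also have "\<dots> \<le> 8/7"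
  proof -
    have "1 / real n \<le> 1 / 7" using n by (intro divide_left_mono) auto
    moreover have "(real n + 1) * (1 / real n) = real n / real n + 1 / real n" by (simp add: add_divide_distrib)
    moreover have "real n / real n = 1" using n by simp
    ultimately show ?thesis by linarith
  qed
  finally have key: "(real n + 1) * ln (real (Suc n)) - 8/7 \<le> (real n + 1) * ln (real n)"
    by (simp add: right_diff_distrib)
  have "ln (real (Suc n)) / (real (Suc n) * (real (Suc n) - 1))
      \<le> (ln (real n) + 8/7) / real n - (ln (real (Suc n)) + 8/7) / real (Suc n)"
  proof -
    have "(ln (real n) + 8/7) / real n - (ln (real (Suc n)) + 8/7) / real (Suc n)
        = ((real n + 1) * (ln (real n) + 8/7) - real n * (ln (real (Suc n)) + 8/7)) / (real (Suc n) * real n)"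
      using n by (subst diff_frac_eq) (auto simp: mult.commute add.commute)
    moreover have "ln (real (Suc n)) \<le> (real n + 1) * (ln (real n) + 8/7) - real n * (ln (real (Suc n)) + 8/7)"
      using key by (simp add: algebra_simps add_divide_distrib)
    then have "ln (real (Suc n)) / (real (Suc n) * real n)
        \<le> ((real n + 1) * (ln (real n) + 8/7) - real n * (ln (real (Suc n)) + 8/7)) / (real (Suc n) * real n)"
      by (rule divide_right_mono) simp
    ultimately show ?thesis by simp
  qed
  moreover have "{8..Suc n} = insert (Suc n) {8..n}" using step by auto
  ultimately show ?case using step by simp
qed simp

text \<open>Mertens' theorem with an explicit constant. Comparing ln n! with its prime factorisation
  and using \<open>theta_le\<close> gives ln n + ln 4 - 1 plus a remainder of at most 24/100;
  passing from p to p - 1 costs 1107/1000. With ln 4 <= 14/10 the constant is 1747/1000, just below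
  7/4.\<close>

lemma sum_ln_prime_le:
  fixes n :: nat
  assumes n: "n \<ge> 16"
  shows "(\<Sum>p | prime p \<and> p \<le> n. ln (real p) / (real p - 1)) \<le> ln (real n) + 7/4"
proof -
  let ?P = "{p::nat. prime p \<and> p \<le> n}"
  have n0: "real n > 0" using n by simp
  have fin: "finite ?P" by (rule finite_primes_le)
  have P: "real p > 1" "ln (real p) > 0" if "p \<in> ?P" for p
    using that prime_gt_1_nat[of p] by auto
  have "real n * (\<Sum>p\<in>?P. ln (real p) / real p) \<le> (\<Sum>p\<in>?P. real (n div p) * ln (real p) + ln (real p))"
    unfolding sum_distrib_left
  proof (rule sum_mono)
    fix p assume p: "p \<in> ?P"
    have "n \<le> p * (n div p) + p"
      using P[OF p] mod_less_divisor[of p n] mult_div_mod_eq[of p n] by linarith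
    then have "real n \<le> real p * real (n div p) + real p"
      by (metis of_nat_add of_nat_le_iff of_nat_mult)
    then have "real n / real p \<le> real (n div p) + 1"
      using P[OF p] by (simp add: divide_le_eq algebra_simps)
    then have "real n / real p * ln (real p) \<le> (real (n div p) + 1) * ln (real p)"
      using P[OF p] by (intro mult_right_mono) auto
    then show "real n * (ln (real p) / real p) \<le> real (n div p) * ln (real p) + ln (real p)" by (simp add: distrib_right)
  qed
  also have "\<dots> = (\<Sum>p\<in>?P. real (n div p) * ln (real p)) + (\<Sum>p\<in>?P. ln (real p))" by (rule sum.distrib)
  also have "(\<Sum>p\<in>?P. real (n div p) * ln (real p)) \<le> (\<Sum>p\<in>?P. real (multiplicity p (fact n :: nat)) * ln (real p))"
    using P multiplicity_fact_ge by (intro sum_mono mult_right_mono) (auto intro: less_imp_le)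
  also have "\<dots> = ln (fact n)" by (rule ln_fact_eq[symmetric])
  also have "\<dots> \<le> (real n + 1) * ln (real n) - real n + 1" using n by (intro ln_fact_upper) simp
  also have "(\<Sum>p\<in>?P. ln (real p)) \<le> real n * ln 4" by (rule theta_le)
  finally have "real n * (\<Sum>p\<in>?P. ln (real p) / real p) \<le> (real n + 1) * ln (real n) - real n + 1 + real n * ln 4" by simp
  then have A: "(\<Sum>p\<in>?P. ln (real p) / real p) \<le> ln (real n) + (ln (real n) + 1) / real n - 1 + ln 4"
    using n0 by (simp add: field_simps)
  have B: "(\<Sum>p\<in>?P. ln (real p) / (real p * (real p - 1))) \<le> (1107/1000)"
  proof -
    \<comment> \<open>Beyond 7 the sum is extended to all integers, where it telescopes.\<close>
    have sub: "?P \<subseteq> {2, 3, 5, 7} \<union> {8..n}"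
    proof
      fix p assume p: "p \<in> ?P"
      show "p \<in> {2, 3, 5, 7} \<union> {8..n}"
      proof (cases "p \<ge> 8")
        case False
        have "\<not> prime (4::nat)" "\<not> prime (6::nat)"
          using prime_odd_nat[of 4] prime_odd_nat[of 6] by auto
        moreover have "p = 2 \<or> p = 3 \<or> p = 4 \<or> p = 5 \<or> p = 6 \<or> p = 7"
          using False p prime_ge_2_nat[of p] by auto
        ultimately show ?thesis using p by auto
      qed (use p in auto)
    qed
    have nn: "ln (real k) / (real k * (real k - 1)) \<ge> 0" for k
      by (cases "k = 0") auto
    let ?g = "\<lambda>p. ln (real p) / (real p * (real p - 1))"
    have "sum ?g ?P \<le> sum ?g ({2, 3, 5, 7} \<union> {8..n})"
      by (rule sum_mono2[OF _ sub]) (use nn in auto)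
    also have "\<dots> = sum ?g {2, 3, 5, 7} + sum ?g {8..n}"
      by (rule sum.union_disjoint) auto
    also have "\<dots> \<le> (ln 2 / 2 + ln 3 / 6 + ln 5 / 20 + ln 7 / 42) + (ln 7 + 8/7) / 7"
    proof (rule add_mono)
      show "sum ?g {2, 3, 5, 7} \<le> ln 2 / 2 + ln 3 / 6 + ln 5 / 20 + ln 7 / 42" by simp
      have "(ln (real n) + 8/7) / real n \<ge> 0" using n by (intro divide_nonneg_nonneg add_nonneg_nonneg) auto
      then show "sum ?g {8..n} \<le> (ln 7 + 8/7) / 7" using sum_ln_telescope[of n] n by linarith
    qed
    also have "\<dots> \<le> 1107/1000" using ln_bounds_small by argo
    finally show ?thesis by simp
  qed
  have C: "(ln (real n) + 1) / real n \<le> (24/100)"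
  proof -
    have "ln (real n / 16) \<le> real n / 16 - 1" using n by (intro ln_le_minus_one) auto
    then have "ln (real n) \<le> ln 16 + real n / 16 - 1" using n by (simp add: ln_div)
    moreover have "ln (16::real) = 4 * ln 2" using ln_realpow[of 2 4] by simp
    ultimately have "ln (real n) + 1 \<le> (28/10) + real n / 16" using ln_bounds_small(1) by simp
    also have "\<dots> \<le> (24/100) * real n" using n by simp
    finally show ?thesis using n0 by (simp add: field_simps)
  qed
  have "ln (4::real) = 2 * ln 2" using ln_realpow[of 2 2] by simp
  then have D: "ln (4::real) \<le> (14/10)" using ln_bounds_small(1) by simp
  have "(\<Sum>p\<in>?P. ln (real p) / (real p - 1)) = (\<Sum>p\<in>?P. ln (real p) / real p + ln (real p) / (real p * (real p - 1)))"
  proof (rule sum.cong[OF refl])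
    fix p assume "p \<in> ?P"
    then have "real p > 1" by (rule P)
    then show "ln (real p) / (real p - 1) = ln (real p) / real p + ln (real p) / (real p * (real p - 1))" by (simp add: field_simps)
  qed
  also have "\<dots> = (\<Sum>p\<in>?P. ln (real p) / real p) + (\<Sum>p\<in>?P. ln (real p) / (real p * (real p - 1)))" by (rule sum.distrib)
  finally show ?thesis using A B C D by linarith
qed

text \<open>A prime \<open>p\<close> divides the product of factorials at most (A + r)/(p - 1)
  times, so by \<open>sum_ln_prime_le\<close> the primes up to \<open>y\<close> contribute at most
  the exponential factor; all other prime factors lie in \<open>S\<close>.\<close>

lemma fact_product_split:
  assumes y: "y \<ge> 16" and rA: "r \<le> A" and S: "finite S" "\<And>p. p \<in> S \<Longrightarrow> prime p"
    and SA: "\<And>p. prime p \<Longrightarrow> y < real p \<Longrightarrow> p \<le> A \<Longrightarrow> p \<in> S"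
  shows "fact A * fact r \<le> real (\<Prod>p\<in>S. p ^ multiplicity p (fact A * fact r)) * exp ((real A + real r) * (ln y + 7/4))"
proof -
  define N :: nat where "N = fact A * fact r"
  define n where "n = nat \<lfloor>y\<rfloor>"
  have n: "n \<ge> 16" "real n \<le> y" "\<And>p. real p \<le> y \<longleftrightarrow> p \<le> n"
    using y by (auto simp: n_def le_nat_iff le_floor_iff)
  let ?P = "{p. prime p \<and> p \<le> n}"
  have fin: "finite ?P" by (rule finite_primes_le)
  have N0: "N > 0" by (simp add: N_def)
  have sub: "prime_factors N \<subseteq> S \<union> ?P"
  proof
    fix p assume "p \<in> prime_factors N"
    then have p: "prime p" "p dvd N" by (auto simp: in_prime_factors_iff)
    then have "p dvd fact A \<or> p dvd fact r" by (simp add: N_def prime_dvd_mult_iff)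
    then have "p \<le> A" using rA p(1) by (auto simp: prime_dvd_fact_iff)
    then show "p \<in> S \<union> ?P" using SA[OF p(1)] n(3)[of p] p(1) by (cases "y < real p") auto
  qed
  have "N = (\<Prod>p\<in>prime_factors N. p ^ multiplicity p N)"
    using N0 by (subst prime_factorization_nat[of N]) auto
  also have "\<dots> = (\<Prod>p\<in>S \<union> ?P. p ^ multiplicity p N)"
    using sub S fin by (intro prod.mono_neutral_left) (auto simp: prime_factors_multiplicity)
  \<comment> \<open>\<open>S\<close> may contain primes up to \<open>y\<close> as well; counting
    those twice only enlarges the bound.\<close>
  also have "\<dots> \<le> (\<Prod>p\<in>S. p ^ multiplicity p N) * (\<Prod>p\<in>?P. p ^ multiplicity p N)"
  proof -
    have "(\<Prod>p\<in>S \<inter> ?P. p ^ multiplicity p N) \<ge> 1"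
      using S fin by (intro prod_ge_1) (auto dest: prime_gt_0_nat simp: Suc_le_eq)
    moreover have "(\<Prod>p\<in>S \<union> ?P. p ^ multiplicity p N) * (\<Prod>p\<in>S \<inter> ?P. p ^ multiplicity p N)
        = (\<Prod>p\<in>S. p ^ multiplicity p N) * (\<Prod>p\<in>?P. p ^ multiplicity p N)"
      by (rule prod.union_inter[OF S(1) fin])
    ultimately show ?thesis
      using mult_le_mono2[of 1 "\<Prod>p\<in>S \<inter> ?P. p ^ multiplicity p N" "\<Prod>p\<in>S \<union> ?P. p ^ multiplicity p N"] by linarith
  qed
  finally have "real N \<le> real ((\<Prod>p\<in>S. p ^ multiplicity p N) * (\<Prod>p\<in>?P. p ^ multiplicity p N))"
    by (simp only: of_nat_le_iff)
  then have le1: "real N \<le> real (\<Prod>p\<in>S. p ^ multiplicity p N) * real (\<Prod>p\<in>?P. p ^ multiplicity p N)"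
    by (simp only: of_nat_mult)
  have "real (\<Prod>p\<in>?P. p ^ multiplicity p N) \<le> exp ((real A + real r) * (ln y + 7/4))"
  proof -
    have pos: "real (\<Prod>p\<in>?P. p ^ multiplicity p N) > 0"
      using fin by (auto intro!: prod_pos dest: prime_gt_0_nat)
    have "ln (real (\<Prod>p\<in>?P. p ^ multiplicity p N)) = (\<Sum>p\<in>?P. ln (real p ^ multiplicity p N))"
      using fin by (subst of_nat_prod, subst ln_prod) (auto dest: prime_gt_0_nat)
    also have "\<dots> = (\<Sum>p\<in>?P. real (multiplicity p N) * ln (real p))"
      by (intro sum.cong) (auto simp: ln_realpow dest: prime_gt_0_nat)
    also have "\<dots> \<le> (\<Sum>p\<in>?P. (real A + real r) * (ln (real p) / (real p - 1)))"
    proof (rule sum_mono)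
      fix p assume "p \<in> ?P"
      then have p: "prime p" by simp
      then have p1: "real p > 1" using prime_gt_1_nat[of p] by simp
      have "multiplicity p N = multiplicity p (fact A :: nat) + multiplicity p (fact r :: nat)"
        unfolding N_def using p by (subst prime_elem_multiplicity_mult_distrib) auto
      then have "(p - 1) * multiplicity p N \<le> A + r"
        using multiplicity_fact_le[OF p, of A] multiplicity_fact_le[OF p, of r] by (simp add: distrib_left)
      then have "real ((p - 1) * multiplicity p N) \<le> real (A + r)" by (simp only: of_nat_le_iff)
      then have "real (multiplicity p N) * (real p - 1) \<le> real A + real r"
        using p1 by (simp add: of_nat_diff mult.commute)
      then have "real (multiplicity p N) \<le> (real A + real r) / (real p - 1)"
        using p1 by (simp add: pos_le_divide_eq)
      then have "real (multiplicity p N) * ln (real p) \<le> (real A + real r) / (real p - 1) * ln (real p)"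
        using p1 by (intro mult_right_mono) auto
      then show "real (multiplicity p N) * ln (real p) \<le> (real A + real r) * (ln (real p) / (real p - 1))" by simp
    qed
    also have "\<dots> = (real A + real r) * (\<Sum>p\<in>?P. ln (real p) / (real p - 1))" by (simp add: sum_distrib_left)
    also have "\<dots> \<le> (real A + real r) * (ln y + 7/4)"
    proof (rule mult_left_mono)
      have "ln (real n) \<le> ln y" using n(1,2) by (intro ln_mono) auto
      then show "(\<Sum>p\<in>?P. ln (real p) / (real p - 1)) \<le> ln y + 7/4" using sum_ln_prime_le[OF n(1)] by linarith
    qed simp
    finally show ?thesis using pos by (metis exp_le_cancel_iff exp_ln)
  qed
  then have "real (\<Prod>p\<in>S. p ^ multiplicity p N) * real (\<Prod>p\<in>?P. p ^ multiplicity p N)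
      \<le> real (\<Prod>p\<in>S. p ^ multiplicity p N) * exp ((real A + real r) * (ln y + 7/4))"
    by (intro mult_left_mono) (auto intro!: prod_nonneg)
  then show ?thesis using le1 by (simp add: N_def)
qed

section \<open>Choice of parameters\<close>

lemma exp_3_bounds: "20 \<le> exp (3::real)" "exp (3::real) \<le> (2013/100)"
proof -
  have e: "exp (3::real) = exp 1 ^ 3" by (simp add: exp_of_nat_mult[symmetric])
  have "exp (1::real) \<ge> 5837465777 / 2147483648 - inverse (2 ^ 32)" using e_approx_32 by linarith
  then have "exp (1::real) \<ge> (27182/10000)" by simp
  then have "(27182/10000) ^ 3 \<le> exp (1::real) ^ 3" by (intro power_mono) auto
  then show "20 \<le> exp (3::real)" unfolding e by (simp add: power3_eq_cube)
  have "exp (1::real) ^ 3 \<le> (272/100) ^ 3" using e_less_272 by (intro power_mono) auto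
  then show "exp (3::real) \<le> (2013/100)" unfolding e by (simp add: power3_eq_cube)
qed

text \<open>The tangent to the logarithm at e^3, with its slope rounded up to 1/20.\<close>

lemma ln_le_tangent_3:
  fixes x :: real
  assumes "x > 0" shows "ln x \<le> 2 + x / 20"
proof -
  have "ln (x / exp 3) \<le> x / exp 3 - 1" using assms by (intro ln_le_minus_one) auto
  then have "ln x \<le> 2 + x / exp 3" using assms by (simp add: ln_div)
  moreover have "x / exp 3 \<le> x / 20" using exp_3_bounds(1) assms by (intro divide_left_mono) auto
  ultimately show ?thesis by linarith
qed

text \<open>The numerical part in real variables: \<open>u\<close> stands for log log H, so that
  \<open>exp u\<close> is log H, \<open>z\<close> for its logarithm and \<open>c\<close> for
  \<open>c1\<close>. The cases for \<open>m\<close> retain what \<open>aD\<close> uses about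
  integrality, where 1, 2 and 3 are treated separately.\<close>

locale parameters =
  fixes m s u z c :: real
  assumes m: "m = 1 \<or> m = 2 \<or> m = 3 \<or> m \<ge> 4"
    and s: "s \<ge> (m + 3) ^ 2 + 1" and u: "u \<ge> s + ln s" and z: "z = ln u" and c: "0 < c" "c \<le> s"
begin

lemma m1: "m \<ge> 1" using m by auto

lemma s17: "s \<ge> 17"
proof -
  have "(m + 3) ^ 2 \<ge> 4 ^ 2" using m1 by (intro power_mono) auto
  then show ?thesis using s by simp
qed

lemma ln_s: "ln s \<ge> (28/10)"
proof -
  have "ln (exp 3 / 17 :: real) \<le> exp 3 / 17 - 1" by (intro ln_le_minus_one) auto
  then have "3 - ln 17 \<le> (exp 3 / 17 - 1 :: real)" by (simp add: ln_div)
  then have "ln (17::real) \<ge> (28/10)" using exp_3_bounds(2) by simp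
  moreover have "ln 17 \<le> ln s" using s17 by (intro ln_mono) auto
  ultimately show ?thesis by linarith
qed

lemma u_ge: "u \<ge> (m + 3) ^ 2 + (38/10)" using u s ln_s by linarith

lemma u_ge_19: "u \<ge> (198/10)" using u s17 ln_s by linarith

lemma z_ge: "z \<ge> (298/100)"
proof -
  have "ln (exp 3 / u) \<le> exp 3 / u - 1" using u_ge_19 by (intro ln_le_minus_one) auto
  then have "3 - z \<le> exp 3 / u - 1" using u_ge_19 by (simp add: ln_div z)
  moreover have "exp 3 / u \<le> (2013/100) / (198/10)" using exp_3_bounds(2) u_ge_19 by (intro frac_le) auto
  ultimately show ?thesis by simp
qed

lemma z_le: "z \<le> 2 + u / 20" unfolding z using u_ge_19 by (intro ln_le_tangent_3) auto

lemma z_le_u: "z \<le> u / 6" using z_le u_ge_19 by linarith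

lemma ln_c: "ln c \<le> z"
proof -
  have "c \<le> u" using c u ln_s by linarith
  then show ?thesis unfolding z using c by (intro ln_mono) auto
qed

lemma ln_m: "2 * ln m \<le> z"
proof -
  have "m ^ 2 \<le> (m + 3) ^ 2" using m1 by (intro power_mono) auto
  then have "m ^ 2 \<le> u" using u_ge by linarith
  then have "ln (m ^ 2) \<le> ln u" using m1 by (intro ln_mono) auto
  then show ?thesis using m1 by (simp add: ln_realpow z)
qed

text \<open>\<open>r\<close> will be about \<open>a * X\<close> with X = log H / log log H. The
  surplus over \<open>X\<close> compensates the losses in \<open>D\<close>; the factor 45 is large
  enough for \<open>aD\<close> to hold for all \<open>m\<close>.\<close>

definition a where "a = 1 + 45 * m * z / u"

text \<open>For q = sqrt u one has m + 3 <= q and z = 2 ln q, and the tangent of the logarithm at 9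
  leaves a quadratic inequality in q. Through 45 * 33/100 it yields the bound 1585/100 for
  \<open>a\<close>.\<close>

lemma mz_u: "m * z \<le> (33/100) * u"
proof -
  define q where "q = sqrt u"
  have q2: "q ^ 2 = u" using u_ge_19 by (simp add: q_def)
  have "(m + 3) ^ 2 \<le> q ^ 2" using u_ge q2 by simp
  then have q: "m + 3 \<le> q" by (rule power2_le_imp_le) (use u_ge_19 in \<open>simp add: q_def\<close>)
  have q0: "q \<ge> 4" using q m1 by linarith
  have "z = ln (q ^ 2)" by (simp only: z q2)
  then have "z = 2 * ln q" using q0 by (simp add: ln_realpow)
  moreover have "ln q \<le> q / 9 + (122/100)"
  proof -
    have "ln (q / 9) \<le> q / 9 - 1" using q0 by (intro ln_le_minus_one) auto
    then have "ln q \<le> q / 9 - 1 + ln 9" using q0 by (simp add: ln_div)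
    moreover have "ln (9::real) \<le> (222/100)"
      using ln_realpow[of 3 2] ln_bounds_small(2) by simp
    ultimately show ?thesis by linarith
  qed
  ultimately have "z \<le> 2 * q / 9 + (244/100)" by linarith
  then have "m * z \<le> (q - 3) * (2 * q / 9 + (244/100))"
    using q m1 z_ge by (intro mult_mono) auto
  also have "\<dots> \<le> (33/100) * q ^ 2"
  proof -
    \<comment> \<open>798/97 is the vertex of the quadratic difference of both sides, whose
      discriminant is negative.\<close>
    have "0 \<le> (q - 798/97) ^ 2" by simp
    then show ?thesis by (simp add: power2_eq_square field_simps)
  qed
  finally show ?thesis by (simp add: q2)
qed

lemma a_bounds: "1 \<le> a" "a \<le> (1585/100)"
proof -
  have u0: "u > 0" using u_ge_19 by simp
  have "0 \<le> 45 * m * z / u" using u0 m1 z_ge by simp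
  then show "1 \<le> a" by (simp add: a_def)
  have "45 * m * z / u \<le> (1485/100)" using mz_u u0 by (simp add: pos_divide_le_eq)
  then show "a \<le> (1585/100)" by (simp add: a_def)
qed

text \<open>The net gain per unit of \<open>r\<close> in \<open>numeric_remainder\<close>: u - z
  from log r, minus 1 from Stirling's formula, minus \<open>z\<close> for log c, minus (m + 1)(z +
  7/4) for the discarded small primes.\<close>

definition D where "D = u - (m + 3) * z - 1 - 7/4 * (m + 1)"

text \<open>With D = u - B, and as a >= 1, it suffices that (B + 1/10) a <= 45 m z, where
  \<open>B\<close> is of order m z. The surplus 1/10 is kept for the terms that are not proportional
  to \<open>r\<close>.\<close>

lemma aD: "a * D \<ge> u + (1/10)"
proof -
  have u0: "u > 0" using u_ge_19 by simp
  define B where "B = (m + 3) * z + 1 + 7/4 * (m + 1)"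
  have "(B + (1/10)) * a \<le> 45 * m * z"
  proof -
    have B: "B + (1/10) \<le> z * ((m + 3) + (7/4 * m + (285/100)) / (298/100))"
    proof -
      define W where "W = 7/4 * m + (285/100)"
      have "W * 1 \<le> W * (z / (298/100))"
        using z_ge m1 by (intro mult_left_mono) (auto simp: W_def)
      moreover have "B + (1/10) = (m + 3) * z + W" by (simp add: B_def W_def field_simps)
      moreover have "z * ((m + 3) + W / (298/100)) = (m + 3) * z + W * (z / (298/100))"
        by (simp add: distrib_left mult.commute)
      ultimately show ?thesis unfolding W_def[symmetric] by linarith
    qed
    define t where "t = z / u"
    have at: "a = 1 + 45 * m * t" by (simp add: a_def t_def)
    \<comment> \<open>For \<open>m >= 4\<close> the uniform bound on \<open>a\<close> suffices. For
      smaller \<open>m\<close> the ratio z/u is bounded more sharply, from a lower bound for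
      \<open>u\<close> that belongs to that \<open>m\<close>.\<close>
    have key: "((m + 3) + (7/4 * m + (285/100)) / (298/100)) * a \<le> 45 * m"
      using m
    proof (elim disjE)
      assume m': "m = 1"
      have "t \<le> (1515/10000)" unfolding t_def using z_le u_ge_19 u0 by (simp add: pos_divide_le_eq)
      then show ?thesis unfolding at using m' by simp
    next
      assume m': "m = 2"
      have "u \<ge> (288/10)" using u_ge m' by simp
      then have "t \<le> (12/100)" unfolding t_def using z_le u0 by (simp add: pos_divide_le_eq)
      then show ?thesis unfolding at using m' by simp
    next
      assume m': "m = 3"
      have "u \<ge> (398/10)" using u_ge m' by simp
      then have "t \<le> (101/1000)" unfolding t_def using z_le u0 by (simp add: pos_divide_le_eq)
      then show ?thesis unfolding at using m' by simp
    next
      assume m': "m \<ge> 4"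
      have "((m + 3) + (7/4 * m + (285/100)) / (298/100)) * a \<le> ((m + 3) + (7/4 * m + (285/100)) / (298/100)) * (1585/100)"
        using a_bounds m1 by (intro mult_left_mono) auto
      also have "\<dots> \<le> 45 * m" using m' by (simp add: field_simps)
      finally show ?thesis .
    qed
    have "(B + (1/10)) * a \<le> z * ((m + 3) + (7/4 * m + (285/100)) / (298/100)) * a"
      using B a_bounds by (intro mult_right_mono) auto
    also have "\<dots> \<le> z * (45 * m)" using key z_ge by (simp add: mult.assoc mult_left_mono)
    finally show ?thesis by (simp add: mult_ac)
  qed
  moreover have "a * u = u + 45 * m * z" using u0 by (simp add: a_def field_simps)
  moreover have "a * D = a * u - B * a" by (simp add: D_def B_def algebra_simps)
  moreover have "(B + (1/10)) * a = B * a + (1/10) * a" by (simp add: distrib_right)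
  ultimately show ?thesis using a_bounds(1) by linarith
qed

definition X where "X = exp u / u"

lemma ln_X: "ln X = u - z"
  using u_ge_19 by (simp add: X_def ln_div z)

text \<open>The exponential is estimated from below by the 8-th power of a quadratic Taylor
  polynomial, itself above the line (3/10) u. So X dominates the lower order terms in
  \<open>tiny\<close>.\<close>

lemma X_big: "X \<ge> 20 * u ^ 2"
proof -
  have u0: "u > 0" using u_ge_19 by simp
  have "(3/10) * u \<le> 1 + u / 8 + (u / 8) ^ 2 / 2"
  proof -
    have "0 \<le> (u - 112/10) ^ 2" by simp
    then show ?thesis by (simp add: power2_eq_square field_simps)
  qed
  then have "((3/10) * u) ^ 8 \<le> (1 + u / 8 + (u / 8) ^ 2 / 2) ^ 8" using u0 by (intro power_mono) auto
  also have "\<dots> \<le> exp (u / 8) ^ 8"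
    using u0 exp_lower_Taylor_quadratic[of "u / 8"] by (intro power_mono) auto
  also have "\<dots> = exp u" by (simp add: exp_of_nat_mult[symmetric])
  finally have e: "((3/10) * u) ^ 8 \<le> exp u" .
  have "(19::real) ^ 5 \<le> u ^ 5" using u_ge_19 by (intro power_mono) auto
  then have "20 * u ^ 3 \<le> (3/10) ^ 8 * u ^ 5 * u ^ 3" using u0 by (intro mult_right_mono) (auto simp: power_numeral_reduce)
  also have "\<dots> = ((3/10) * u) ^ 8" by (simp only: power_mult_distrib mult.assoc power_add[symmetric]) simp
  finally have "20 * u ^ 3 \<le> exp u" using e by linarith
  then show ?thesis using u0 by (simp add: X_def pos_le_divide_eq power_numeral_reduce mult_ac)
qed

lemma X_pos: "X > 0" "X \<ge> 100"
proof -
  have "u ^ 2 \<ge> 19 ^ 2" using u_ge_19 by (intro power_mono) auto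
  then show "X \<ge> 100" using X_big by simp
  then show "X > 0" by simp
qed

lemma y_ge: "ln X \<ge> 16" using ln_X z_le u_ge_19 by linarith

lemma ln_y: "ln (ln X) \<le> z"
  unfolding z using y_ge ln_X z_ge by (intro ln_mono) auto

lemma small_terms:
  assumes "0 < R" "R \<le> 17 * X"
  shows "ln (m * R) \<le> u + (46/100) * z" and "ln (1 + m * (m * R)) \<le> (29/10) + z + u"
proof -
  have l17: "ln (17::real) \<le> (285/100)" "ln (18::real) \<le> (29/10)"
    using ln_le_tangent_3[of 17] ln_le_tangent_3[of 18] by auto
  have "ln R \<le> ln (17 * X)" using assms by (intro ln_mono) auto
  also have "\<dots> = ln 17 + (u - z)" using X_pos by (simp add: ln_mult ln_X)
  finally have lR: "ln R \<le> (285/100) + u - z" using l17 by linarith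
  have "ln (m * R) = ln m + ln R" using m1 assms by (simp add: ln_mult)
  then show "ln (m * R) \<le> u + (46/100) * z" using lR ln_m z_ge by linarith
  have "1 + m * (m * R) \<le> 18 * (m * m * X)"
  proof -
    have mm: "m * m \<ge> 1" using mult_mono[of 1 m 1 m] m1 by simp
    have "m * m * R \<le> m * m * (17 * X)" using assms mm by (intro mult_left_mono) auto
    moreover have "1 \<le> m * m * X" using mult_mono[of 1 "m * m" 1 X] mm X_pos by simp
    ultimately show ?thesis by (simp add: mult.assoc)
  qed
  then have "ln (1 + m * (m * R)) \<le> ln (18 * (m * m * X))"
    using m1 assms by (intro ln_mono) (auto intro: add_pos_pos)
  also have "\<dots> = ln 18 + 2 * ln m + (u - z)"
    using m1 X_pos by (simp add: ln_mult ln_X)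
  finally show "ln (1 + m * (m * R)) \<le> (29/10) + z + u" using l17 ln_m z_ge by linarith
qed

lemma tiny: "2 * m * (u + (146/100) * z) + ((29/10) + z + u) \<le> X" "m * (z + 7/4) + ((29/10) + z + u) < (1/10) * X"
proof -
  have "(m + 3) ^ 2 = m * m + 6 * m + 9" by (simp add: power2_eq_square algebra_simps)
  moreover have "m * m \<ge> 0" by simp
  ultimately have "m \<le> u" using u_ge m1 by linarith
  have zu: "z \<le> u / 6" by (rule z_le_u)
  have u1: "(29/10) \<le> u / 6" "7/4 \<le> u / 6" using u_ge_19 by simp_all
  have u0: "u \<ge> 1" using u_ge_19 by simp
  have uu: "u \<le> u * u" using u0 by simp
  have "2 * m * (u + (146/100) * z) \<le> 2 * u * (2 * u)"
    using \<open>m \<le> u\<close> zu u0 z_ge m1 by (intro mult_mono) auto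
  moreover have "2 * u * (2 * u) = 4 * (u * u)" by simp
  moreover have "(29/10) + z + u \<le> (14/10) * (u * u)" using u1 zu uu by linarith
  ultimately have "2 * m * (u + (146/100) * z) + ((29/10) + z + u) \<le> 20 * u ^ 2"
    using uu u0 unfolding power2_eq_square by linarith
  then show "2 * m * (u + (146/100) * z) + ((29/10) + z + u) \<le> X" using X_big by linarith
  have "m * (z + 7/4) \<le> u * (u / 3)" using \<open>m \<le> u\<close> zu u1 u0 z_ge m1 by (intro mult_mono) auto
  then have "m * (z + 7/4) + ((29/10) + z + u) < 2 * (u * u)"
    using \<open>(29/10) + z + u \<le> (14/10) * (u * u)\<close> uu u0 by (simp only: times_divide_eq_right)
  then show "m * (z + 7/4) + ((29/10) + z + u) < (1/10) * X" using X_big by (simp add: power2_eq_square)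
qed

text \<open>In the following two bounds \<open>r\<close> is the number of conditions imposed at each node.\<close>

lemma numeric_remainder:
  assumes r: "a * X \<le> r" "r + 1 \<le> 17 * X"
  shows "ln (1 + m * (m * (r + 1))) + exp u + r * ln c + (m * (r + 1) + r) * (ln (ln X) + 7/4) < r * ln r - r"
proof -
  have aX: "a * X \<ge> X" using a_bounds X_pos by simp
  then have r0: "r \<ge> X" "r > 0" using r X_pos by linarith+
  have lnr: "ln r \<ge> u - z" using r0 X_pos ln_X by (metis ln_mono)
  have D0: "D > 0"
  proof (rule ccontr)
    assume "\<not> D > 0"
    then have "a * D \<le> 0" using a_bounds by (simp add: mult_nonneg_nonpos)
    then show False using aD u_ge_19 by linarith
  qed
  have "exp u = X * u" using u_ge_19 by (simp add: X_def)
  \<comment> \<open>As \<open>exp u\<close> is log H, this chain compares log H plus a margin of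
    X/10 with the gain \<open>r * D\<close>.\<close>
  then have "exp u + (1/10) * X = X * (u + (1/10))" by (simp add: distrib_left)
  also have "\<dots> \<le> X * (a * D)" using aD X_pos by (intro mult_left_mono) auto
  also have "\<dots> = (a * X) * D" by simp
  also have "\<dots> \<le> r * D" using r D0 by (intro mult_right_mono) auto
  finally have 1: "exp u + (1/10) * X \<le> r * D" .
  have 2: "ln (1 + m * (m * (r + 1))) \<le> (29/10) + z + u" using small_terms(2)[of "r + 1"] r r0 by simp
  have 3: "r * ln c \<le> r * z" using ln_c r0 by (intro mult_left_mono) auto
  have 4: "(m * (r + 1) + r) * (ln (ln X) + 7/4) \<le> (m * (r + 1) + r) * (z + 7/4)"
    using ln_y r0 m1 by (intro mult_left_mono) auto
  have 5: "r * (u - z) \<le> r * ln r" using lnr r0 by (intro mult_left_mono) auto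
  \<comment> \<open>All losses proportional to \<open>r\<close> are collected in \<open>D\<close>;
    the rest, \<open>m * (z + 7/4)\<close> and one logarithm, fits into the margin.\<close>
  have "r * D = r * (u - z) - r - r * z - (m * (r + 1) + r) * (z + 7/4) + m * (z + 7/4)"
    by (simp add: D_def algebra_simps)
  moreover have "(29/10) + z + u + m * (z + 7/4) < (1/10) * X" using tiny(2) by linarith
  ultimately show ?thesis using 1 2 3 4 5 by linarith
qed

text \<open>The constant 114 splits into 45 from the surplus in \<open>a\<close>, 24 from the terms
  with factor 146/100 * a, where a <= 1585/100, and another 45 as reserve for the lower order terms.
  The leading term m X u is m log H.\<close>

lemma numeric_size:
  assumes r: "r \<le> a * X + 1" "r > 0"
  shows "m * (r + 1) * ln (m * (r + 1)) + ln (1 + m * (m * (r + 1))) + r * ln c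
    < m * exp u + 114 * m ^ 2 * (z / u) * exp u"
proof -
  define R where "R = r + 1"
  have aX: "a * X \<le> (1585/100) * X" using a_bounds X_pos by (intro mult_right_mono) auto
  have R: "R \<le> a * X + 2" "R > 0" "R \<le> 17 * X" using r aX X_pos unfolding R_def by linarith+
  have u0: "u > 0" using u_ge_19 by simp
  have 1: "m * R * ln (m * R) \<le> m * R * (u + (46/100) * z)"
    using small_terms(1)[OF R(2,3)] m1 R by (intro mult_left_mono) auto
  have 2: "ln (1 + m * (m * R)) \<le> (29/10) + z + u" by (rule small_terms(2)[OF R(2,3)])
  have 3: "r * ln c \<le> m * R * z"
  proof -
    have "r * ln c \<le> r * z" using ln_c r by (intro mult_left_mono) auto
    also have "\<dots> \<le> R * z" using z_ge by (simp add: R_def)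
    also have "\<dots> \<le> m * (R * z)" using m1 R z_ge mult_right_mono[of 1 m "R * z"] by simp
    finally show ?thesis by (simp add: mult.assoc)
  qed
  have "m * R * (u + (146/100) * z) \<le> m * (a * X + 2) * (u + (146/100) * z)"
    using R m1 u0 z_ge by (intro mult_right_mono mult_left_mono) auto
  moreover have "m * (a * X + 2) * (u + (146/100) * z)
      = m * X * (a * u) + m * X * ((146/100) * a * z) + 2 * m * (u + (146/100) * z)"
    by (simp add: algebra_simps)
  moreover have au: "a * u = u + 45 * m * z" using u0 by (simp add: a_def field_simps)
  moreover have "m * X * ((146/100) * a * z) \<le> m * X * (24 * (m * z))"
  proof -
    have "(146/100) * a * z \<le> 24 * (m * z)"
      using mult_mono[of "(146/100) * a" "24 * m" z z] a_bounds m1 z_ge by simp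
    then show ?thesis using m1 X_pos by (intro mult_left_mono) auto
  qed
  moreover have "m * X * (a * u) + m * X * (24 * (m * z)) = m * X * (u + 69 * m * z)"
    unfolding au by (simp add: algebra_simps)
  ultimately have 4: "m * R * (u + (146/100) * z) \<le> m * X * (u + 69 * m * z) + 2 * m * (u + (146/100) * z)"
    by linarith
  have 5: "m * X * (u + 69 * m * z) + X < m * X * (u + 114 * m * z)"
  proof -
    have "1 * 1 * 1 < m * m * (45 * z)" using m1 z_ge mult_mono[of 1 m 1 m] by (intro mult_le_less_imp_less) auto
    then have "X * 1 < X * (m * m * (45 * z))" using X_pos by (intro mult_strict_left_mono) auto
    then show ?thesis by (simp add: algebra_simps)
  qed
  have 6: "m * X * (u + 114 * m * z) = m * exp u + 114 * m ^ 2 * (z / u) * exp u"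
    using u0 by (simp add: X_def field_simps power2_eq_square)
  have "m * R * (u + (46/100) * z) + m * R * z = m * R * (u + (146/100) * z)" by (simp add: algebra_simps)
  then show ?thesis using 1 2 3 4 5 6 tiny(1) unfolding R_def[symmetric] by linarith
qed

end

section \<open>The lower bound\<close>

lemma c1_pos: "c1 m a > 0"
  unfolding c1_def
proof (intro prod_pos mult_pos_pos)
  fix v :: "'a \<Rightarrow> real" and i
  have "1 \<le> Max (insert 1 ((\<lambda>j. place_norm v (a j)) ` {1..m}))" by (intro Max_ge) auto
  then have pos: "0 < Max (insert 1 ((\<lambda>j. place_norm v (a j)) ` {1..m}))" by linarith
  then show "0 < Max (insert 1 ((\<lambda>j. place_norm v (a j)) ` {1..m})) ^ m" by (rule zero_less_power)
  have "place_norm v (a i) \<ge> 0" by (simp add: place_norm_def)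
  then show "0 < place_norm v (a i) + Max (insert 1 ((\<lambda>j. place_norm v (a j)) ` {1..m}))"
    using pos by (rule add_nonneg_pos)
qed

theorem theorem2:
  fixes m :: nat
    and \<alpha> l :: "nat \<Rightarrow> 'k::field_char_0"
    and H s :: real
  assumes "number_field TYPE('k)"
    and "m \<ge> 1"
    and "\<And>j. j \<in> {1..m} \<Longrightarrow> algebraic_int (\<alpha> j) \<and> \<alpha> j \<noteq> 0"
    and "inj_on \<alpha> {1..m}"
    and "s = Max {exp (real (nf_degree TYPE('k))) + 1, c1 m \<alpha> + 1, (real m + 3)^2 + 1}"
    and "H > 0"
    and "ln H \<ge> s * exp s"
    and "\<And>i. i \<in> {0..m} \<Longrightarrow> algebraic_int (l i)"
    and "\<exists>i\<in>{0..m}. l i \<noteq> 0"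
    and "(\<Prod>v\<in>arch_places. Max ((\<lambda>i. place_norm v (l i)) ` {0..m})) \<le> H"
  shows "\<exists>p::nat. prime p \<and>
           real p \<in> {ln (ln H / ln (ln H)) <..< 17 * real m * ln H / ln (ln H)} \<and>
           (\<exists>w::'k \<Rightarrow> real. place_over p w \<and>
              completion_norm w (linear_form w m l \<alpha>)
                > H powr (- (real m + 1) - 114 * (real m)^2 * (ln (ln (ln H)) / ln (ln H))))"
proof -
  note nf = assms(1) and H0 = assms(6)
  define u where "u = ln (ln H)"
  define z where "z = ln u"
  define c where "c = c1 m \<alpha>"
  have s_ge: "s \<ge> c + 1" "s \<ge> (real m + 3) ^ 2 + 1" unfolding assms(5) c_def by auto
  have c0: "c > 0" unfolding c_def by (rule c1_pos)
  have s0: "s > 0" using s_ge(1) c0 by linarith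
  have lnH: "ln H > 0" using assms(7) s0 by (smt (verit) mult_pos_pos exp_gt_zero)
  have eu: "exp u = ln H" using lnH by (simp add: u_def)
  \<comment> \<open>The logarithmic form of the hypothesis on \<open>H\<close> is u >= s + ln s,
    from which all numerical bounds start.\<close>
  have "ln (s * exp s) \<le> u" unfolding u_def using assms(7) s0 by (intro ln_mono) auto
  then have u_ge: "s + ln s \<le> u" using s0 by (simp add: ln_mult)
  interpret parameters "real m" s u z c
  proof
    show "real m = 1 \<or> real m = 2 \<or> real m = 3 \<or> 4 \<le> real m" using assms(2) by auto
  qed (use s_ge u_ge c0 in \<open>auto simp: z_def\<close>)
  have X: "X = ln H / ln (ln H)" unfolding X_def eu unfolding u_def ..
  \<comment> \<open>\<open>numeric_remainder\<close> asks for \<open>r >= a * X\<close> and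
    \<open>numeric_size\<close> for \<open>r <= a * X + 1\<close>.\<close>
  define r where "r = nat \<lceil>a * X\<rceil>"
  have aX: "X \<le> a * X" "a * X \<le> 1585/100 * X"
    using a_bounds X_pos by (auto intro: mult_right_mono)
  have r: "a * X \<le> real r" "real r \<le> a * X + 1"
    using aX X_pos unfolding r_def by linarith+
  have "real r > 0" using r aX X_pos by linarith
  then have r0: "r > 0" by simp
  have r17: "real r + 1 < 17 * X" using r aX X_pos by linarith
  \<comment> \<open>The upper end comes from m (r + 1) < 17 m X, which bounds the factorials
    involved; the lower end is the cut below which primes are discarded.\<close>
  define S where "S = {p. prime p \<and> ln X < real p \<and> real p < 17 * real m * X}"
  have S: "finite S" "\<And>p. p \<in> S \<Longrightarrow> prime p"
  proof -
    have "S \<subseteq> {..nat \<lceil>17 * real m * X\<rceil>}" unfolding S_def by (auto; linarith)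
    then show "finite S" by (rule finite_subset) simp
  qed (simp add: S_def)
  \<comment> \<open>The bound of \<open>prod_place_norm_pade_value\<close> for the product of the
    normalised Archimedean values of W.\<close>
  define G where "G n = fact (m * r + n) * (1 + real m * real (m * r + n)) * H * c ^ r" for n
  have G0: "G n > 0" for n unfolding G_def using H0 c0 by (intro mult_pos_pos) (auto simp: add_pos_nonneg)
  have lnG: "ln (G n) = ln (fact (m * r + n)) + ln (1 + real m * real (m * r + n)) + exp u + real r * ln c" for n
  proof -
    have "1 + real m * real (m * r + n) > 0" by (simp add: add_pos_nonneg)
    then show ?thesis unfolding G_def using H0 c0 by (simp add: ln_mult ln_realpow eu del: of_nat_add of_nat_mult)
  qed
  have A_le: "real (m * r + n) \<le> real m * (real r + 1)" if "n \<le> m" for n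
    using that by (simp add: distrib_left)
  have A_ln: "ln (1 + real m * real (m * r + n)) \<le> ln (1 + real m * (real m * (real r + 1)))" if "n \<le> m" for n
    using A_le[OF that] by (intro ln_mono add_left_mono mult_left_mono) (auto simp: add_pos_nonneg)
  have small: "G n < real (\<Prod>p\<in>S. p ^ multiplicity p (fact (m * r + n) * fact r))" if n: "n \<le> m" for n
  proof -
    define A where "A = m * r + n"
    define E where "E = (real A + real r) * (ln (ln X) + 7/4)"
    define P where "P = real (\<Prod>p\<in>S. p ^ multiplicity p (fact A * fact r))"
    have "fact A * fact r \<le> P * exp E"
      unfolding P_def E_def
    proof (rule fact_product_split[OF y_ge _ S])
      show "r \<le> A" using assms(2) by (simp add: A_def trans_le_add1)
      fix p assume p: "prime p" "ln X < real p" "p \<le> A"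
      have "real p \<le> real (m * r + n)" using p(3) unfolding A_def by (rule of_nat_mono)
      also have "\<dots> \<le> real m * (real r + 1)" by (rule A_le[OF n])
      finally have "real p \<le> real m * (real r + 1)" .
      also have "\<dots> < real m * (17 * X)" using r17 assms(2) by (intro mult_strict_left_mono) auto
      finally show "p \<in> S" using p by (simp add: S_def mult_ac)
    qed
    \<comment> \<open>\<open>fact A\<close> occurs on both sides and cancels; what is left compares
      log H and the losses with ln r! >= r ln r - r.\<close>
    moreover have "G n * exp E < fact A * fact r"
    proof -
      have "E \<le> (real m * (real r + 1) + real r) * (ln (ln X) + 7/4)"
        unfolding E_def using A_le[OF n] y_ge by (intro mult_right_mono) (auto simp: A_def)
      then have "ln (1 + real m * real A) + exp u + real r * ln c + E < real r * ln (real r) - real r"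
        using numeric_remainder[OF r(1)] r17 A_ln[OF n] by (simp add: A_def)
      also have "\<dots> \<le> ln (fact r)" by (rule ln_fact_lower)
      finally have "ln (G n) + E < ln (fact A) + ln (fact r)" using lnG[of n] by (simp add: A_def)
      then have "ln (G n * exp E) < ln (fact A * fact r)" using G0[of n] by (simp add: ln_mult)
      then show ?thesis using G0[of n] by (subst (asm) ln_less_cancel_iff) auto
    qed
    ultimately have "G n * exp E < P * exp E" by linarith
    then show ?thesis by (simp add: P_def A_def)
  qed
  obtain n p w where n: "n \<le> m" and p: "p \<in> S" and w: "place_over p w"
    and lb: "1 \<le> G n * completion_norm w (linear_form w m l \<alpha>)"
    using linear_form_lower_bound[OF nf r0 assms(3,4,8,9,10) S] small unfolding G_def c_def by blast
  \<comment> \<open>The 1 comes from the factor \<open>H\<close> in \<open>G\<close>; the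
    \<open>m\<close> and the correction come from the remaining factors, through
    \<open>numeric_size\<close>.\<close>
  define e where "e = (real m + 1) + 114 * (real m) ^ 2 * (z / u)"
  have "G n < H powr e"
  proof -
    define A where "A = m * r + n"
    have "A \<ge> 1" using assms(2) r0 by (simp add: A_def Suc_le_eq)
    then have A1: "real A \<ge> 1" by simp
    have "(fact A :: real) \<le> real A ^ A" using fact_le_power[of A, where 'a = real] by simp
    then have "ln (fact A :: real) \<le> ln (real A ^ A)" by (intro ln_mono) auto
    also have "\<dots> = real A * ln (real A)" using A1 by (simp add: ln_realpow)
    also have "\<dots> \<le> (real m * (real r + 1)) * ln (real m * (real r + 1))"
      using A1 A_le[OF n] by (intro mult_mono ln_mono) (auto simp: A_def)
    finally have "ln (G n) < exp u + (real m * exp u + 114 * real m ^ 2 * (z / u) * exp u)"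
      using numeric_size[OF r(2)] r0 A_ln[OF n] lnG[of n] by (simp add: A_def)
    also have "\<dots> = e * ln H" by (simp add: e_def eu algebra_simps)
    finally have "ln (G n) < ln (H powr e)" using H0 by (simp add: ln_powr)
    then show ?thesis using G0[of n] H0 by (subst (asm) ln_less_cancel_iff) auto
  qed
  then have "1 < H powr e * completion_norm w (linear_form w m l \<alpha>)"
  proof -
    assume less: "G n < H powr e"
    have "0 < G n * completion_norm w (linear_form w m l \<alpha>)" using lb by linarith
    then have "completion_norm w (linear_form w m l \<alpha>) > 0" using G0[of n] by (rule zero_less_mult_pos)
    with less have "G n * completion_norm w (linear_form w m l \<alpha>)
        < H powr e * completion_norm w (linear_form w m l \<alpha>)" by (rule mult_strict_right_mono)
    then show ?thesis using lb by linarith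
  qed
  then have "H powr (- e) < completion_norm w (linear_form w m l \<alpha>)"
    using H0 by (simp add: powr_minus field_simps)
  moreover have "- e = - (real m + 1) - 114 * (real m) ^ 2 * (ln (ln (ln H)) / ln (ln H))"
    by (simp add: e_def z_def u_def)
  ultimately have "completion_norm w (linear_form w m l \<alpha>)
      > H powr (- (real m + 1) - 114 * (real m) ^ 2 * (ln (ln (ln H)) / ln (ln H)))" by simp
  moreover have "real p \<in> {ln (ln H / ln (ln H)) <..< 17 * real m * ln H / ln (ln H)}"
    using p by (simp add: S_def X)
  ultimately show ?thesis using p w by (auto simp: S_def)
qed

end
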